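(* Let $\pi$ be an irreducible cuspidal representation of $G=GL_n(E)$. Then there exists a nonzero constant $\gamma(\pi,\psi,As)\in\mathbb{C}$ such that for every $W\in\mathcal{W}(\pi,\psi_E)$ and every function $\varphi:F^n\to\mathbb{C}$ with $\varphi(0)=0$, \[ \gamma(\pi,\psi,As)\,Z(W,\varphi;\psi)=Z(\widetilde W,\mathcal{F}_\psi\varphi;\psi^{-1}). \]
   Context: Let $F=\mathbb{F}_q$ be a finite field and $E=\mathbb{F}_{q^2}$ its quadratic extension, with nontrivial Galois automorphism $\theta(x)=x^q$ (applied entrywise to matrices). Fix a nontrivial additive character $\psi$ of $F$, fix $z\in E\setminus F$, and set $\psi_E(x)=\psi\big(\frac{x-\theta(x)}{z-\theta(z)}\big)$; this is a nontrivial additive character of $E$, trivial on $F$. Put $G=GL_n(E)$, $H=GL_n(F)$. For a commutative ring $R$, $N_n(R)$ denotes the upper triangular unipotent $n\times n$ matrices over $R$, and a character $\psi_R$ of $R$ is extended to $N_n(R)$ by $\psi_R(u)=\psi_R(\sum_{i=1}^{n-1}u_{i,i+1})$. An irreducible representation $\pi$ of $G$ is generic if $\mathrm{Hom}_{N_n(E)}(\pi,\psi_E)\neq0$ (this space then has dimension one); for a nonzero $\ell$ in it, the Whittaker model $\mathcal{W}(\pi,\psi_E)$ is the space of functions $W_v(g)=\ell(\pi(g)v)$. $\pi$ is cuspidal if it has no nonzero vectors fixed by the unipotent radical of any proper standard parabolic subgroup (cuspidal representations are generic). For $W\in\mathcal{W}(\pi,\psi_E)$ put $\widetilde W(g)=W(\omega_n\,{}^tg^{-1})$,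 where $\omega_n$ is the antidiagonal permutation matrix; then $\widetilde W\in\mathcal{W}(\widetilde\pi,\psi_E^{-1})$, $\widetilde\pi$ the contragredient. Vectors in $F^n$ are rows, $e_1=(1,0,\dots,0)$, $e_n=(0,\dots,0,1)$, $\langle x,y\rangle=\sum x_iy_i$. For $\varphi:F^n\to\mathbb{C}$, $\mathcal{F}_\psi\varphi(y)=\sum_{x\in F^n}\varphi(x)\psi(\langle x,y\rangle)$. For a Whittaker function $W$ (with respect to $\psi_E$ or $\psi_E^{-1}$) define $Z(W,\varphi;\psi^{\pm1})=\sum_{g\in N_n(F)\backslash H}W(g)\varphi(e_ng)$. *)

theory Defs
  imports "Jordan_Normal_Form.Matrix"
begin

text \<open>E is modelled as a finite field type 'e with CARD('e) = q^2; F is the subfield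
  of elements fixed by the Frobenius theta x = x^q.\<close>

definition Fsub :: "nat \<Rightarrow> 'a::field set" where
  "Fsub q = {x. x ^ q = x}"

definition frob :: "nat \<Rightarrow> 'a::field \<Rightarrow> 'a" where
  "frob q x = x ^ q"

definition psiE :: "nat \<Rightarrow> 'a::field \<Rightarrow> ('a \<Rightarrow> complex) \<Rightarrow> 'a \<Rightarrow> complex" where
  "psiE q z psi x = psi ((x - frob q x) / (z - frob q z))"

definition GL :: "nat \<Rightarrow> 'a::field mat set" where
  "GL n = {g \<in> carrier_mat n n. invertible_mat g}"

definition GL_sub :: "nat \<Rightarrow> 'a::field set \<Rightarrow> 'a mat set" where
  "GL_sub n K = {g \<in> GL n. \<forall>i<n. \<forall>j<n. g $$ (i,j) \<in> K}"

definition unip :: "nat \<Rightarrow> 'a::field set \<Rightarrow> 'a mat set" where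
  "unip n R = {u \<in> carrier_mat n n. (\<forall>i<n. u $$ (i,i) = 1) \<and> (\<forall>i<n. \<forall>j<i. u $$ (i,j) = 0)
      \<and> (\<forall>i<n. \<forall>j<n. u $$ (i,j) \<in> R)}"

definition psiN :: "('a::field \<Rightarrow> complex) \<Rightarrow> nat \<Rightarrow> 'a mat \<Rightarrow> complex" where
  "psiN chi n u = chi (\<Sum>i<n-1. u $$ (i, i+1))"

definition is_rep :: "nat \<Rightarrow> nat \<Rightarrow> ('a::field mat \<Rightarrow> complex mat) \<Rightarrow> bool" where
  "is_rep n d rho \<longleftrightarrow> (\<forall>g\<in>GL n. rho g \<in> carrier_mat d d)
     \<and> (\<forall>g\<in>GL n. \<forall>h\<in>GL n. rho (g * h) = rho g * rho h)
     \<and> rho (1\<^sub>m n) = 1\<^sub>m d"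

definition is_subspace :: "nat \<Rightarrow> complex vec set \<Rightarrow> bool" where
  "is_subspace d S \<longleftrightarrow> S \<subseteq> carrier_vec d \<and> 0\<^sub>v d \<in> S
     \<and> (\<forall>v\<in>S. \<forall>w\<in>S. v + w \<in> S) \<and> (\<forall>c. \<forall>v\<in>S. c \<cdot>\<^sub>v v \<in> S)"

definition irreducible_rep :: "nat \<Rightarrow> nat \<Rightarrow> ('a::field mat \<Rightarrow> complex mat) \<Rightarrow> bool" where
  "irreducible_rep n d rho \<longleftrightarrow> is_rep n d rho \<and> d > 0 \<and>
     (\<forall>S. is_subspace d S \<and> (\<forall>g\<in>GL n. \<forall>v\<in>S. rho g *\<^sub>v v \<in> S)
          \<longrightarrow> S = {0\<^sub>v d} \<or> S = carrier_vec d)"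

text \<open>Unipotent radical of the standard parabolic subgroup whose blocks are cut at the
  positions in C (a subset of {1..<n}; C nonempty iff the parabolic is proper).
  Indices are 0-based: entry (i,j), i<j, is free iff i and j lie in different blocks.\<close>
definition unip_radical :: "nat \<Rightarrow> nat set \<Rightarrow> 'a::field mat set" where
  "unip_radical n C = {u \<in> carrier_mat n n. \<forall>i<n. \<forall>j<n.
      (i = j \<longrightarrow> u $$ (i,j) = 1) \<and>
      (i \<noteq> j \<and> \<not> (\<exists>c\<in>C. i < c \<and> c \<le> j) \<longrightarrow> u $$ (i,j) = 0)}"

definition cuspidal_rep :: "nat \<Rightarrow> nat \<Rightarrow> ('a::field mat \<Rightarrow> complex mat) \<Rightarrow> bool" where
  "cuspidal_rep n d rho \<longleftrightarrow> (\<forall>C. C \<noteq> {} \<and> C \<subseteq> {1..<n} \<longrightarrow>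
     (\<forall>v\<in>carrier_vec d. (\<forall>u\<in>(unip_radical n C :: 'a mat set). rho u *\<^sub>v v = v) \<longrightarrow> v = 0\<^sub>v d))"

definition is_whittaker_functional ::
  "nat \<Rightarrow> nat \<Rightarrow> ('a::field mat \<Rightarrow> complex mat) \<Rightarrow> ('a \<Rightarrow> complex) \<Rightarrow> complex vec \<Rightarrow> bool" where
  "is_whittaker_functional n d rho chi l \<longleftrightarrow> l \<in> carrier_vec d \<and>
     (\<forall>u\<in>unip n UNIV. \<forall>w\<in>carrier_vec d. l \<bullet> (rho u *\<^sub>v w) = psiN chi n u * (l \<bullet> w))"

definition whittaker_fun :: "('a mat \<Rightarrow> complex mat) \<Rightarrow> complex vec \<Rightarrow> complex vec \<Rightarrow> 'a mat \<Rightarrow> complex" where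
  "whittaker_fun rho l v g = l \<bullet> (rho g *\<^sub>v v)"

definition omega :: "nat \<Rightarrow> 'a::field mat" where
  "omega n = mat n n (\<lambda>(i,j). if i + j = n - 1 then 1 else 0)"

definition mat_inv :: "nat \<Rightarrow> 'a::field mat \<Rightarrow> 'a mat" where
  "mat_inv n g = (SOME h. h \<in> carrier_mat n n \<and> g * h = 1\<^sub>m n \<and> h * g = 1\<^sub>m n)"

definition wtilde :: "nat \<Rightarrow> ('a::field mat \<Rightarrow> complex) \<Rightarrow> 'a mat \<Rightarrow> complex" where
  "wtilde n W g = W (omega n * transpose_mat (mat_inv n g))"

definition last_row_times :: "nat \<Rightarrow> 'a::field mat \<Rightarrow> 'a vec" where
  "last_row_times n g = transpose_mat g *\<^sub>v unit_vec n (n - 1)"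

definition Ncosets :: "nat \<Rightarrow> 'a::field set \<Rightarrow> 'a mat set set" where
  "Ncosets n K = (\<lambda>g. (\<lambda>u. u * g) ` unip n K) ` GL_sub n K"

definition zeta :: "nat \<Rightarrow> 'a::field set \<Rightarrow> ('a mat \<Rightarrow> complex) \<Rightarrow> ('a vec \<Rightarrow> complex) \<Rightarrow> complex" where
  "zeta n K W phi = (\<Sum>C\<in>Ncosets n K. let g = (SOME g. g \<in> C) in W g * phi (last_row_times n g))"

definition Kvecs :: "nat \<Rightarrow> 'a::field set \<Rightarrow> 'a vec set" where
  "Kvecs n K = {x \<in> carrier_vec n. \<forall>i<n. x $ i \<in> K}"

definition fourier :: "nat \<Rightarrow> 'a::field set \<Rightarrow> ('a \<Rightarrow> complex) \<Rightarrow> ('a vec \<Rightarrow> complex) \<Rightarrow> 'a vec \<Rightarrow> complex" where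
  "fourier n K psi phi y = (\<Sum>x\<in>Kvecs n K. phi x * psi (x \<bullet> y))"

end

theory Submission
  imports Defs "Jordan_Normal_Form.Spectral_Radius" "HOL-Number_Theory.Cong"
begin

text \<open>Write H = GL_n(F) and let P(F) be the stabiliser in H of the last basis row. Since every nonzero
  row is a translate of the last one and phi(0) = 0, both sides of the functional equation are
  determined by two linear functionals on pi invariant under P(F), so it suffices to see
  that these are proportional and nonzero. Expanding a P(F)-invariant functional along the columns of
  N_n(E), from the last to the second, only characters trivial on F occur; P(F) permutes the
  nontrivial ones transitively and the trivial one is killed by cuspidality. Hence such a functional
  is determined by its projection to the Whittaker functionals. These form a line: a function on G
  that is equivariant under N_n(E) on both sides is supported on Bruhat cells of monomial matrices
  fixed by the anti-transpose, so it is invariant under that anti-involution (Gelfand's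
  trick). Both functionals are nonzero because such a function, restricted to the mirabolic subgroup,
  is supported on N_n(E).\<close>

section \<open>Matrix groups over a finite field\<close>

text \<open>The condition phi(0) = 0 reflects the method: H moves the last basis row to every
  nonzero row but never to 0, so nothing is known about the functionals attached to x = 0. On the
  right-hand side the Fourier transform is expanded inside the sum, so that phi itself weights the
  functionals on both sides; the substitution g -> g k^t then makes them shift in x in the same way.
  Only characters trivial on F matter because F is its own annihilator under (t, a) -> psi_E(t a):
  the characters of a column group E^c trivial on F^c are again indexed by F^c, and P(F) can move
  every nonzero index to the last basis vector. The elements that fix this vector contain the group
  of the same kind for the preceding column, which keeps the induction going. Gelfand's trick speaks
  of functions on G, uniqueness of functionals on one representation. The passage between them uses
  averages over G and bilinear pairings on pi, so that the contragredient is never constructed. The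
  constant gamma is b/a, where a and b are the multiples of one fixed Whittaker functional to which
  the two functionals project.\<close>

lemma finite_carrier_mat: "finite (carrier_mat n m :: 'a::finite mat set)"
proof -
  have "carrier_mat n m \<subseteq> (\<lambda>f. mat n m f) ` (({..<n} \<times> {..<m}) \<rightarrow>\<^sub>E (UNIV :: 'a set))"
  proof
    fix A :: "'a mat" assume A: "A \<in> carrier_mat n m"
    have "A = mat n m (restrict (\<lambda>ij. A $$ ij) ({..<n} \<times> {..<m}))"
      using A by (intro eq_matI) auto
    then show "A \<in> (\<lambda>f. mat n m f) ` (({..<n} \<times> {..<m}) \<rightarrow>\<^sub>E (UNIV :: 'a set))"
      by (intro image_eqI[where x = "restrict (\<lambda>ij. A $$ ij) ({..<n} \<times> {..<m})"]) auto
  qed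
  then show ?thesis
    by (rule finite_subset) (intro finite_imageI finite_PiE; simp)
qed

lemma finite_carrier_vec: "finite (carrier_vec n :: 'a::finite vec set)"
proof -
  have "carrier_vec n \<subseteq> (\<lambda>f. vec n f) ` ({..<n} \<rightarrow>\<^sub>E (UNIV :: 'a set))"
  proof
    fix v :: "'a vec" assume v: "v \<in> carrier_vec n"
    have "v = vec n (restrict (\<lambda>i. v $ i) {..<n})"
      using v by (intro eq_vecI) auto
    then show "v \<in> (\<lambda>f. vec n f) ` ({..<n} \<rightarrow>\<^sub>E (UNIV :: 'a set))"
      by (intro image_eqI[where x = "restrict (\<lambda>i. v $ i) {..<n}"]) auto
  qed
  then show ?thesis
    by (rule finite_subset) (intro finite_imageI finite_PiE; simp)
qed

lemma GL_iff:
  "g \<in> GL n \<longleftrightarrow> g \<in> carrier_mat n n \<and> (\<exists>h\<in>carrier_mat n n. g * h = 1\<^sub>m n \<and> h * g = 1\<^sub>m n)"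
proof
  assume g: "g \<in> GL n"
  then have gc: "g \<in> carrier_mat n n" by (simp add: GL_def)
  from g obtain B where B: "g * B = 1\<^sub>m n" "B * g = 1\<^sub>m (dim_row B)"
    using gc by (auto simp: GL_def invertible_mat_def inverts_mat_def)
  have "dim_col B = n" using arg_cong[OF B(1), of dim_col] by simp
  moreover have "dim_row B = n" using arg_cong[OF B(2), of dim_col] gc by simp
  ultimately show "g \<in> carrier_mat n n \<and> (\<exists>h\<in>carrier_mat n n. g * h = 1\<^sub>m n \<and> h * g = 1\<^sub>m n)"
    using gc B by (intro conjI bexI[of _ B]) auto
next
  assume "g \<in> carrier_mat n n \<and> (\<exists>h\<in>carrier_mat n n. g * h = 1\<^sub>m n \<and> h * g = 1\<^sub>m n)"
  then show "g \<in> GL n"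
    by (auto simp: GL_def invertible_mat_def inverts_mat_def)
qed

lemma GL_carrier [simp]: "g \<in> GL n \<Longrightarrow> g \<in> carrier_mat n n"
  by (simp add: GL_def)

lemma finite_GL: "finite (GL n :: 'a::{finite,field} mat set)"
  using finite_subset[of "GL n" "carrier_mat n n"] finite_carrier_mat GL_carrier by blast

lemma GL_one [simp]: "1\<^sub>m n \<in> GL n"
  unfolding GL_iff by (auto intro!: bexI[of _ "1\<^sub>m n"])

lemma mat_inv:
  assumes "g \<in> GL n"
  shows "mat_inv n g \<in> carrier_mat n n" "g * mat_inv n g = 1\<^sub>m n" "mat_inv n g * g = 1\<^sub>m n"
proof -
  have "\<exists>h. h \<in> carrier_mat n n \<and> g * h = 1\<^sub>m n \<and> h * g = 1\<^sub>m n"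
    using assms unfolding GL_iff by blast
  from someI_ex[OF this] show "mat_inv n g \<in> carrier_mat n n" "g * mat_inv n g = 1\<^sub>m n"
    "mat_inv n g * g = 1\<^sub>m n" unfolding mat_inv_def by blast+
qed

lemma mat_inv_GL [simp]: "g \<in> GL n \<Longrightarrow> mat_inv n g \<in> GL n"
  unfolding GL_iff[of "mat_inv n g"] using mat_inv[of g n] GL_carrier[of g n] by blast

lemma mat_inv_cancel:
  assumes "g \<in> GL n" "A \<in> carrier_mat n m"
  shows "g * (mat_inv n g * A) = A" "mat_inv n g * (g * A) = A"
  using assms mat_inv[OF assms(1)] GL_carrier[OF assms(1)]
  by (simp_all flip: assoc_mult_mat[of _ n n _ n _ m])

lemma mat_inv_cancel_right:
  assumes "g \<in> GL n" "A \<in> carrier_mat m n"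
  shows "(A * g) * mat_inv n g = A" "(A * mat_inv n g) * g = A"
  using assms mat_inv[OF assms(1)] GL_carrier[OF assms(1)]
  by (simp_all add: assoc_mult_mat[of _ m n _ n _ n])

lemma mat_inv_unique:
  assumes "g \<in> GL n" "h \<in> carrier_mat n n" "g * h = 1\<^sub>m n"
  shows "mat_inv n g = h"
proof -
  have "mat_inv n g = mat_inv n g * (g * h)"
    using assms(3) mat_inv(1)[OF assms(1)] by simp
  also have "\<dots> = h" using mat_inv_cancel(2)[OF assms(1,2)] .
  finally show ?thesis .
qed

lemma GL_mult [simp]:
  assumes "g \<in> GL n" "h \<in> GL n"
  shows "g * h \<in> GL n"
proof -
  note [simp] = GL_carrier[OF assms(1)] GL_carrier[OF assms(2)] mult_carrier_mat[of _ n n _ n] mat_inv[OF assms(1)] mat_inv[OF assms(2)]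
  have "(g * h) * (mat_inv n h * mat_inv n g) = ((g * h) * mat_inv n h) * mat_inv n g"
    by (rule assoc_mult_mat[symmetric, of _ n n _ n _ n]) auto
  also have "\<dots> = 1\<^sub>m n" using mat_inv_cancel_right(1)[OF assms(2), of g n] by simp
  finally have 1: "(g * h) * (mat_inv n h * mat_inv n g) = 1\<^sub>m n" .
  have "(mat_inv n h * mat_inv n g) * (g * h) = mat_inv n h * (mat_inv n g * (g * h))"
    by (rule assoc_mult_mat[of _ n n _ n _ n]) auto
  also have "\<dots> = 1\<^sub>m n" using mat_inv_cancel(2)[OF assms(1), of h n] by simp
  finally show ?thesis unfolding GL_iff using 1
    by (auto intro!: bexI[of _ "mat_inv n h * mat_inv n g"])
qed

lemma mat_inv_mult:
  assumes "g \<in> GL n" "h \<in> GL n"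
  shows "mat_inv n (g * h) = mat_inv n h * mat_inv n g"
proof (rule mat_inv_unique)
  note [simp] = GL_carrier[OF assms(1)] GL_carrier[OF assms(2)] mult_carrier_mat[of _ n n _ n] mat_inv[OF assms(1)] mat_inv[OF assms(2)]
  have "(g * h) * (mat_inv n h * mat_inv n g) = ((g * h) * mat_inv n h) * mat_inv n g"
    by (rule assoc_mult_mat[symmetric, of _ n n _ n _ n]) auto
  also have "\<dots> = 1\<^sub>m n" using mat_inv_cancel_right(1)[OF assms(2), of g n] by simp
  finally show "(g * h) * (mat_inv n h * mat_inv n g) = 1\<^sub>m n" .
qed (use assms in \<open>auto intro: mat_inv(1)\<close>)

lemma GL_transpose [simp]:
  assumes "g \<in> GL n" shows "transpose_mat g \<in> GL n"
proof -
  note i = mat_inv[OF assms] GL_carrier[OF assms]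
  have "transpose_mat g * transpose_mat (mat_inv n g) = 1\<^sub>m n"
    using transpose_mult[OF i(1) i(4)] i(3) by simp
  moreover have "transpose_mat (mat_inv n g) * transpose_mat g = 1\<^sub>m n"
    using transpose_mult[OF i(4) i(1)] i(2) by simp
  ultimately show ?thesis unfolding GL_iff using i
    by (auto intro!: bexI[of _ "transpose_mat (mat_inv n g)"])
qed

lemma GL_assoc: "a \<in> GL n \<Longrightarrow> b \<in> GL n \<Longrightarrow> c \<in> GL n \<Longrightarrow> (a * b) * c = a * (b * c)"
  by (rule assoc_mult_mat[OF GL_carrier GL_carrier GL_carrier])

lemma GL_if_injective:
  assumes A: "A \<in> carrier_mat n n"
    and inj: "\<And>x. x \<in> carrier_vec n \<Longrightarrow> A *\<^sub>v x = 0\<^sub>v n \<Longrightarrow> x = 0\<^sub>v n"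
  shows "A \<in> GL n"
proof -
  have "det A \<noteq> 0" using det_0_iff_vec_prod_zero[OF A] inj by blast
  from det_non_zero_imp_unit[OF A this, of "()"] show ?thesis
    using A unfolding GL_iff Units_def ring_mat_def by auto
qed

lemma unip_GL:
  fixes u :: "'a::field mat"
  assumes "u \<in> unip n R"
  shows "u \<in> GL n"
proof (rule GL_if_injective)
  show uc: "u \<in> carrier_mat n n" using assms by (simp add: unip_def)
  fix x :: "'a vec" assume x: "x \<in> carrier_vec n" and ux: "u *\<^sub>v x = 0\<^sub>v n"
  \<comment> \<open>Back substitution; the induction variable counts rows from the bottom.\<close>
  have *: "x $ (n - 1 - i) = 0" if "i < n" for i
    using that
  proof (induction i rule: less_induct)
    case (less i)
    let ?k = "n - 1 - i"
    have k: "?k < n" using less.prems by simp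
    have "0 = (u *\<^sub>v x) $ ?k" using ux k by simp
    also have "\<dots> = (\<Sum>j\<in>{0..<n}. u $$ (?k,j) * x $ j)"
      using uc x k by (auto simp: scalar_prod_def)
    also have "\<dots> = (\<Sum>j\<in>{0..<n}. if j = ?k then x $ j else 0)"
    proof (rule sum.cong[OF refl])
      fix j assume j: "j \<in> {0..<n}"
      consider "j < ?k" | "j = ?k" | "j > ?k" by linarith
      then show "u $$ (?k,j) * x $ j = (if j = ?k then x $ j else 0)"
      proof cases
        case 3
        then have "n - 1 - j < i" "j = n - 1 - (n - 1 - j)" using j by auto
        then show ?thesis using less.IH[of "n - 1 - j"] less.prems 3 by auto
      qed (use assms j k in \<open>auto simp: unip_def\<close>)
    qed
    also have "\<dots> = x $ ?k" using k by simp
    finally show ?case by simp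
  qed
  have "x $ j = 0" if "j < n" for j
    using *[of "n - 1 - j"] that by simp
  then show "x = 0\<^sub>v n" using x by (intro eq_vecI) auto
qed

text \<open>Over a finite field inverses follow: left translation by an element is an injective
  self-map of a finite set, hence onto (\<open>mat_group_inv\<close>).\<close>

definition mat_group :: "nat \<Rightarrow> 'a::field mat set \<Rightarrow> bool" where
  "mat_group n S \<longleftrightarrow> S \<subseteq> GL n \<and> 1\<^sub>m n \<in> S \<and> (\<forall>g\<in>S. \<forall>h\<in>S. g * h \<in> S)"

lemma mat_groupD:
  assumes "mat_group n S"
  shows "g \<in> S \<Longrightarrow> g \<in> GL n" "1\<^sub>m n \<in> S" "g \<in> S \<Longrightarrow> h \<in> S \<Longrightarrow> g * h \<in> S"
  using assms unfolding mat_group_def by auto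

lemma mat_group_finite: "mat_group n (S :: 'a::{finite,field} mat set) \<Longrightarrow> finite S"
  using finite_subset[OF _ finite_GL] unfolding mat_group_def by blast

lemma mat_group_GL: "mat_group n (GL n)"
  by (simp add: mat_group_def)

lemma mat_group_bij:
  fixes S :: "'a::{finite,field} mat set"
  assumes S: "mat_group n S" and h: "h \<in> S"
  shows "bij_betw (\<lambda>g. g * h) S S" "bij_betw (\<lambda>g. h * g) S S"
proof -
  note hG = mat_groupD(1)[OF S h]
  have "inj_on (\<lambda>g. g * h) S"
    by (rule inj_on_inverseI[where g = "\<lambda>g. g * mat_inv n h"])
      (rule mat_inv_cancel_right(1)[OF hG GL_carrier[OF mat_groupD(1)[OF S]]])
  moreover have "(\<lambda>g. g * h) ` S \<subseteq> S" using mat_groupD(3)[OF S] h by auto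
  ultimately show "bij_betw (\<lambda>g. g * h) S S"
    using mat_group_finite[OF S] by (simp add: bij_betw_def endo_inj_surj)
  have "inj_on (\<lambda>g. h * g) S"
    by (rule inj_on_inverseI[where g = "\<lambda>g. mat_inv n h * g"])
      (rule mat_inv_cancel(2)[OF hG GL_carrier[OF mat_groupD(1)[OF S]]])
  moreover have "(\<lambda>g. h * g) ` S \<subseteq> S" using mat_groupD(3)[OF S] h by auto
  ultimately show "bij_betw (\<lambda>g. h * g) S S"
    using mat_group_finite[OF S] by (simp add: bij_betw_def endo_inj_surj)
qed

lemma mat_group_sum:
  fixes S :: "'a::{finite,field} mat set" and f :: "'a mat \<Rightarrow> complex"
  assumes S: "mat_group n S" and h: "h \<in> S"
  shows "(\<Sum>g\<in>S. f (g * h)) = (\<Sum>g\<in>S. f g)" "(\<Sum>g\<in>S. f (h * g)) = (\<Sum>g\<in>S. f g)"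
  using sum.reindex_bij_betw[OF mat_group_bij(1)[OF S h], of f]
    sum.reindex_bij_betw[OF mat_group_bij(2)[OF S h], of f] by auto

lemma mat_group_inv:
  fixes S :: "'a::{finite,field} mat set"
  assumes S: "mat_group n S" and h: "h \<in> S"
  shows "mat_inv n h \<in> S"
proof -
  from mat_group_bij(2)[OF S h] mat_groupD(2)[OF S] obtain g where g: "g \<in> S" "h * g = 1\<^sub>m n"
    unfolding bij_betw_def by (metis imageE)
  then show ?thesis using mat_inv_unique[of h n g] mat_groupD(1)[OF S] h by auto
qed

lemma index_mult_sum:
  assumes "A \<in> carrier_mat n n" "B \<in> carrier_mat n n" "i < n" "j < n"
  shows "(A * B) $$ (i,j) = (\<Sum>k<n. A $$ (i,k) * B $$ (k,j))"
  using assms by (auto simp: scalar_prod_def lessThan_atLeast0)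

lemma index_mult_vec_sum:
  assumes "A \<in> carrier_mat n m" "x \<in> carrier_vec m" "i < n"
  shows "(A *\<^sub>v x) $ i = (\<Sum>k<m. A $$ (i,k) * x $ k)"
  using assms by (auto simp: scalar_prod_def lessThan_atLeast0)

lemma unit_row_mult:
  fixes A B :: "'a::semiring_1 mat"
  assumes "A \<in> carrier_mat n n" "B \<in> carrier_mat n n" "i < n" "j < n" "k < n"
    and "\<And>b. b < n \<Longrightarrow> A $$ (i,b) = (if b = k then 1 else 0)"
  shows "(A * B) $$ (i,j) = B $$ (k,j)"
proof -
  have "(A * B) $$ (i,j) = (\<Sum>b<n. if b = k then B $$ (b,j) else 0)"
    unfolding index_mult_sum[OF assms(1-4)] using assms(6) by (intro sum.cong) auto
  then show ?thesis using assms(5) by simp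
qed

lemma unit_col_mult:
  fixes A B :: "'a::semiring_1 mat"
  assumes "A \<in> carrier_mat n n" "B \<in> carrier_mat n n" "i < n" "j < n" "k < n"
    and "\<And>b. b < n \<Longrightarrow> B $$ (b,j) = (if b = k then 1 else 0)"
  shows "(A * B) $$ (i,j) = A $$ (i,k)"
proof -
  have "(A * B) $$ (i,j) = (\<Sum>b<n. if b = k then A $$ (i,b) else 0)"
    unfolding index_mult_sum[OF assms(1-4)] using assms(6) by (intro sum.cong) auto
  then show ?thesis using assms(5) by simp
qed

definition subring :: "'a::field set \<Rightarrow> bool" where
  "subring R \<longleftrightarrow> 0 \<in> R \<and> 1 \<in> R \<and> (\<forall>x\<in>R. \<forall>y\<in>R. x + y \<in> R \<and> x * y \<in> R)"

lemma subring_UNIV: "subring UNIV"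
  by (simp add: subring_def)

lemma subring_sum:
  assumes "subring R" "\<And>i. i \<in> I \<Longrightarrow> f i \<in> R"
  shows "sum f I \<in> R"
  using assms(2) by (induction I rule: infinite_finite_induct) (use assms(1) in \<open>auto simp: subring_def\<close>)

lemma mat_group_GL_sub:
  assumes R: "subring (R :: 'a::field set)"
  shows "mat_group n (GL_sub n R)"
proof -
  have "g * h \<in> GL_sub n R" if "g \<in> GL_sub n R" "h \<in> GL_sub n R" for g h
  proof -
    have gh: "g \<in> GL n" "h \<in> GL n" using that by (auto simp: GL_sub_def)
    have "(g * h) $$ (i,j) \<in> R" if "i < n" "j < n" for i j
      unfolding index_mult_sum[OF GL_carrier[OF gh(1)] GL_carrier[OF gh(2)] that]
      using \<open>g \<in> GL_sub n R\<close> \<open>h \<in> GL_sub n R\<close> that R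
      by (intro subring_sum[OF R]) (auto simp: GL_sub_def subring_def)
    then show ?thesis using gh by (auto simp: GL_sub_def)
  qed
  moreover have "1\<^sub>m n \<in> GL_sub n R" using R by (auto simp: GL_sub_def subring_def)
  ultimately show ?thesis by (auto simp: mat_group_def GL_sub_def)
qed

lemma unip_mult_entry:
  assumes u: "u \<in> unip n R" "v \<in> unip n R" and ij: "i < n" "j < n"
  shows "(u * v) $$ (i,j) = (\<Sum>k\<in>{i..j}. u $$ (i,k) * v $$ (k,j))"
proof -
  have c: "u \<in> carrier_mat n n" "v \<in> carrier_mat n n" using u by (auto simp: unip_def)
  show ?thesis unfolding index_mult_sum[OF c ij]
    using u ij by (intro sum.mono_neutral_right) (auto simp: unip_def)
qed

lemma mat_group_unip:
  assumes R: "subring (R :: 'a::field set)"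
  shows "mat_group n (unip n R)"
proof -
  have "u * v \<in> unip n R" if uv: "u \<in> unip n R" "v \<in> unip n R" for u v
  proof -
    have c: "u \<in> carrier_mat n n" "v \<in> carrier_mat n n" using uv by (auto simp: unip_def)
    have "(u * v) $$ (i,j) \<in> R" if "i < n" "j < n" for i j
      unfolding index_mult_sum[OF c that] using uv that R
      by (intro subring_sum[OF R]) (auto simp: unip_def subring_def)
    moreover have "(u * v) $$ (i,i) = 1" if "i < n" for i
      using unip_mult_entry[OF uv that that] uv that by (auto simp: unip_def)
    moreover have "(u * v) $$ (i,j) = 0" if "i < n" "j < i" for i j
      using unip_mult_entry[OF uv, of i j] that by auto
    ultimately show ?thesis using c by (auto simp: unip_def)
  qed
  moreover have "1\<^sub>m n \<in> unip n R" using R by (auto simp: unip_def subring_def)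
  ultimately show ?thesis using unip_GL by (auto simp: mat_group_def)
qed

lemma unip_mult_superdiag:
  assumes u: "u \<in> unip n R" "v \<in> unip n R" and i: "i < n - 1"
  shows "(u * v) $$ (i,i+1) = u $$ (i,i+1) + v $$ (i,i+1)"
proof -
  have "{i..i+1} = {i,i+1}" by auto
  then show ?thesis using unip_mult_entry[OF u, of i "i+1"] u i by (auto simp: unip_def)
qed

section \<open>Functions bi-equivariant under the unipotent group\<close>

text \<open>A permutation each of whose descents drops by one is a direct sum of decreasing permutations.\<close>

lemma layered_run:
  fixes v :: "nat \<Rightarrow> nat"
  assumes inj: "inj_on v {..<n}" and into: "\<And>i. i < n \<Longrightarrow> v i < n"
    and step: "\<And>i. Suc i < n \<Longrightarrow> v i < v (Suc i) \<or> v i = Suc (v (Suc i))"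
    and i: "i < n" "i + t \<le> v i"
  shows "v (i + t) = v i - t"
  using i
proof (induction i arbitrary: t rule: less_induct)
  case (less i)
  note outer = less.IH and i = less.prems(1)
  have surj: "\<exists>p<n. v p = b" if "b < n" for b
  proof -
    have "v ` {..<n} = {..<n}"
      using inj into by (intro endo_inj_surj) auto
    then show ?thesis using that by (metis imageE lessThan_iff)
  qed
  from less.prems(2) show ?case
  proof (induction t rule: less_induct)
    case (less t)
    show ?case
    proof (cases t)
      case (Suc s)
      have an: "v i < n" using into i by simp
      then have tn: "i + t < n" using less.prems by linarith
      have vs: "v (i + s) = v i - s" using less.IH[of s] less.prems Suc by simp
      show ?thesis
      proof (rule ccontr)
        \<comment> \<open>A broken run starts an ascent past \<open>v i\<close>, after which all
          values stay above \<open>v i\<close>. The value \<open>v i - t\<close> is then taken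
          neither later nor inside the run, and the outer induction excludes a position before
          \<open>i\<close>.\<close>
        assume "v (i + t) \<noteq> v i - t"
        then have up: "v i - s < v (i + t)"
          using step[of "i + s"] vs tn Suc by auto
        have gt: "v i < v (i + t)"
        proof (rule ccontr)
          assume "\<not> v i < v (i + t)"
          define r where "r = v i - v (i + t)"
          have r: "r < t" "v i - r = v (i + t)"
            using up \<open>\<not> v i < v (i + t)\<close> Suc by (auto simp: r_def)
          then have "v (i + r) = v (i + t)" using less.IH[of r] less.prems by simp
          then show False using inj r(1) tn by (auto dest!: inj_onD)
        qed
        have tail: "v i < v r" if "i + t \<le> r" "r < n" for r
          using that
        proof (induction r rule: dec_induct)
          case base then show ?case using gt by simp
        next
          case (step r)
          then have "v i < v r" by simp
          moreover have "v (Suc r) \<noteq> v i" using inj step i by (auto dest!: inj_onD)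
          ultimately show ?case using assms(3)[of r] step by linarith
        qed
        obtain p where p: "p < n" "v p = v i - t" using surj[of "v i - t"] an less_imp_diff_less by blast
        consider "p < i" | "i \<le> p" "p < i + t" | "i + t \<le> p" by linarith
        then show False
        proof cases
          case 1
          have "v (p + (i - p)) = v p - (i - p)"
            using outer[OF 1 p(1), of "i - p"] 1 p less.prems by linarith
          then show False using 1 p less.prems Suc by simp
        next
          case 2
          then have "v p = v i - (p - i)" using less.IH[of "p - i"] less.prems by simp
          then show False using p 2 less.prems by linarith
        next
          case 3
          then show False using tail[of p] p by simp
        qed
      qed
    qed simp
  qed
qed

text \<open>If \<open>i \<le> v i\<close>, the run of \<open>layered_run\<close> continued up to
  position \<open>v i\<close> takes the value \<open>i\<close> there, and \<open>c\<close> is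
  constant along it since each of its steps is a descent. If \<open>v i < i\<close>, the claim at
  \<open>v i\<close> and injectivity give the one at \<open>i\<close>. In the application
  \<open>c\<close> holds the nonzero entries of a monomial matrix.\<close>

lemma layered_involution:
  fixes v :: "nat \<Rightarrow> nat" and c :: "nat \<Rightarrow> 'b"
  assumes inj: "inj_on v {..<n}" and into: "\<And>i. i < n \<Longrightarrow> v i < n"
    and step: "\<And>i. Suc i < n \<Longrightarrow> v i < v (Suc i) \<or> (v i = Suc (v (Suc i)) \<and> c (Suc i) = c i)"
    and i: "i < n"
  shows "v (v i) = i \<and> c (v i) = c i"
  using i
proof (induction i rule: less_induct)
  case (less i)
  have step': "v i < v (Suc i) \<or> v i = Suc (v (Suc i))" if "Suc i < n" for i
    using step[OF that] by auto
  note run = layered_run[OF inj into step' less.prems]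
  show ?case
  proof (cases "i \<le> v i")
    case True
    have "c (i + t) = c i" if "i + t \<le> v i" for t
      using that
    proof (induction t)
      case (Suc t)
      have "v (i + t) = v i - t" "v (i + Suc t) = v i - Suc t" using run[of t] run[of "Suc t"] Suc.prems by auto
      moreover have "Suc (i + t) < n" using into[OF less.prems] Suc.prems by linarith
      ultimately have "c (Suc (i + t)) = c (i + t)" using step[of "i + t"] by auto
      then show ?case using Suc by simp
    qed simp
    from this[of "v i - i"] run[of "v i - i"] True show ?thesis by simp
  next
    case False
    then have IH: "v (v (v i)) = v i" "c (v (v i)) = c (v i)" using less.IH[of "v i"] into[OF less.prems] by auto
    have "v (v i) = i" using inj IH(1) into less.prems by (auto dest!: inj_onD)
    with IH show ?thesis by simp
  qed
qed

text \<open>Reflection in the antidiagonal, i.e. transposition conjugated by \<open>omega n\<close>: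
  unlike plain transposition it preserves the upper unipotent group, and also its character.\<close>

definition antitr :: "nat \<Rightarrow> 'a::field mat \<Rightarrow> 'a mat" where
  "antitr n g = mat n n (\<lambda>(i,j). g $$ (n - 1 - j, n - 1 - i))"

lemma antitr_carrier [simp]: "antitr n g \<in> carrier_mat n n"
  by (simp add: antitr_def)

lemma antitr_index [simp]: "i < n \<Longrightarrow> j < n \<Longrightarrow> antitr n g $$ (i,j) = g $$ (n - 1 - j, n - 1 - i)"
  by (simp add: antitr_def)

lemma antitr_antitr: "g \<in> carrier_mat n n \<Longrightarrow> antitr n (antitr n g) = g"
  by (intro eq_matI) (auto simp: antitr_def)

lemma antitr_one: "antitr n (1\<^sub>m n) = 1\<^sub>m n"
  by (intro eq_matI) (auto simp: antitr_def)

lemma antitr_mult: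
  assumes "g \<in> carrier_mat n n" "h \<in> carrier_mat n n"
  shows "antitr n (g * h) = antitr n h * antitr n g"
proof (rule eq_matI)
  fix i j assume "i < dim_row (antitr n h * antitr n g)" "j < dim_col (antitr n h * antitr n g)"
  then have ij: "i < n" "j < n" by (auto simp: antitr_def)
  have "antitr n (g * h) $$ (i,j) = (\<Sum>k<n. g $$ (n - 1 - j, k) * h $$ (k, n - 1 - i))"
    using ij by (simp add: index_mult_sum[OF assms])
  also have "\<dots> = (\<Sum>k<n. g $$ (n - 1 - j, n - Suc k) * h $$ (n - Suc k, n - 1 - i))"
    by (rule sum.nat_diff_reindex[symmetric])
  also have "\<dots> = (antitr n h * antitr n g) $$ (i,j)"
    using ij by (auto simp: index_mult_sum[of _ n] intro!: sum.cong)
  finally show "antitr n (g * h) $$ (i,j) = (antitr n h * antitr n g) $$ (i,j)" .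
qed (auto simp: antitr_def)

lemma antitr_GL [simp]:
  assumes "g \<in> GL n" shows "antitr n g \<in> GL n"
proof -
  note i = mat_inv[OF assms] GL_carrier[OF assms]
  have "antitr n (mat_inv n g) * antitr n g = 1\<^sub>m n" "antitr n g * antitr n (mat_inv n g) = 1\<^sub>m n"
    using antitr_mult[OF i(4,1)] antitr_mult[OF i(1,4)] unfolding i(2,3) antitr_one by auto
  then show ?thesis unfolding GL_iff by (intro conjI bexI[of _ "antitr n (mat_inv n g)"]) auto
qed

lemma antitr_unip: "u \<in> unip n R \<Longrightarrow> antitr n u \<in> unip n R"
  by (auto simp: unip_def)

lemma psiN_antitr: "psiN chi n (antitr n u) = psiN chi n u"
proof -
  have "(\<Sum>i<n-1. antitr n u $$ (i, i+1)) = (\<Sum>i<n-1. (\<lambda>k. u $$ (k, k+1)) (n - 1 - Suc i))"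
  proof (rule sum.cong[OF refl])
    fix i assume "i \<in> {..<n-1}"
    moreover from this have "Suc (n - Suc (Suc i)) = n - Suc i" by auto
    ultimately show "antitr n u $$ (i, i+1) = (\<lambda>k. u $$ (k, k+1)) (n - 1 - Suc i)" by simp
  qed
  also have "\<dots> = (\<Sum>i<n-1. u $$ (i, i+1))"
    by (rule sum.nat_diff_reindex)
  finally show ?thesis by (simp add: psiN_def)
qed

section \<open>Monomial representatives of unipotent double cosets, by elimination with matrices 1 +
  x s^t\<close>

definition rk1 :: "nat \<Rightarrow> (nat \<Rightarrow> 'a) \<Rightarrow> (nat \<Rightarrow> 'a) \<Rightarrow> 'a::field mat" where
  "rk1 n x s = mat n n (\<lambda>(i,j). (if i = j then 1 else 0) + x i * s j)"

lemma rk1_carrier [simp]: "rk1 n x s \<in> carrier_mat n n"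
  by (simp add: rk1_def)

lemma rk1_mult:
  assumes "g \<in> carrier_mat n n" "a < n" "b < n"
  shows "(rk1 n x s * g) $$ (a,b) = g $$ (a,b) + x a * (\<Sum>k<n. s k * g $$ (k,b))"
proof -
  have "(rk1 n x s * g) $$ (a,b) = (\<Sum>k<n. (if k = a then g $$ (k,b) else 0) + x a * (s k * g $$ (k,b)))"
    unfolding index_mult_sum[OF rk1_carrier assms] using assms
    by (intro sum.cong refl) (auto simp: rk1_def algebra_simps)
  also have "\<dots> = g $$ (a,b) + x a * (\<Sum>k<n. s k * g $$ (k,b))"
    using assms by (simp add: sum.distrib sum_distrib_left)
  finally show ?thesis .
qed

lemma mult_rk1:
  assumes "g \<in> carrier_mat n n" "a < n" "b < n"
  shows "(g * rk1 n x s) $$ (a,b) = g $$ (a,b) + (\<Sum>k<n. g $$ (a,k) * x k) * s b"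
proof -
  have "(g * rk1 n x s) $$ (a,b) = (\<Sum>k<n. (if k = b then g $$ (a,k) else 0) + g $$ (a,k) * x k * s b)"
    unfolding index_mult_sum[OF assms(1) rk1_carrier assms(2,3)] using assms
    by (intro sum.cong refl) (auto simp: rk1_def algebra_simps)
  also have "\<dots> = g $$ (a,b) + (\<Sum>k<n. g $$ (a,k) * x k) * s b"
    using assms by (simp add: sum.distrib sum_distrib_right)
  finally show ?thesis .
qed

lemma rk1_unip:
  assumes "\<And>i j. x i \<noteq> 0 \<Longrightarrow> s j \<noteq> 0 \<Longrightarrow> i < j"
  shows "rk1 n x s \<in> unip n UNIV"
proof -
  have "x i * s j = 0" if "j \<le> i" for i j using assms[of i j] that by fastforce
  then show ?thesis by (auto simp: unip_def rk1_def)
qed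

text \<open>A matrix with all \<open>n\<close> rows clean is monomial; the column condition makes
  the pivots of different rows lie in different columns.\<close>

definition clean :: "nat \<Rightarrow> 'a::field mat \<Rightarrow> nat \<Rightarrow> bool" where
  "clean n g i \<longleftrightarrow> (\<exists>j<n. g $$ (i,j) \<noteq> 0 \<and> (\<forall>b<n. b \<noteq> j \<longrightarrow> g $$ (i,b) = 0) \<and>
     (\<forall>a<n. a \<noteq> i \<longrightarrow> g $$ (a,j) = 0))"

text \<open>Taking the leftmost nonzero entry of row \<open>k\<close> as pivot, the rest of the row
  lies to its right and is cleared by a column operation \<open>u'\<close>, the entries above it by
  a row operation \<open>u\<close>; both are upper unipotent. Below the pivot there is nothing to
  clear, because the rows there are clean with pivots in other columns, and for the same reason they
  survive both operations.\<close>

lemma clean_step: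
  fixes g :: "'a::field mat"
  assumes g: "g \<in> GL n" and k: "k < n" and cl: "\<And>i. k < i \<Longrightarrow> i < n \<Longrightarrow> clean n g i"
  shows "\<exists>u\<in>unip n UNIV. \<exists>u'\<in>unip n UNIV. \<forall>i. k \<le> i \<and> i < n \<longrightarrow> clean n (u * g * u') i"
proof -
  note gc = GL_carrier[OF g]
  have "\<exists>j<n. g $$ (k,j) \<noteq> 0"
  proof (rule ccontr)
    assume "\<not> ?thesis"
    then have "(g * mat_inv n g) $$ (k,k) = 0"
      using k by (subst index_mult_sum[OF gc mat_inv(1)[OF g]]) auto
    then show False using mat_inv(2)[OF g] k by simp
  qed
  define j where "j = (LEAST j. j < n \<and> g $$ (k,j) \<noteq> 0)"
  have j: "j < n" "g $$ (k,j) \<noteq> 0"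
    using LeastI_ex[of "\<lambda>j. j < n \<and> g $$ (k,j) \<noteq> 0"] \<open>\<exists>j<n. g $$ (k,j) \<noteq> 0\<close> by (auto simp: j_def)
  have least: "g $$ (k,b) = 0" if "b < j" for b
    using not_less_Least[OF that[unfolded j_def]] that j by auto
  define c where "c = g $$ (k,j)"
  have c0: "c \<noteq> 0" using j by (simp add: c_def)
  have below: "g $$ (a,j) = 0" if a: "k < a" "a < n" for a
  proof -
    obtain j' where j': "j' < n" "\<forall>b<n. b \<noteq> j' \<longrightarrow> g $$ (a,b) = 0" "\<forall>b<n. b \<noteq> a \<longrightarrow> g $$ (b,j') = 0"
      using cl[OF a] by (auto simp: clean_def)
    have "j \<noteq> j'" using j' j k a by auto
    then show ?thesis using j' j by auto
  qed
  define s where "s = (\<lambda>b. if b > j then - g $$ (k,b) / c else 0)"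
  define x where "x = (\<lambda>a. if a < k then - g $$ (a,j) / c else 0)"
  define u where "u = rk1 n x (\<lambda>b. if b = k then 1 else 0)"
  define u' where "u' = rk1 n (\<lambda>a. if a = j then 1 else 0) s"
  have N: "u \<in> unip n UNIV" "u' \<in> unip n UNIV"
    unfolding u_def u'_def by (rule rk1_unip; auto simp: x_def s_def split: if_splits)+
  define g1 where "g1 = g * u'"
  have g1c: "g1 \<in> carrier_mat n n" using gc by (simp add: g1_def u'_def)
  have g1: "g1 $$ (a,b) = g $$ (a,b) + g $$ (a,j) * s b" if "a < n" "b < n" for a b
    unfolding g1_def u'_def mult_rk1[OF gc that] using j by (simp add: if_distrib cong: if_cong)
  have g2: "(u * g1) $$ (a,b) = g1 $$ (a,b) + x a * g1 $$ (k,b)" if "a < n" "b < n" for a b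
    unfolding u_def rk1_mult[OF g1c that] using k
    by (simp add: if_distrib[of "\<lambda>t. t * _"] cong: if_cong)
  have g1k: "g1 $$ (k,b) = (if b = j then c else 0)" if "b < n" for b
    using g1[OF k that] least[of b] c0 by (auto simp: s_def c_def)
  have g1j: "g1 $$ (a,j) = g $$ (a,j)" if "a < n" for a
    using g1[OF that j(1)] by (simp add: s_def)
  have "clean n (u * g1) i" if i: "k \<le> i" "i < n" for i
  proof (cases "i = k")
    case True
    have "(u * g1) $$ (k,b) = (if b = j then c else 0)" if "b < n" for b
      using g2[OF k that] g1k[OF that] by (simp add: x_def)
    moreover have "(u * g1) $$ (a,j) = 0" if "a < n" "a \<noteq> k" for a
      using g2[OF that(1) j(1)] g1j[OF that(1)] g1k[OF j(1)] below[of a] that c0 by (auto simp: x_def)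
    ultimately show ?thesis unfolding clean_def True using j c0 by (intro exI[of _ j]) auto
  next
    case False
    then have ki: "k < i" using i by simp
    obtain j' where j': "j' < n" "g $$ (i,j') \<noteq> 0" "\<forall>b<n. b \<noteq> j' \<longrightarrow> g $$ (i,b) = 0"
        "\<forall>a<n. a \<noteq> i \<longrightarrow> g $$ (a,j') = 0"
      using cl[OF ki i(2)] by (auto simp: clean_def)
    have jj: "j' \<noteq> j" using j' j k ki by auto
    have "(u * g1) $$ (i,b) = g $$ (i,b)" if "b < n" for b
      using g2[OF i(2) that] g1[OF i(2) that] below[OF ki i(2)] ki by (simp add: x_def)
    moreover have "(u * g1) $$ (a,j') = 0" if "a < n" "a \<noteq> i" for a
    proof -
      have "s j' = 0" using j'(4) k ki by (simp add: s_def)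
      then show ?thesis using g2[OF that(1) j'(1)] g1[OF that(1) j'(1)] g1k[OF j'(1)] jj j'(4) that by simp
    qed
    ultimately show ?thesis unfolding clean_def using j' by (intro exI[of _ j']) auto
  qed
  moreover have "u * g1 = u * g * u'"
    unfolding g1_def u_def u'_def by (rule assoc_mult_mat[symmetric, OF rk1_carrier gc rk1_carrier])
  ultimately show ?thesis using N by (intro bexI[of _ u] bexI[of _ u']) auto
qed

text \<open>Rows are cleaned from the last one upwards, \<open>m\<close> counting the finished ones,
  while the unipotent factors accumulate on both sides.\<close>

lemma bruhat:
  fixes g :: "'a::field mat"
  assumes g: "g \<in> GL n"
  shows "\<exists>u\<in>unip n UNIV. \<exists>u'\<in>unip n UNIV. \<forall>i<n. clean n (u * g * u') i"
proof -
  have "\<exists>u\<in>unip n UNIV. \<exists>u'\<in>unip n UNIV. \<forall>i. n - m \<le> i \<and> i < n \<longrightarrow> clean n (u * g * u') i"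
    if "m \<le> n" for m
    using that
  proof (induction m)
    case 0
    then show ?case using mat_groupD(2)[OF mat_group_unip[OF subring_UNIV]] by fastforce
  next
    case (Suc m)
    then obtain u u' where u: "u \<in> unip n UNIV" "u' \<in> unip n UNIV"
      "\<forall>i. n - m \<le> i \<and> i < n \<longrightarrow> clean n (u * g * u') i" by auto
    have G: "u \<in> GL n" "u' \<in> GL n" using u unip_GL by auto
    have "u * g * u' \<in> GL n" using G g by simp
    from clean_step[OF this, of "n - Suc m"] u(3) Suc.prems obtain w w' where
      w: "w \<in> unip n UNIV" "w' \<in> unip n UNIV"
      "\<forall>i. n - Suc m \<le> i \<and> i < n \<longrightarrow> clean n (w * (u * g * u') * w') i"
      by (metis Suc_diff_Suc Suc_le_eq diff_less less_le_trans zero_less_Suc)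
    have W: "w \<in> GL n" "w' \<in> GL n" using w unip_GL by auto
    have "w * (u * g * u') * w' = (w * u) * g * (u' * w')"
      using G W g by (simp add: GL_assoc)
    then show ?case using w u mat_groupD(3)[OF mat_group_unip[OF subring_UNIV]]
      by (intro bexI[of _ "w * u"] bexI[of _ "u' * w'"]) auto
  qed
  from this[of n] show ?thesis by simp
qed

lemma psiN_rk1:
  assumes "\<And>i j. x i \<noteq> 0 \<Longrightarrow> s j \<noteq> 0 \<Longrightarrow> i < j"
  shows "psiN chi n (rk1 n x s) = chi (\<Sum>i<n-1. x i * s (i+1))"
  unfolding psiN_def by (intro arg_cong[of _ _ chi] sum.cong) (auto simp: rk1_def)

section \<open>Support of functions bi-equivariant under a nondegenerate character\<close>

locale additive_character =
  fixes chi :: "'a::{finite,field} \<Rightarrow> complex"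
  assumes chi_add: "chi (x + y) = chi x * chi y"
    and chi_0: "chi 0 = 1"
    and chi_nontriv: "\<exists>x. chi x \<noteq> 1"
begin

abbreviation N where "N n \<equiv> unip n (UNIV :: 'a set)"

lemma chi_minus: "chi x * chi (- x) = 1" "chi (- x) * chi x = 1"
  using chi_add[of x "- x"] chi_add[of "- x" x] chi_0 by auto

lemma chi_nonzero [simp]: "chi x \<noteq> 0"
  using chi_minus(1)[of x] by auto

text \<open>The kernel of \<open>chi\<close> contains all \<open>x - x * r\<close>, and for
  \<open>r \<noteq> 1\<close> these exhaust the field.\<close>

lemma chi_scale_eq:
  assumes "\<And>x. chi x = chi (x * r)"
  shows "r = 1"
proof (rule ccontr)
  assume "r \<noteq> 1"
  obtain y where y: "chi y \<noteq> 1" using chi_nontriv by blast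
  define x where "x = y / (1 - r)"
  have "y = x + - (x * r)" 
  proof -
    have "y = x * (1 - r)" using \<open>r \<noteq> 1\<close> by (simp add: x_def)
    then show ?thesis by (simp add: algebra_simps)
  qed
  then have "chi y = chi x * chi (- (x * r))" using chi_add by metis
  also have "\<dots> = 1" using assms[of x] chi_minus by simp
  finally show False using y by simp
qed

lemma psiN_mult:
  assumes "u \<in> unip n R" "v \<in> unip n R"
  shows "psiN chi n (u * v) = psiN chi n u * psiN chi n v"
proof -
  have "(\<Sum>i<n-1. (u * v) $$ (i,i+1)) = (\<Sum>i<n-1. u $$ (i,i+1)) + (\<Sum>i<n-1. v $$ (i,i+1))"
    unfolding sum.distrib[symmetric] using unip_mult_superdiag[OF assms] by (intro sum.cong) auto
  then show ?thesis by (simp add: psiN_def chi_add)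
qed

lemma psiN_nonzero [simp]: "psiN chi n u \<noteq> 0"
  by (simp add: psiN_def)

lemma psiN_one [simp]: "psiN chi n (1\<^sub>m n) = 1"
  by (simp add: psiN_def chi_0)

text \<open>The model is the matrix coefficient \<open>l \<bullet> (rho g v)\<close> of a Whittaker
  functional \<open>l\<close> and a Whittaker vector \<open>v\<close> for the same character
  (\<open>whittaker_bieq\<close>).\<close>

definition bieq :: "nat \<Rightarrow> ('a mat \<Rightarrow> complex) \<Rightarrow> bool" where
  "bieq n f \<longleftrightarrow> (\<forall>g\<in>GL n. \<forall>u\<in>N n. f (u * g) = psiN chi n u * f g \<and> f (g * u) = psiN chi n u * f g)"

text \<open>Conjugation by \<open>m\<close> turns 1 + x E at the simple root \<open>(i, i+1)\<close>
  into 1 + x r E at \<open>(w i, w (i+1))\<close>, which is again upper unipotent because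
  \<open>w\<close> ascends. As \<open>f m \<noteq> 0\<close>, the character must agree on both. It
  is trivial on the second unless that position is on the superdiagonal, and there agreement for all
  \<open>x\<close> forces \<open>r = 1\<close>.\<close>

lemma monomial_step:
  assumes f: "bieq n f" and m: "m \<in> GL n" and nz: "f m \<noteq> 0" and i: "Suc i < n"
    and w: "w i < w (Suc i)" "w (Suc i) < n"
    and row: "\<And>i b. i < n \<Longrightarrow> b < n \<Longrightarrow> b \<noteq> w i \<Longrightarrow> m $$ (i,b) = 0"
    and col: "\<And>i a. i < n \<Longrightarrow> a < n \<Longrightarrow> a \<noteq> i \<Longrightarrow> m $$ (a,w i) = 0"
    and diag: "\<And>i. i < n \<Longrightarrow> m $$ (i, w i) \<noteq> 0"
  shows "w (Suc i) = Suc (w i) \<and> m $$ (Suc i, w (Suc i)) = m $$ (i, w i)"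
proof -
  note mc = GL_carrier[OF m]
  define r where "r = m $$ (Suc i, w (Suc i)) / m $$ (i, w i)"
  have key: "chi x = (if w (Suc i) = Suc (w i) then chi (x * r) else 1)" for x
  proof -
    define u where "u = rk1 n (\<lambda>a. if a = i then x else 0) (\<lambda>b. if b = Suc i then 1 else 0)"
    define u' where "u' = rk1 n (\<lambda>a. if a = w i then x * r else 0) (\<lambda>b. if b = w (Suc i) then 1 else 0)"
    have uN: "u \<in> N n" "u' \<in> N n"
      unfolding u_def u'_def using w by (intro rk1_unip; auto split: if_splits)+
    have "u * m = m * u'"
    proof (rule eq_matI)
      fix a b assume "a < dim_row (m * u')" "b < dim_col (m * u')"
      then have ab: "a < n" "b < n" using mc by (auto simp: u'_def rk1_def)
      have wi: "w i < n" using w by simp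
      have "(u * m) $$ (a,b) = m $$ (a,b) + (if a = i then x else 0) * m $$ (Suc i, b)"
        unfolding u_def rk1_mult[OF mc ab] using i
        by (simp add: if_distrib[of "\<lambda>t. t * _"] cong: if_cong)
      moreover have "(m * u') $$ (a,b) = m $$ (a,b) + m $$ (a, w i) * (x * r) * (if b = w (Suc i) then 1 else 0)"
        unfolding u'_def mult_rk1[OF mc ab] using wi
        by (simp add: if_distrib[of "\<lambda>t. _ * t"] cong: if_cong)
      moreover have "(if a = i then x else 0) * m $$ (Suc i, b)
          = m $$ (a, w i) * (x * r) * (if b = w (Suc i) then 1 else 0)"
        using row[of "Suc i" b] col[of i a] diag[of i] ab i by (auto simp: r_def)
      ultimately show "(u * m) $$ (a,b) = (m * u') $$ (a,b)" by simp
    qed (use mc in \<open>auto simp: u_def u'_def rk1_def\<close>)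
    then have "psiN chi n u * f m = psiN chi n u' * f m"
      using f m uN unfolding bieq_def by metis
    then have "psiN chi n u = psiN chi n u'" using nz by simp
    moreover have "psiN chi n u = chi x"
      unfolding u_def using i
      by (subst psiN_rk1) (auto simp: if_distrib[of "\<lambda>t. t * _"] cong: if_cong split: if_splits)
    moreover have "psiN chi n u' = (if w (Suc i) = Suc (w i) then chi (x * r) else 1)"
      unfolding u'_def using w
      by (subst psiN_rk1) (auto simp: if_distrib[of "\<lambda>t. t * _"] chi_0 cong: if_cong split: if_splits)
    ultimately show ?thesis by simp
  qed
  have 1: "w (Suc i) = Suc (w i)" using key chi_nontriv by (metis)
  then have "r = 1" using key by (intro chi_scale_eq) auto
  then show ?thesis using 1 diag[of i] i by (simp add: r_def field_simps)
qed

text \<open>Replacing \<open>w\<close> by \<open>n - 1 - w\<close> turns the alternative at each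
  \<open>i\<close> into "ascent, or descent by exactly one", the hypothesis of
  \<open>layered_involution\<close>.\<close>

definition layered_support :: "nat \<Rightarrow> 'a mat \<Rightarrow> (nat \<Rightarrow> nat) \<Rightarrow> bool" where
  "layered_support n m w \<longleftrightarrow> inj_on w {..<n} \<and>
     (\<forall>i<n. w i < n \<and> m $$ (i, w i) \<noteq> 0 \<and> (\<forall>b<n. b \<noteq> w i \<longrightarrow> m $$ (i,b) = 0)) \<and>
     (\<forall>i. Suc i < n \<longrightarrow> w (Suc i) < w i \<or>
       (w (Suc i) = Suc (w i) \<and> m $$ (Suc i, w (Suc i)) = m $$ (i, w i)))"

lemma layered_supportD:
  assumes "layered_support n m w"
  shows "i < n \<Longrightarrow> w i < n" "inj_on w {..<n}"
    "i < n \<Longrightarrow> b < n \<Longrightarrow> b \<noteq> w i \<Longrightarrow> m $$ (i,b) = 0"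
    "i < n \<Longrightarrow> m $$ (i, w i) \<noteq> 0"
    "Suc i < n \<Longrightarrow> w (Suc i) < w i \<or>
       (w (Suc i) = Suc (w i) \<and> m $$ (Suc i, w (Suc i)) = m $$ (i, w i))"
  using assms unfolding layered_support_def by auto

lemma monomial_support:
  assumes f: "bieq n f" and m: "m \<in> GL n" and nz: "f m \<noteq> 0" and cl: "\<forall>i<n. clean n m i"
  shows "\<exists>w. layered_support n m w"
proof -
  from cl have "\<forall>i. \<exists>j. i < n \<longrightarrow> j < n \<and> m $$ (i,j) \<noteq> 0 \<and> (\<forall>b<n. b \<noteq> j \<longrightarrow> m $$ (i,b) = 0) \<and>
     (\<forall>a<n. a \<noteq> i \<longrightarrow> m $$ (a,j) = 0)" unfolding clean_def by blast
  from choice[OF this] obtain w where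
    "\<forall>i. i < n \<longrightarrow> w i < n \<and> m $$ (i,w i) \<noteq> 0 \<and> (\<forall>b<n. b \<noteq> w i \<longrightarrow> m $$ (i,b) = 0) \<and>
     (\<forall>a<n. a \<noteq> i \<longrightarrow> m $$ (a,w i) = 0)" ..
  then have w: "\<And>i. i < n \<Longrightarrow> w i < n" "\<And>i. i < n \<Longrightarrow> m $$ (i, w i) \<noteq> 0"
    "\<And>i b. i < n \<Longrightarrow> b < n \<Longrightarrow> b \<noteq> w i \<Longrightarrow> m $$ (i,b) = 0"
    "\<And>i a. i < n \<Longrightarrow> a < n \<Longrightarrow> a \<noteq> i \<Longrightarrow> m $$ (a,w i) = 0" by auto
  have inj: "inj_on w {..<n}"
  proof (rule inj_onI)
    fix i j assume ij: "i \<in> {..<n}" "j \<in> {..<n}" "w i = w j"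
    then show "i = j" using w(4)[of j i] w(2)[of i] by force
  qed
  have "w (Suc i) < w i \<or> (w (Suc i) = Suc (w i) \<and> m $$ (Suc i, w (Suc i)) = m $$ (i, w i))"
    if i: "Suc i < n" for i
  proof (cases "w i < w (Suc i)")
    case True
    then show ?thesis using monomial_step[OF f m nz i True w(1)[OF i] w(3) w(4) w(2)] by auto
  next
    case False
    moreover have "w i \<noteq> w (Suc i)" using inj_onD[OF inj, of i "Suc i"] i by auto
    ultimately show ?thesis by simp
  qed
  then have "layered_support n m w" unfolding layered_support_def using w(1-3) inj by blast
  then show ?thesis by blast
qed

text \<open>With \<open>v i = n - 1 - w i\<close>, the reflection carries the entry at
  \<open>(i, w i)\<close> to \<open>(v i, n - 1 - i)\<close>. Since \<open>v\<close> is an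
  involution, that position is \<open>(v i, w (v i))\<close>, where \<open>m\<close> has the same
  entry.\<close>

lemma monomial_antitr:
  assumes f: "bieq n f" and m: "m \<in> GL n" and nz: "f m \<noteq> 0" and cl: "\<forall>i<n. clean n m i"
  shows "antitr n m = m"
proof -
  from monomial_support[OF assms] obtain w where "layered_support n m w" by blast
  note w = layered_supportD[OF this]
  define v where "v = (\<lambda>i. n - 1 - w i)"
  have wv: "w i = n - 1 - v i" if "i < n" for i using w(1)[OF that] by (simp add: v_def)
  have inj: "inj_on v {..<n}"
  proof (rule inj_onI)
    fix i j assume ij: "i \<in> {..<n}" "j \<in> {..<n}" "v i = v j"
    then have "w i = w j" using wv[of i] wv[of j] by simp
    then show "i = j" using inj_onD[OF w(2)] ij by blast
  qed
  have into: "v i < n" if "i < n" for i using that by (simp add: v_def)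
  have inv: "v (v i) = i" "m $$ (v i, w (v i)) = m $$ (i, w i)" if "i < n" for i
  proof -
    have "v i < v (Suc i) \<or> (v i = Suc (v (Suc i)) \<and> m $$ (Suc i, w (Suc i)) = m $$ (i, w i))"
      if i: "Suc i < n" for i
      using w(5)[OF i] w(1)[of i] w(1)[OF i] i by (auto simp: v_def)
    from layered_involution[where c = "\<lambda>i. m $$ (i, w i)", OF inj into this \<open>i < n\<close>]
    show "v (v i) = i" "m $$ (v i, w (v i)) = m $$ (i, w i)" by auto
  qed
  show ?thesis
  proof (rule eq_matI)
    fix i j assume "i < dim_row m" "j < dim_col m"
    then have ij: "i < n" "j < n" using GL_carrier[OF m] by auto
    show "antitr n m $$ (i,j) = m $$ (i,j)"
    proof (cases "j = w i")
      case True
      have "w (v i) = n - 1 - i" using wv[OF into[OF ij(1)]] inv(1)[OF ij(1)] by simp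
      then show ?thesis using True ij inv(2)[OF ij(1)] by (simp add: v_def)
    next
      case False
      have "n - 1 - i \<noteq> w (n - 1 - j)"
      proof
        assume "n - 1 - i = w (n - 1 - j)"
        then have "v (n - 1 - j) = i" using ij by (simp add: v_def)
        then have "v i = n - 1 - j" using inv(1)[of "n - 1 - j"] ij by simp
        then show False using False wv[OF ij(1)] ij by simp
      qed
      then have "m $$ (n - 1 - j, n - 1 - i) = 0" using w(3)[of "n - 1 - j" "n - 1 - i"] ij by simp
      then show ?thesis using w(3)[OF ij] False ij by simp
    qed
  qed (use GL_carrier[OF m] in \<open>auto simp: antitr_def\<close>)
qed

lemma bieq_comp_antitr:
  assumes "bieq n f" shows "bieq n (f \<circ> antitr n)"
  unfolding bieq_def
proof (intro ballI)
  fix g u :: "'a mat" assume g: "g \<in> GL n" and u: "u \<in> N n"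
  note c = GL_carrier[OF g] GL_carrier[OF unip_GL[OF u]]
  show "(f \<circ> antitr n) (u * g) = psiN chi n u * (f \<circ> antitr n) g \<and>
      (f \<circ> antitr n) (g * u) = psiN chi n u * (f \<circ> antitr n) g"
    using assms antitr_GL[OF g] antitr_unip[OF u]
    by (auto simp: bieq_def antitr_mult[OF c] antitr_mult[OF c(2,1)] psiN_antitr)
qed

lemma bieq_two_sided:
  assumes "bieq n f" "g \<in> GL n" "u \<in> N n" "u' \<in> N n"
  shows "f (u * g * u') = psiN chi n u * psiN chi n u' * f g"
  using assms unip_GL[OF assms(3)] by (simp add: bieq_def)

text \<open>\<open>f\<close> and its reflection have the same equivariance, so they may be compared
  on a monomial representative; there either both vanish or the representative is fixed by the
  reflection.\<close>

theorem bieq_antitr: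
  assumes f: "bieq n f" and g: "g \<in> GL n"
  shows "f (antitr n g) = f g"
proof -
  obtain u u' where u: "u \<in> N n" "u' \<in> N n" "\<forall>i<n. clean n (u * g * u') i" using bruhat[OF g] by auto
  let ?m = "u * g * u'" and ?f' = "f \<circ> antitr n"
  have m: "?m \<in> GL n" using unip_GL[OF u(1)] unip_GL[OF u(2)] g by simp
  note f' = bieq_comp_antitr[OF f]
  have "f ?m = ?f' ?m"
  proof (cases "f ?m \<noteq> 0 \<or> ?f' ?m \<noteq> 0")
    case True
    then have "antitr n ?m = ?m"
      using monomial_antitr[OF f m _ u(3)] monomial_antitr[OF f' m _ u(3)] by blast
    then show ?thesis by simp
  qed auto
  then show ?thesis
    using bieq_two_sided[OF f g u(1,2)] bieq_two_sided[OF f' g u(1,2)] by simp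
qed

text \<open>Unipotent factors do not affect the shape of the last row, so the monomial
  representative has its last pivot 1 on the diagonal. Going upwards, \<open>w\<close> fixes all
  later indices, so injectivity gives \<open>w i \<le> i\<close>; hence there is no descent at
  \<open>i\<close>, and the support condition forces \<open>w i = i\<close> with the same entry 1.
  The representative is therefore the identity.\<close>

theorem bieq_mirabolic:
  assumes f: "bieq n f" and g: "g \<in> GL n" and n: "n > 0" and nz: "f g \<noteq> 0"
    and last: "\<And>j. j < n \<Longrightarrow> g $$ (n - 1, j) = (if j = n - 1 then 1 else 0)"
  shows "g \<in> N n"
proof -
  obtain u u' where u: "u \<in> N n" "u' \<in> N n" "\<forall>i<n. clean n (u * g * u') i" using bruhat[OF g] by auto
  let ?m = "u * g * u'"
  note G = unip_GL[OF u(1)] unip_GL[OF u(2)]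
  note c = GL_carrier[OF G(1)] GL_carrier[OF G(2)] GL_carrier[OF g]
  have m: "?m \<in> GL n" using G g by auto
  have fm: "f ?m \<noteq> 0" using bieq_two_sided[OF f g u(1,2)] nz by simp
  from monomial_support[OF f m fm u(3)] obtain w where "layered_support n ?m w" by blast
  note w = layered_supportD[OF this]
  have lastm: "?m $$ (n - 1, j) = (if j = n - 1 then 1 else 0)" if "j < n" for j
  proof -
    have u_last: "u $$ (n - 1, b) = (if b = n - 1 then 1 else 0)" if "b < n" for b
      using u(1) that n by (auto simp: unip_def)
    have ug: "(u * g) $$ (n - 1, k) = (if k = n - 1 then 1 else 0)" if "k < n" for k
      using unit_row_mult[OF c(1,3) _ that _ u_last] last[OF that] n by simp
    have "?m $$ (n - 1, j) = u' $$ (n - 1, j)"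
      using unit_row_mult[OF mult_carrier_mat[OF c(1,3)] c(2) _ that _ ug] n by simp
    then show ?thesis using u(2) that n by (auto simp: unip_def)
  qed
  have "\<forall>i. n - k \<le> i \<and> i < n \<longrightarrow> w i = i \<and> ?m $$ (i,i) = 1" if "1 \<le> k" "k \<le> n" for k
    using that
  proof (induction k rule: dec_induct)
    case base
    have "w (n - 1) = n - 1" using w(4)[of "n - 1"] lastm[of "w (n - 1)"] w(1)[of "n - 1"] n
      by (auto split: if_splits)
    moreover have "i = n - 1" if "n - 1 \<le> i" "i < n" for i using that by simp
    ultimately show ?case using lastm[of "n - 1"] n by auto
  next
    case (step k)
    let ?i = "n - Suc k"
    have i: "Suc ?i < n" "Suc ?i = n - k" using step by auto
    have IH: "w j = j \<and> ?m $$ (j,j) = 1" if "Suc ?i \<le> j" "j < n" for j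
      using step.IH step.prems that i by auto
    have "\<not> ?i < w ?i"
    proof
      assume lt: "?i < w ?i"
      then have "w (w ?i) = w ?i" using IH[of "w ?i"] w(1)[of ?i] i by auto
      then show False using inj_onD[OF w(2), of "w ?i" ?i] w(1)[of ?i] lt i by auto
    qed
    then have "w ?i = ?i \<and> ?m $$ (?i,?i) = 1" using w(5)[OF i(1)] IH[of "Suc ?i"] i by auto
    moreover have "j = ?i \<or> Suc ?i \<le> j" if "n - Suc k \<le> j" for j using that by auto
    ultimately show ?case using IH by blast
  qed
  from this[of n] n have wi: "w i = i" "?m $$ (i,i) = 1" if "i < n" for i using that by auto
  have "?m = 1\<^sub>m n"
    using wi w(3) GL_carrier[OF m] by (intro eq_matI) auto
  then have "u * g = mat_inv n u'"
    using mat_inv_cancel_right(1)[OF G(2), of "u * g" n] c mat_inv(1)[OF G(2)] by simp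
  then have "g = mat_inv n u * mat_inv n u'"
    using mat_inv_cancel(2)[OF G(1) c(3)] by simp
  then show ?thesis
    using mat_group_inv[OF mat_group_unip[OF subring_UNIV] u(1)] mat_group_inv[OF mat_group_unip[OF subring_UNIV] u(2)]
      mat_groupD(3)[OF mat_group_unip[OF subring_UNIV]] by metis
qed

end

section \<open>Schur's lemma for invariant pairings\<close>

definition vsum :: "nat \<Rightarrow> 'b set \<Rightarrow> ('b \<Rightarrow> complex vec) \<Rightarrow> complex vec" where
  "vsum d S F = vec d (\<lambda>i. \<Sum>s\<in>S. F s $ i)"

lemma vsum_carrier [simp]: "vsum d S F \<in> carrier_vec d"
  by (simp add: vsum_def)

lemma scalar_vsum:
  assumes "l \<in> carrier_vec d" "\<And>s. s \<in> S \<Longrightarrow> F s \<in> carrier_vec d"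
  shows "l \<bullet> vsum d S F = (\<Sum>s\<in>S. l \<bullet> F s)"
proof -
  have "l \<bullet> vsum d S F = (\<Sum>i\<in>{0..<d}. \<Sum>s\<in>S. l $ i * F s $ i)"
    by (simp add: vsum_def scalar_prod_def sum_distrib_left)
  also have "\<dots> = (\<Sum>s\<in>S. \<Sum>i\<in>{0..<d}. l $ i * F s $ i)" by (rule sum.swap)
  also have "\<dots> = (\<Sum>s\<in>S. l \<bullet> F s)"
    using assms(2) by (intro sum.cong refl) (auto simp: scalar_prod_def dest: carrier_vecD)
  finally show ?thesis .
qed

lemma mult_vsum:
  assumes "M \<in> carrier_mat d d" "\<And>s. s \<in> S \<Longrightarrow> F s \<in> carrier_vec d"
  shows "M *\<^sub>v vsum d S F = vsum d S (\<lambda>s. M *\<^sub>v F s)"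
proof (rule eq_vecI)
  fix i assume "i < dim_vec (vsum d S (\<lambda>s. M *\<^sub>v F s))"
  then have i: "i < d" by (simp add: vsum_def)
  then have "row M i \<in> carrier_vec d" using assms(1) by auto
  from scalar_vsum[OF this assms(2)]
  show "(M *\<^sub>v vsum d S F) $ i = vsum d S (\<lambda>s. M *\<^sub>v F s) $ i"
    using assms(1) i by (simp add: vsum_def)
qed (use assms in \<open>auto simp: vsum_def\<close>)

definition linf :: "nat \<Rightarrow> (complex vec \<Rightarrow> complex) \<Rightarrow> bool" where
  "linf d L \<longleftrightarrow> (\<forall>x\<in>carrier_vec d. \<forall>y\<in>carrier_vec d. L (x + y) = L x + L y) \<and>
     (\<forall>c. \<forall>x\<in>carrier_vec d. L (c \<cdot>\<^sub>v x) = c * L x)"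

lemma linear_functional_expand:
  fixes L :: "complex vec \<Rightarrow> complex"
  assumes L: "linf d L" and x: "x \<in> carrier_vec d"
  shows "L x = (\<Sum>j<d. x $ j * L (unit_vec d j))"
proof -
  have add: "L (x + y) = L x + L y" and smult: "L (c \<cdot>\<^sub>v x) = c * L x"
    if "x \<in> carrier_vec d" "y \<in> carrier_vec d" for x y c
    using L that by (auto simp: linf_def)
  have "L (vec d (\<lambda>i. if i < k then x $ i else 0)) = (\<Sum>j<k. x $ j * L (unit_vec d j))" if "k \<le> d" for k
    using that
  proof (induction k)
    case 0
    have "vec d (\<lambda>i. if i < 0 then x $ i else 0) = 0 \<cdot>\<^sub>v x" using x by (intro eq_vecI) auto
    then show ?case using smult[OF x x, of 0] by simp
  next
    case (Suc k)
    have "vec d (\<lambda>i. if i < Suc k then x $ i else 0)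
        = vec d (\<lambda>i. if i < k then x $ i else 0) + x $ k \<cdot>\<^sub>v unit_vec d k"
      using Suc.prems by (intro eq_vecI) (auto simp: unit_vec_def less_Suc_eq)
    then show ?case using Suc by (simp add: add smult[OF unit_vec_carrier unit_vec_carrier])
  qed
  from this[of d] have "L (vec d (\<lambda>i. if i < d then x $ i else 0)) = (\<Sum>j<d. x $ j * L (unit_vec d j))" by simp
  moreover have "vec d (\<lambda>i. if i < d then x $ i else 0) = x" using x by (intro eq_vecI) auto
  ultimately show ?thesis by simp
qed

lemma linear_functional_vec:
  fixes L :: "complex vec \<Rightarrow> complex"
  assumes "linf d L"
  shows "\<exists>l\<in>carrier_vec d. \<forall>x\<in>carrier_vec d. L x = l \<bullet> x"
proof (intro bexI ballI)
  fix x :: "complex vec" assume x: "x \<in> carrier_vec d"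
  have "L x = (\<Sum>j<d. x $ j * L (unit_vec d j))" by (rule linear_functional_expand[OF assms x])
  also have "\<dots> = vec d (\<lambda>j. L (unit_vec d j)) \<bullet> x"
    using x by (auto simp: scalar_prod_def lessThan_atLeast0 mult.commute intro!: sum.cong)
  finally show "L x = vec d (\<lambda>j. L (unit_vec d j)) \<bullet> x" .
qed simp

definition bilin :: "nat \<Rightarrow> (complex vec \<Rightarrow> complex vec \<Rightarrow> complex) \<Rightarrow> bool" where
  "bilin d B \<longleftrightarrow>
     (\<forall>x\<in>carrier_vec d. \<forall>x'\<in>carrier_vec d. \<forall>y\<in>carrier_vec d.
        B (x + x') y = B x y + B x' y \<and> B y (x + x') = B y x + B y x') \<and>
     (\<forall>c. \<forall>x\<in>carrier_vec d. \<forall>y\<in>carrier_vec d. B (c \<cdot>\<^sub>v x) y = c * B x y \<and> B x (c \<cdot>\<^sub>v y) = c * B x y)"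

lemma bilin_matrix:
  assumes "bilin d B"
  shows "\<exists>\<beta>\<in>carrier_mat d d. \<forall>x\<in>carrier_vec d. \<forall>y\<in>carrier_vec d. B x y = y \<bullet> (\<beta> *\<^sub>v x)"
proof (intro bexI ballI)
  let ?\<beta> = "mat d d (\<lambda>(i,j). B (unit_vec d j) (unit_vec d i))"
  fix x y :: "complex vec" assume x: "x \<in> carrier_vec d" and y: "y \<in> carrier_vec d"
  have lin: "linf d (\<lambda>x. B x y)" "linf d (B x)" if "x \<in> carrier_vec d" "y \<in> carrier_vec d" for x y
    using assms that by (auto simp: bilin_def linf_def)
  have "B x y = (\<Sum>j<d. x $ j * B (unit_vec d j) y)"
    by (rule linear_functional_expand[OF lin(1)[OF x y] x])
  also have "\<dots> = (\<Sum>j<d. x $ j * (\<Sum>i<d. y $ i * B (unit_vec d j) (unit_vec d i)))"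
    using linear_functional_expand[OF lin(2)[OF unit_vec_carrier y] y] by simp
  also have "\<dots> = (\<Sum>i<d. y $ i * (\<Sum>j<d. B (unit_vec d j) (unit_vec d i) * x $ j))"
    unfolding sum_distrib_left by (subst sum.swap) (simp add: algebra_simps)
  also have "\<dots> = y \<bullet> (?\<beta> *\<^sub>v x)"
    using x y by (auto simp: scalar_prod_def lessThan_atLeast0 intro!: sum.cong)
  finally show "B x y = y \<bullet> (?\<beta> *\<^sub>v x)" .
qed simp

lemma bilin_sum:
  assumes "\<And>s. s \<in> S \<Longrightarrow> linf d (r s)" "\<And>s. s \<in> S \<Longrightarrow> linf d (p s)"
  shows "bilin d (\<lambda>x y. \<Sum>s\<in>S. r s x * p s y)"
  unfolding bilin_def using assms
  by (simp add: linf_def distrib_left distrib_right sum.distrib sum_distrib_left mult.assoc mult.left_commute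
      cong: sum.cong_simp)

lemma linf_scalar_left: "w \<in> carrier_vec d \<Longrightarrow> linf d (\<lambda>y. y \<bullet> w)"
  by (simp add: linf_def add_scalar_prod_distrib[of _ d])

lemma bilin_scalar: "bilin d (\<lambda>x y. y \<bullet> x)"
  by (simp add: bilin_def add_scalar_prod_distrib[of _ d] scalar_prod_add_distrib[of _ d])

lemma irreducible_full:
  assumes irr: "irreducible_rep n d rho" and S: "is_subspace d S"
    and inv: "\<And>g v. g \<in> GL n \<Longrightarrow> v \<in> S \<Longrightarrow> rho g *\<^sub>v v \<in> S"
    and v: "v \<in> S" "v \<noteq> 0\<^sub>v d"
  shows "S = carrier_vec d"
  using assms unfolding irreducible_rep_def by blast

text \<open>The pairings are the intertwiners from rho to the dual of the right module given by t.\<close>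

lemma schur_form:
  fixes rho :: "'a::field mat \<Rightarrow> complex mat"
  assumes irr: "irreducible_rep n d rho"
    and B1: "bilin d B1" and B2: "bilin d B2"
    and t: "\<And>g y. g \<in> GL n \<Longrightarrow> y \<in> carrier_vec d \<Longrightarrow> t g y \<in> carrier_vec d"
    and inv1: "\<And>g x y. g \<in> GL n \<Longrightarrow> x \<in> carrier_vec d \<Longrightarrow> y \<in> carrier_vec d \<Longrightarrow> B1 (rho g *\<^sub>v x) y = B1 x (t g y)"
    and inv2: "\<And>g x y. g \<in> GL n \<Longrightarrow> x \<in> carrier_vec d \<Longrightarrow> y \<in> carrier_vec d \<Longrightarrow> B2 (rho g *\<^sub>v x) y = B2 x (t g y)"
    and nz: "x0 \<in> carrier_vec d" "y0 \<in> carrier_vec d" "B2 x0 y0 \<noteq> 0"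
  shows "\<exists>\<kappa>. \<forall>x\<in>carrier_vec d. \<forall>y\<in>carrier_vec d. B1 x y = \<kappa> * B2 x y"
proof -
  have rho: "rho g *\<^sub>v x \<in> carrier_vec d" if "g \<in> GL n" "x \<in> carrier_vec d" for g x
    using irr that unfolding irreducible_rep_def is_rep_def
    by (auto intro!: mult_mat_vec_carrier[of _ d d])
  have d: "d > 0" using irr by (simp add: irreducible_rep_def)
  \<comment> \<open>For each \<open>a\<close>, \<open>b\<close> the vectors \<open>x\<close> with a
    B1(x,.) = b B2(x,.) form an invariant subspace. The case \<open>a = 0\<close>,
    \<open>b = 1\<close> makes \<open>B2\<close> nondegenerate; the case \<open>a = 1\<close>,
    \<open>b = \<kappa>\<close> finishes the proof.\<close>
  have dep: "x = 0\<^sub>v d" if dep: "x \<in> carrier_vec d" "\<And>y. y \<in> carrier_vec d \<Longrightarrow> a * B1 x y = b * B2 x y"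
    and ex: "x1 \<in> carrier_vec d" "y1 \<in> carrier_vec d" "a * B1 x1 y1 \<noteq> b * B2 x1 y1" for x x1 y1 a b
  proof (rule ccontr)
    assume x: "x \<noteq> 0\<^sub>v d"
    let ?S = "{x \<in> carrier_vec d. \<forall>y\<in>carrier_vec d. a * B1 x y = b * B2 x y}"
    have z: "B1 (0\<^sub>v d) y = 0" "B2 (0\<^sub>v d) y = 0" if "y \<in> carrier_vec d" for y
    proof -
      have "B1 (0 \<cdot>\<^sub>v x) y = 0 * B1 x y" "B2 (0 \<cdot>\<^sub>v x) y = 0 * B2 x y"
        using B1 B2 dep(1) that unfolding bilin_def by blast+
      moreover have "0 \<cdot>\<^sub>v x = 0\<^sub>v d" using dep(1) by auto
      ultimately show "B1 (0\<^sub>v d) y = 0" "B2 (0\<^sub>v d) y = 0" by auto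
    qed
    have "is_subspace d ?S"
      unfolding is_subspace_def
    proof (intro conjI ballI allI)
      show "v + w \<in> ?S" if "v \<in> ?S" "w \<in> ?S" for v w
        using that B1 B2 by (simp add: bilin_def distrib_left)
      show "c \<cdot>\<^sub>v v \<in> ?S" if "v \<in> ?S" for c v
        using that B1 B2 by (simp add: bilin_def mult.left_commute[of _ c])
    qed (use z in auto)
    moreover have "rho g *\<^sub>v w \<in> ?S" if "g \<in> GL n" "w \<in> ?S" for g w
      using that rho t by (simp add: inv1 inv2)
    ultimately have "?S = carrier_vec d"
      using irreducible_full[OF irr, of ?S x] x dep by blast
    then show False using ex by blast
  qed
  obtain b1 where b1: "b1 \<in> carrier_mat d d" "\<And>x y. x \<in> carrier_vec d \<Longrightarrow> y \<in> carrier_vec d \<Longrightarrow> B1 x y = y \<bullet> (b1 *\<^sub>v x)"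
    using bilin_matrix[OF B1] by blast
  obtain b2 where b2: "b2 \<in> carrier_mat d d" "\<And>x y. x \<in> carrier_vec d \<Longrightarrow> y \<in> carrier_vec d \<Longrightarrow> B2 x y = y \<bullet> (b2 *\<^sub>v x)"
    using bilin_matrix[OF B2] by blast
  have G: "b2 \<in> GL d"
  proof (rule GL_if_injective[OF b2(1)])
    fix x :: "complex vec" assume "x \<in> carrier_vec d" "b2 *\<^sub>v x = 0\<^sub>v d"
    then show "x = 0\<^sub>v d" using dep[of x 0 1 x0 y0] b2(2) nz by auto
  qed
  let ?M = "mat_inv d b2 * b1"
  have M: "?M \<in> carrier_mat d d" using mat_inv(1)[OF G] b1(1) by simp
  \<comment> \<open>The factor is an eigenvalue of b2^-1 b1; an eigenvector is a nonzero element of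
    the corresponding invariant subspace.\<close>
  obtain \<kappa> where "eigenvalue ?M \<kappa>" using spectrum_non_empty[OF M d] by (auto simp: spectrum_def)
  then obtain x where x: "x \<in> carrier_vec d" "x \<noteq> 0\<^sub>v d" "?M *\<^sub>v x = \<kappa> \<cdot>\<^sub>v x"
    using M unfolding eigenvalue_def eigenvector_def by auto
  have "b1 *\<^sub>v x = (b2 * ?M) *\<^sub>v x" using mat_inv_cancel(1)[OF G b1(1)] by simp
  also have "\<dots> = b2 *\<^sub>v (\<kappa> \<cdot>\<^sub>v x)" using assoc_mult_mat_vec[OF b2(1) M x(1)] x(3) by simp
  also have "\<dots> = \<kappa> \<cdot>\<^sub>v (b2 *\<^sub>v x)" using mult_mat_vec[OF b2(1) x(1)] .
  finally have eq: "b1 *\<^sub>v x = \<kappa> \<cdot>\<^sub>v (b2 *\<^sub>v x)" .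
  have "1 * B1 x y = \<kappa> * B2 x y" if "y \<in> carrier_vec d" for y
    using that x(1) b2(1) by (simp add: b1(2) b2(2) eq mult_mat_vec_carrier[of _ d d])
  from dep[OF x(1) this] x(2) have "1 * B1 x y = \<kappa> * B2 x y" if "x \<in> carrier_vec d" "y \<in> carrier_vec d" for x y
    using that by blast
  then show ?thesis by auto
qed

context
  fixes n d :: nat and rho :: "'a::{finite,field} mat \<Rightarrow> complex mat"
  assumes irr: "irreducible_rep n d rho"
begin

lemma rho_carrier: "g \<in> GL n \<Longrightarrow> rho g \<in> carrier_mat d d"
  using irr by (simp add: irreducible_rep_def is_rep_def)

lemma rho_vec [simp]: "g \<in> GL n \<Longrightarrow> x \<in> carrier_vec d \<Longrightarrow> rho g *\<^sub>v x \<in> carrier_vec d"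
  using rho_carrier[of g] by (rule mult_mat_vec_carrier)

lemma rho_mult: "g \<in> GL n \<Longrightarrow> h \<in> GL n \<Longrightarrow> x \<in> carrier_vec d \<Longrightarrow> rho (g * h) *\<^sub>v x = rho g *\<^sub>v (rho h *\<^sub>v x)"
  using irr assoc_mult_mat_vec[OF rho_carrier[of g] rho_carrier[of h]] by (simp add: irreducible_rep_def is_rep_def)

lemma rho_one: "x \<in> carrier_vec d \<Longrightarrow> rho (1\<^sub>m n) *\<^sub>v x = x"
  using irr by (simp add: irreducible_rep_def is_rep_def)

lemma d_pos: "d > 0"
  using irr by (simp add: irreducible_rep_def)

lemma rho_add: "g \<in> GL n \<Longrightarrow> x \<in> carrier_vec d \<Longrightarrow> y \<in> carrier_vec d \<Longrightarrow> rho g *\<^sub>v (x + y) = rho g *\<^sub>v x + rho g *\<^sub>v y"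
  using rho_carrier[of g] by (rule mult_add_distrib_mat_vec)

lemma rho_smult: "g \<in> GL n \<Longrightarrow> x \<in> carrier_vec d \<Longrightarrow> rho g *\<^sub>v (c \<cdot>\<^sub>v x) = c \<cdot>\<^sub>v (rho g *\<^sub>v x)"
  using rho_carrier[of g] by (rule mult_mat_vec)

lemma linf_rho: "l \<in> carrier_vec d \<Longrightarrow> g \<in> GL n \<Longrightarrow> linf d (\<lambda>x. l \<bullet> (rho g *\<^sub>v x))"
  by (simp add: linf_def rho_add rho_smult scalar_prod_add_distrib[of _ d])

text \<open>The sum is the average over G of the conjugates of the rank-one operator w -> (l.w) v.
  It commutes with G, hence is a scalar; its trace is |G| times \<open>l \<bullet> v\<close>, so the
  scalar is nonzero.\<close>

lemma schur_average:
  assumes v: "v \<in> carrier_vec d" and l: "l \<in> carrier_vec d" and lv: "l \<bullet> v \<noteq> 0"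
  shows "\<exists>\<kappa>. \<kappa> \<noteq> 0 \<and> (\<forall>x\<in>carrier_vec d. \<forall>y\<in>carrier_vec d.
     (\<Sum>g\<in>GL n. (y \<bullet> (rho g *\<^sub>v v)) * (l \<bullet> (rho (mat_inv n g) *\<^sub>v x))) = \<kappa> * (y \<bullet> x))"
proof -
  define C where "C = (\<lambda>x y. \<Sum>g\<in>GL n. (y \<bullet> (rho g *\<^sub>v v)) * (l \<bullet> (rho (mat_inv n g) *\<^sub>v x)))"
  have "bilin d (\<lambda>x y. \<Sum>g\<in>GL n. (l \<bullet> (rho (mat_inv n g) *\<^sub>v x)) * (y \<bullet> (rho g *\<^sub>v v)))"
    using linf_rho[OF l] v by (intro bilin_sum linf_scalar_left) auto
  then have C: "bilin d C" unfolding C_def by (subst mult.commute)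
  have inv: "C (rho h *\<^sub>v x) y = C x (transpose_mat (rho h) *\<^sub>v y)"
    if h: "h \<in> GL n" and x: "x \<in> carrier_vec d" and y: "y \<in> carrier_vec d" for h x y
  proof -
    define F where "F = (\<lambda>g. (y \<bullet> (rho g *\<^sub>v v)) * (l \<bullet> (rho (mat_inv n g) *\<^sub>v (rho h *\<^sub>v x))))"
    have "C (rho h *\<^sub>v x) y = (\<Sum>g\<in>GL n. F (h * g))"
      unfolding C_def using mat_group_sum(2)[OF mat_group_GL h, of F] by (simp add: F_def)
    also have "\<dots> = C x (transpose_mat (rho h) *\<^sub>v y)"
      unfolding C_def
    proof (rule sum.cong[OF refl])
      fix g :: "'a mat" assume g: "g \<in> GL n"
      have "mat_inv n (h * g) * h = mat_inv n g"
        using mat_inv_cancel_right(2)[OF h, of "mat_inv n g" n] mat_inv_mult[OF h g] mat_inv(1)[OF g] by simp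
      then have "rho (mat_inv n (h * g)) *\<^sub>v (rho h *\<^sub>v x) = rho (mat_inv n g) *\<^sub>v x"
        using rho_mult[of "mat_inv n (h * g)" h x] g h x by simp
      moreover have "y \<bullet> (rho (h * g) *\<^sub>v v) = (transpose_mat (rho h) *\<^sub>v y) \<bullet> (rho g *\<^sub>v v)"
        using transpose_vec_mult_scalar[OF rho_carrier[OF h], of "rho g *\<^sub>v v" y] g h v y by (simp add: rho_mult)
      ultimately show "F (h * g) = ((transpose_mat (rho h) *\<^sub>v y) \<bullet> (rho g *\<^sub>v v)) * (l \<bullet> (rho (mat_inv n g) *\<^sub>v x))"
        by (simp add: F_def)
    qed
    finally show ?thesis .
  qed
  have "\<exists>\<kappa>. \<forall>x\<in>carrier_vec d. \<forall>y\<in>carrier_vec d. C x y = \<kappa> * (y \<bullet> x)"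
  proof (rule schur_form[OF irr C bilin_scalar, where t = "\<lambda>g y. transpose_mat (rho g) *\<^sub>v y"
        and ?x0.0 = "unit_vec d 0" and ?y0.0 = "unit_vec d 0"])
    show "C (rho g *\<^sub>v x) y = C x (transpose_mat (rho g) *\<^sub>v y)"
      if "g \<in> GL n" "x \<in> carrier_vec d" "y \<in> carrier_vec d" for g x y using inv[OF that] .
    show "transpose_mat (rho g) *\<^sub>v y \<in> carrier_vec d" if "g \<in> GL n" "y \<in> carrier_vec d" for g y
      using that rho_carrier[OF that(1)] by (intro mult_mat_vec_carrier[of _ d d]) auto
    show "y \<bullet> (rho g *\<^sub>v x) = (transpose_mat (rho g) *\<^sub>v y) \<bullet> x"
      if "g \<in> GL n" "x \<in> carrier_vec d" "y \<in> carrier_vec d" for g x y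
      using transpose_vec_mult_scalar[OF rho_carrier[OF that(1)] that(2,3)] by simp
    show "unit_vec d 0 \<in> carrier_vec d" "unit_vec d 0 \<in> carrier_vec d" "unit_vec d 0 \<bullet> unit_vec d 0 \<noteq> (0 :: complex)"
      using d_pos by auto
  qed
  then obtain \<kappa> where \<kappa>: "\<And>x y. x \<in> carrier_vec d \<Longrightarrow> y \<in> carrier_vec d \<Longrightarrow> C x y = \<kappa> * (y \<bullet> x)" by blast
  \<comment> \<open>Both sides compute the trace of the averaged operator.\<close>
  have "\<kappa> * of_nat d = (\<Sum>i<d. C (unit_vec d i) (unit_vec d i))"
    using \<kappa> by (simp add: mult.commute)
  also have "\<dots> = (\<Sum>g\<in>GL n. \<Sum>i<d. (rho g *\<^sub>v v) $ i * (l \<bullet> (rho (mat_inv n g) *\<^sub>v unit_vec d i)))"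
    unfolding C_def by (subst sum.swap) (auto intro!: sum.cong simp: v)
  also have "\<dots> = (\<Sum>g\<in>GL n. l \<bullet> (rho (mat_inv n g) *\<^sub>v (rho g *\<^sub>v v)))"
  proof (rule sum.cong[OF refl])
    fix g :: "'a mat" assume g: "g \<in> GL n"
    show "(\<Sum>i<d. (rho g *\<^sub>v v) $ i * (l \<bullet> (rho (mat_inv n g) *\<^sub>v unit_vec d i)))
       = l \<bullet> (rho (mat_inv n g) *\<^sub>v (rho g *\<^sub>v v))"
      by (rule linear_functional_expand[OF linf_rho[OF l], symmetric]) (use g v in auto)
  qed
  also have "\<dots> = (\<Sum>g\<in>(GL n :: 'a mat set). l \<bullet> v)"
  proof (rule sum.cong[OF refl])
    fix g :: "'a mat" assume g: "g \<in> GL n"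
    show "l \<bullet> (rho (mat_inv n g) *\<^sub>v (rho g *\<^sub>v v)) = l \<bullet> v"
      using rho_mult[of "mat_inv n g" g v] mat_inv(3)[OF g] rho_one[OF v] g v by simp
  qed
  finally have "\<kappa> * of_nat d = of_nat (card (GL n :: 'a mat set)) * (l \<bullet> v)" by simp
  moreover have "card (GL n :: 'a mat set) > 0"
    using finite_GL GL_one card_gt_0_iff by blast
  ultimately have "\<kappa> \<noteq> 0" using lv by auto
  then show ?thesis using \<kappa> unfolding C_def by blast
qed

end

section \<open>Uniqueness of Whittaker functionals\<close>

context additive_character
begin

lemma whittaker_bieq:
  fixes rho :: "'a mat \<Rightarrow> complex mat"
  assumes irr: "irreducible_rep n d rho" and l: "is_whittaker_functional n d rho chi l"
    and v: "v \<in> carrier_vec d" "\<And>u. u \<in> N n \<Longrightarrow> rho u *\<^sub>v v = psiN chi n u \<cdot>\<^sub>v v"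
  shows "bieq n (\<lambda>g. l \<bullet> (rho g *\<^sub>v v))"
  unfolding bieq_def
proof (intro ballI conjI)
  fix g u :: "'a mat" assume g: "g \<in> GL n" and u: "u \<in> N n"
  have lc: "l \<in> carrier_vec d" using l by (simp add: is_whittaker_functional_def)
  note uG = unip_GL[OF u]
  show "l \<bullet> (rho (u * g) *\<^sub>v v) = psiN chi n u * (l \<bullet> (rho g *\<^sub>v v))"
    using l u rho_vec[OF irr g v(1)] by (simp add: rho_mult[OF irr uG g v(1)] is_whittaker_functional_def)
  show "l \<bullet> (rho (g * u) *\<^sub>v v) = psiN chi n u * (l \<bullet> (rho g *\<^sub>v v))"
    using rho_vec[OF irr g v(1)] lc by (simp add: rho_mult[OF irr g uG v(1)] v(2)[OF u] rho_smult[OF irr g v(1)])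
qed

text \<open>Any \<open>x\<close> with \<open>l \<bullet> x \<noteq> 0\<close> is projected to the
  right equivariance by averaging over the unipotent group; every term of the average keeps the
  value \<open>l \<bullet> x\<close>, so nothing cancels under \<open>l\<close>.\<close>

lemma whittaker_vector:
  fixes rho :: "'a mat \<Rightarrow> complex mat"
  assumes irr: "irreducible_rep n d rho" and l: "is_whittaker_functional n d rho chi l" "l \<noteq> 0\<^sub>v d"
  obtains v where "v \<in> carrier_vec d" "l \<bullet> v \<noteq> 0" "\<And>u. u \<in> N n \<Longrightarrow> rho u *\<^sub>v v = psiN chi n u \<cdot>\<^sub>v v"
proof -
  have lc: "l \<in> carrier_vec d" using l by (simp add: is_whittaker_functional_def)
  obtain i where i: "i < d" "l $ i \<noteq> 0" using l(2) lc by (metis eq_vecI carrier_vecD index_zero_vec(1) index_zero_vec(2))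
  define x where "x = (unit_vec d i :: complex vec)"
  have x: "x \<in> carrier_vec d" "l \<bullet> x \<noteq> 0" using i lc by (auto simp: x_def)
  define F where "F = (\<lambda>u. inverse (psiN chi n u) \<cdot>\<^sub>v (rho u *\<^sub>v x))"
  have Fc: "F u \<in> carrier_vec d" if "u \<in> N n" for u
    using rho_vec[OF irr unip_GL[OF that] x(1)] by (simp add: F_def)
  define v where "v = vsum d (N n) F"
  note NG = mat_group_unip[OF subring_UNIV, where ?'a = 'a, of n]
  have "l \<bullet> v = (\<Sum>u\<in>N n. l \<bullet> F u)" unfolding v_def using scalar_vsum[of l d "N n" F] lc Fc by simp
  also have "\<dots> = (\<Sum>u\<in>N n. l \<bullet> x)"
  proof (rule sum.cong[OF refl])
    fix u assume u: "u \<in> N n"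
    show "l \<bullet> F u = l \<bullet> x"
      using rho_vec[OF irr unip_GL[OF u] x(1)] lc u l(1) x(1)
      by (simp add: F_def is_whittaker_functional_def)
  qed
  finally have "l \<bullet> v = of_nat (card (N n)) * (l \<bullet> x)" by simp
  moreover have "card (N n) > 0" using mat_group_finite[OF NG] mat_groupD(2)[OF NG] card_gt_0_iff by blast
  ultimately have "l \<bullet> v \<noteq> 0" using x by simp
  moreover have "rho w *\<^sub>v v = psiN chi n w \<cdot>\<^sub>v v" if w: "w \<in> N n" for w
  proof (rule eq_vecI)
    note wG = unip_GL[OF w]
    have e: "rho w *\<^sub>v v = vsum d (N n) (\<lambda>u. rho w *\<^sub>v F u)"
      unfolding v_def by (rule mult_vsum[OF rho_carrier[OF irr wG] Fc])
    have e2: "rho w *\<^sub>v F u = psiN chi n w \<cdot>\<^sub>v F (w * u)" if u: "u \<in> N n" for u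
      using rho_mult[OF irr wG unip_GL[OF u] x(1)] rho_smult[OF irr wG rho_vec[OF irr unip_GL[OF u] x(1)]]
      by (simp add: F_def psiN_mult[OF w u] smult_smult_assoc mult.assoc[symmetric])
    show "(rho w *\<^sub>v v) $ i = (psiN chi n w \<cdot>\<^sub>v v) $ i" if "i < dim_vec (psiN chi n w \<cdot>\<^sub>v v)" for i
    proof -
      have i: "i < d" using that by (simp add: v_def vsum_def)
      have "(rho w *\<^sub>v v) $ i = (\<Sum>u\<in>N n. psiN chi n w * F (w * u) $ i)"
        unfolding e vsum_def using i e2 carrier_vecD[OF Fc[OF mat_groupD(3)[OF NG w]]]
        by (auto intro!: sum.cong)
      also have "\<dots> = (\<Sum>u\<in>N n. psiN chi n w * F u $ i)"
        by (rule mat_group_sum(2)[OF NG w, of "\<lambda>u. psiN chi n w * F u $ i"])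
      finally show ?thesis using i by (simp add: v_def vsum_def sum_distrib_left)
    qed
    show "dim_vec (rho w *\<^sub>v v) = dim_vec (psiN chi n w \<cdot>\<^sub>v v)" unfolding e by (simp add: v_def vsum_def)
  qed
  ultimately show thesis using that[of v] by (simp add: v_def)
qed

text \<open>For a Whittaker vector v, the symmetry of the function g to k(rho(g) v) under the
  anti-transpose shows that the invariant pairing B k below satisfies B k v = kappa k with kappa
  independent of k, and by Schur's lemma the pairings B l' and B l are proportional.\<close>

theorem whittaker_unique:
  fixes rho :: "'a mat \<Rightarrow> complex mat"
  assumes irr: "irreducible_rep n d rho"
    and l: "is_whittaker_functional n d rho chi l" "l \<noteq> 0\<^sub>v d"
    and l': "is_whittaker_functional n d rho chi l'"
  shows "\<exists>c. \<forall>x\<in>carrier_vec d. l' \<bullet> x = c * (l \<bullet> x)"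
proof -
  obtain v where v: "v \<in> carrier_vec d" "l \<bullet> v \<noteq> 0" "\<And>u. u \<in> N n \<Longrightarrow> rho u *\<^sub>v v = psiN chi n u \<cdot>\<^sub>v v"
    by (rule whittaker_vector[OF irr l]) blast
  have lc: "l \<in> carrier_vec d" and lc': "l' \<in> carrier_vec d"
    using l l' by (auto simp: is_whittaker_functional_def)
  obtain \<kappa> where \<kappa>: "\<kappa> \<noteq> 0" "\<And>x y. x \<in> carrier_vec d \<Longrightarrow> y \<in> carrier_vec d \<Longrightarrow>
     (\<Sum>g\<in>GL n. (y \<bullet> (rho g *\<^sub>v v)) * (l \<bullet> (rho (mat_inv n g) *\<^sub>v x))) = \<kappa> * (y \<bullet> x)"
    using schur_average[OF irr v(1) lc v(2)] by blast
  \<comment> \<open>Compared with the sum in \<open>schur_average\<close>, the second factor carries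
    the reflected element. This makes \<open>B k\<close> invariant when \<open>h\<close> acts on
    \<open>x\<close> and its reflection on \<open>y\<close>, a transformation law independent of
    \<open>k\<close>, so that \<open>schur_form\<close> can compare two choices of
    \<open>k\<close>.\<close>
  define B where "B = (\<lambda>k x y. \<Sum>g\<in>GL n. (l \<bullet> (rho (mat_inv n g) *\<^sub>v x)) * (k \<bullet> (rho (antitr n g) *\<^sub>v y)))"
  have bil: "bilin d (B k)" if "k \<in> carrier_vec d" for k
    unfolding B_def using that lc by (intro bilin_sum linf_rho[OF irr]) auto
  have inv: "B k (rho h *\<^sub>v x) y = B k x (rho (antitr n h) *\<^sub>v y)"
    if h: "h \<in> GL n" and x: "x \<in> carrier_vec d" and y: "y \<in> carrier_vec d" for k h x y
  proof -
    define F where "F = (\<lambda>g. (l \<bullet> (rho (mat_inv n g) *\<^sub>v (rho h *\<^sub>v x))) * (k \<bullet> (rho (antitr n g) *\<^sub>v y)))"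
    have "B k (rho h *\<^sub>v x) y = (\<Sum>g\<in>GL n. F (h * g))"
      unfolding B_def using mat_group_sum(2)[OF mat_group_GL h, of F] by (simp add: F_def)
    also have "\<dots> = B k x (rho (antitr n h) *\<^sub>v y)"
      unfolding B_def
    proof (rule sum.cong[OF refl])
      fix g :: "'a mat" assume g: "g \<in> GL n"
      have "mat_inv n (h * g) * h = mat_inv n g"
        using mat_inv_cancel_right(2)[OF h, of "mat_inv n g" n] mat_inv_mult[OF h g] mat_inv(1)[OF g] by simp
      then have "rho (mat_inv n (h * g)) *\<^sub>v (rho h *\<^sub>v x) = rho (mat_inv n g) *\<^sub>v x"
        using rho_mult[OF irr, of "mat_inv n (h * g)" h x] g h x by simp
      moreover have "rho (antitr n (h * g)) *\<^sub>v y = rho (antitr n g) *\<^sub>v (rho (antitr n h) *\<^sub>v y)"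
        using rho_mult[OF irr antitr_GL[OF g] antitr_GL[OF h] y] antitr_mult[of h n g] g h by simp
      ultimately show "F (h * g) = (l \<bullet> (rho (mat_inv n g) *\<^sub>v x)) * (k \<bullet> (rho (antitr n g) *\<^sub>v (rho (antitr n h) *\<^sub>v y)))"
        by (simp add: F_def)
    qed
    finally show ?thesis .
  qed
  have Bv: "B k v y = \<kappa> * (k \<bullet> y)" if k: "is_whittaker_functional n d rho chi k" and y: "y \<in> carrier_vec d" for k y
  proof -
    have kc: "k \<in> carrier_vec d" using k by (simp add: is_whittaker_functional_def)
    have sym: "k \<bullet> (rho (antitr n g) *\<^sub>v v) = k \<bullet> (rho g *\<^sub>v v)" if "g \<in> GL n" for g
      using bieq_antitr[OF whittaker_bieq[OF irr k v(1) v(3)] that] by simp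
    \<comment> \<open>With t for the reflection, symmetry rewrites k(g^t h v) as k(h^t g v). The
      average over \<open>g\<close> is then the one of \<open>schur_average\<close> with k moved by
      h^t, giving \<kappa> k(h^t v), and symmetry once more turns this into \<kappa> k(h v).\<close>
    have orbit: "B k v (rho h *\<^sub>v v) = \<kappa> * (k \<bullet> (rho h *\<^sub>v v))" if h: "h \<in> GL n" for h
    proof -
      let ?h = "antitr n h"
      have hG: "?h \<in> GL n" using h by simp
      have hh: "antitr n ?h = h" using antitr_antitr[of h n] h by simp
      have "B k v (rho h *\<^sub>v v) = (\<Sum>g\<in>GL n. ((transpose_mat (rho ?h) *\<^sub>v k) \<bullet> (rho g *\<^sub>v v)) * (l \<bullet> (rho (mat_inv n g) *\<^sub>v v)))"
        unfolding B_def
      proof (rule sum.cong[OF refl])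
        fix g :: "'a mat" assume g: "g \<in> GL n"
        have "k \<bullet> (rho (antitr n g) *\<^sub>v (rho h *\<^sub>v v)) = k \<bullet> (rho (antitr n (?h * g)) *\<^sub>v v)"
          using rho_mult[OF irr antitr_GL[OF g] h v(1)] antitr_mult[OF GL_carrier[OF hG] GL_carrier[OF g]] hh by simp
        also have "\<dots> = k \<bullet> (rho ?h *\<^sub>v (rho g *\<^sub>v v))"
          using sym[OF GL_mult[OF hG g]] rho_mult[OF irr hG g v(1)] by simp
        also have "\<dots> = (transpose_mat (rho ?h) *\<^sub>v k) \<bullet> (rho g *\<^sub>v v)"
          by (rule transpose_vec_mult_scalar[OF rho_carrier[OF irr hG] rho_vec[OF irr g v(1)] kc, symmetric])
        finally show "l \<bullet> (rho (mat_inv n g) *\<^sub>v v) * (k \<bullet> (rho (antitr n g) *\<^sub>v (rho h *\<^sub>v v))) =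
          (transpose_mat (rho ?h) *\<^sub>v k) \<bullet> (rho g *\<^sub>v v) * (l \<bullet> (rho (mat_inv n g) *\<^sub>v v))" by simp
      qed
      also have "\<dots> = \<kappa> * ((transpose_mat (rho ?h) *\<^sub>v k) \<bullet> v)"
        by (rule \<kappa>(2)[OF v(1)]) (use rho_carrier[OF irr hG] kc in \<open>auto intro!: mult_mat_vec_carrier[of _ d d]\<close>)
      also have "(transpose_mat (rho ?h) *\<^sub>v k) \<bullet> v = k \<bullet> (rho ?h *\<^sub>v v)"
        by (rule transpose_vec_mult_scalar[OF rho_carrier[OF irr hG] v(1) kc])
      also have "\<dots> = k \<bullet> (rho h *\<^sub>v v)" by (rule sym[OF h])
      finally show ?thesis .
    qed
    \<comment> \<open>The identity holds on the orbit of \<open>v\<close>; asking for it at all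
      translates makes the set an invariant subspace, hence everything.\<close>
    let ?S = "{x \<in> carrier_vec d. \<forall>h\<in>GL n. B k v (rho h *\<^sub>v x) = \<kappa> * (k \<bullet> (rho h *\<^sub>v x))}"
    have Badd: "B k v (x + x') = B k v x + B k v x'" "B k v (c \<cdot>\<^sub>v x) = c * B k v x"
      if "x \<in> carrier_vec d" "x' \<in> carrier_vec d" for x x' c
      using bil[OF kc] v(1) that unfolding bilin_def by blast+
    have B0: "B k v (0\<^sub>v d) = 0"
    proof -
      have "0 \<cdot>\<^sub>v v = 0\<^sub>v d" using v(1) by auto
      then show ?thesis using Badd(2)[OF v(1) v(1), of 0] by simp
    qed
    have "is_subspace d ?S"
      unfolding is_subspace_def
    proof (intro conjI ballI allI)
      show "0\<^sub>v d \<in> ?S"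
      proof -
        have "rho h *\<^sub>v 0\<^sub>v d = 0\<^sub>v d" if "h \<in> GL n" for h
          using rho_carrier[OF irr that] by auto
        then show ?thesis using B0 kc by simp
      qed
      show "x + x' \<in> ?S" if "x \<in> ?S" "x' \<in> ?S" for x x'
        using that rho_vec[OF irr] kc
        by (simp add: rho_add[OF irr] Badd scalar_prod_add_distrib[of _ d] distrib_left)
      show "c \<cdot>\<^sub>v x \<in> ?S" if "x \<in> ?S" for c x
        using that rho_vec[OF irr] kc
        by (simp add: rho_smult[OF irr] Badd(2)[OF _ v(1)])
    qed auto
    moreover have "rho g *\<^sub>v x \<in> ?S" if "g \<in> GL n" "x \<in> ?S" for g x
      using that rho_vec[OF irr] by (simp add: rho_mult[OF irr, symmetric])
    moreover have "v \<in> ?S" using v(1) orbit by simp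
    moreover have "v \<noteq> 0\<^sub>v d" using v(2) lc by auto
    ultimately have "?S = carrier_vec d" using irreducible_full[OF irr, of ?S v] by blast
    then have "B k v (rho (1\<^sub>m n) *\<^sub>v y) = \<kappa> * (k \<bullet> (rho (1\<^sub>m n) *\<^sub>v y))" using y GL_one by blast
    then show ?thesis using rho_one[OF irr y] by simp
  qed
  have "B l v v \<noteq> 0" using Bv[OF l(1) v(1)] \<kappa> v(2) by simp
  have "\<exists>c. \<forall>x\<in>carrier_vec d. \<forall>y\<in>carrier_vec d. B l' x y = c * B l x y"
  proof (rule schur_form[OF irr bil[OF lc'] bil[OF lc], where t = "\<lambda>g y. rho (antitr n g) *\<^sub>v y"
        and ?x0.0 = v and ?y0.0 = v])
    show "rho (antitr n g) *\<^sub>v y \<in> carrier_vec d" if "g \<in> GL n" "y \<in> carrier_vec d" for g y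
      using that rho_vec[OF irr] by simp
  qed (use inv v(1) \<open>B l v v \<noteq> 0\<close> in auto)
  then obtain c where c: "\<And>y. y \<in> carrier_vec d \<Longrightarrow> B l' v y = c * B l v y" using v(1) by blast
  have "l' \<bullet> y = c * (l \<bullet> y)" if "y \<in> carrier_vec d" for y
    using c[OF that] Bv[OF l' that] Bv[OF l(1) that] \<kappa>(1) by simp
  then show ?thesis by blast
qed

end

section \<open>Fourier analysis along the columns of the unipotent group\<close>

text \<open>Pick \<open>j\<close> with \<open>a $ j \<noteq> 0\<close>; then
  \<open>j \<le> c\<close>. In the identity matrix, row \<open>c\<close> is replaced by
  \<open>a\<close>, and row \<open>j\<close>, if different, by the unit row at \<open>c\<close> thus
  displaced. Rows below \<open>c\<close> are untouched.\<close>

lemma row_completion: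
  fixes a :: "'a::field vec"
  assumes K: "0 \<in> K" "1 \<in> K" and c: "c < n" and a: "a \<in> carrier_vec n" "a \<noteq> 0\<^sub>v n"
    and aK: "\<And>i. i < n \<Longrightarrow> a $ i \<in> K" and a0: "\<And>i. c < i \<Longrightarrow> i < n \<Longrightarrow> a $ i = 0"
  shows "\<exists>p\<in>GL_sub n K. (\<forall>k<n. p $$ (c,k) = a $ k) \<and>
     (\<forall>i k. c < i \<and> i < n \<and> k < n \<longrightarrow> p $$ (i,k) = (if k = i then 1 else 0))"
proof -
  obtain j where j: "j < n" "a $ j \<noteq> 0"
    using a by (metis carrier_vecD eq_vecI index_zero_vec(1) index_zero_vec(2))
  then have jc: "j \<le> c" using a0[of j] by force
  define p where "p = mat n n (\<lambda>(i,k). if i = c then a $ k else if k = (if i = j then c else i) then 1 else 0)"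
  have pc: "p \<in> carrier_mat n n" by (simp add: p_def)
  have "p \<in> GL n"
  proof (rule GL_if_injective[OF pc])
    fix x :: "'a vec" assume x: "x \<in> carrier_vec n" and px: "p *\<^sub>v x = 0\<^sub>v n"
    have row: "(\<Sum>k<n. p $$ (i,k) * x $ k) = 0" if "i < n" for i
      using index_mult_vec_sum[OF pc x that] px that by simp
    have other: "x $ (if i = j then c else i) = 0" if i: "i < n" "i \<noteq> c" for i
    proof -
      have "(\<Sum>k<n. p $$ (i,k) * x $ k) = (\<Sum>k<n. if k = (if i = j then c else i) then x $ k else 0)"
        using i by (intro sum.cong refl) (auto simp: p_def)
      also have "\<dots> = x $ (if i = j then c else i)" using i c by (subst sum.delta) auto
      finally show ?thesis using row[OF i(1)] by simp
    qed
    have nj: "x $ k = 0" if "k < n" "k \<noteq> j" for k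
      using other[of k] other[of j] that j by (cases "k = c") auto
    have "(\<Sum>k<n. p $$ (c,k) * x $ k) = (\<Sum>k<n. if k = j then a $ j * x $ j else 0)"
      using nj c by (intro sum.cong refl) (auto simp: p_def)
    then have "x $ j = 0" using row[OF c] j by simp
    then show "x = 0\<^sub>v n" using nj x by (intro eq_vecI) auto
  qed
  then have "p \<in> GL_sub n K" using K aK by (auto simp: GL_sub_def p_def)
  then show ?thesis using c jc by (intro bexI[of _ p]) (auto simp: p_def)
qed

lemma sum_character_zero:
  fixes S :: "'b set" and f :: "'b \<Rightarrow> complex"
  assumes "bij_betw \<sigma> S S" "\<And>x. x \<in> S \<Longrightarrow> f (\<sigma> x) = c * f x" "c \<noteq> 1"
  shows "sum f S = 0"
proof -
  have "sum f S = (\<Sum>x\<in>S. f (\<sigma> x))" by (rule sum.reindex_bij_betw[OF assms(1), symmetric])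
  also have "\<dots> = c * sum f S" using assms(2) by (simp add: sum_distrib_left)
  finally have "(1 - c) * sum f S = 0" by (simp add: algebra_simps)
  then show ?thesis using assms(3) by simp
qed

text \<open>Abstracts the pair psi_E, F: \<open>chi_K\<close> and \<open>K_dual\<close> together say
  that \<open>K\<close> is its own annihilator under (t, a) -> chi(t a).\<close>

locale relative_character = additive_character chi
  for chi :: "'a::{finite,field} \<Rightarrow> complex" +
  fixes K :: "'a set" and n :: nat
  assumes K: "subring K"
    and chi_K: "x \<in> K \<Longrightarrow> chi x = 1"
    and K_dual: "(\<And>t. t \<in> K \<Longrightarrow> chi (t * a) = 1) \<Longrightarrow> a \<in> K"
begin

section \<open>Column subgroups and the groups acting on them\<close>

definition X :: "nat \<Rightarrow> 'a set \<Rightarrow> 'a vec set" where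
  "X c R = {x \<in> carrier_vec n. \<forall>i<n. x $ i \<in> R \<and> (c \<le> i \<longrightarrow> x $ i = 0)}"

definition U :: "nat \<Rightarrow> 'a vec \<Rightarrow> 'a mat" where
  "U c x = rk1 n (\<lambda>i. if i < n then x $ i else 0) (\<lambda>j. if j = c then 1 else 0)"

text \<open>The unipotent matrices living in columns after \<open>c\<close>: all of
  \<open>N n\<close> for \<open>c = 0\<close>, trivial for \<open>c = n - 1\<close>.
  \<open>V c\<close> is \<open>V (Suc c)\<close> times the column group
  \<open>U (Suc c)\<close>.\<close>

definition V :: "nat \<Rightarrow> 'a mat set" where
  "V c = {u \<in> N n. \<forall>j<n. j \<le> c \<longrightarrow> (\<forall>i<j. u $$ (i,j) = 0)}"

text \<open>\<open>P (n - 1) K\<close> is the rational mirabolic group. In general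
  \<open>P c\<close> contains the column group \<open>U c\<close>, normalises it, and normalises
  \<open>V c\<close> without changing its character (\<open>P_U\<close>,
  \<open>P_V\<close>).\<close>

definition P :: "nat \<Rightarrow> 'a set \<Rightarrow> 'a mat set" where
  "P c R = {p \<in> GL_sub n R. \<forall>i<n. \<forall>j<n. c \<le> i \<longrightarrow> p $$ (i,j) = (if j = i then 1 else 0)}"

lemma XD: "x \<in> X c R \<Longrightarrow> x \<in> carrier_vec n" "x \<in> X c R \<Longrightarrow> i < n \<Longrightarrow> x $ i \<in> R"
  "x \<in> X c R \<Longrightarrow> i < n \<Longrightarrow> c \<le> i \<Longrightarrow> x $ i = 0"
  by (auto simp: X_def)

lemma finite_X: "finite (X c R)"
  by (rule finite_subset[OF _ finite_carrier_vec[of n]]) (auto simp: X_def)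

lemma X_K: "x \<in> X c K \<Longrightarrow> x \<in> X c UNIV"
  by (auto simp: X_def)

lemma X_add: "subring R \<Longrightarrow> x \<in> X c R \<Longrightarrow> y \<in> X c R \<Longrightarrow> x + y \<in> X c R"
  by (auto simp: X_def subring_def)

lemma X_shift:
  assumes R: "subring R" and y: "y \<in> X c R"
  shows "bij_betw (\<lambda>x. x + y) (X c R) (X c R)"
proof -
  have "inj_on (\<lambda>x. x + y) (X c R)"
  proof (rule inj_onI)
    fix x x' assume x: "x \<in> X c R" "x' \<in> X c R" "x + y = x' + y"
    have "x $ i = x' $ i" if "i < n" for i
      using arg_cong[OF x(3), of "\<lambda>v. v $ i"] that XD(1)[OF x(1)] XD(1)[OF x(2)] XD(1)[OF y] by simp
    then show "x = x'" using XD(1)[OF x(1)] XD(1)[OF x(2)] by (intro eq_vecI) auto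
  qed
  moreover have "(\<lambda>x. x + y) ` X c R \<subseteq> X c R" using X_add[OF R _ y] by blast
  ultimately show ?thesis using finite_X by (simp add: bij_betw_def endo_inj_surj)
qed

lemma U_carrier [simp]: "U c x \<in> carrier_mat n n"
  by (simp add: U_def)

lemma U_mult:
  assumes "g \<in> carrier_mat n n" "a < n" "b < n" "c < n"
  shows "(U c x * g) $$ (a,b) = g $$ (a,b) + x $ a * g $$ (c,b)"
  unfolding U_def rk1_mult[OF assms(1-3)] using assms
  by (simp add: if_distrib[of "\<lambda>t. t * _"] cong: if_cong)

lemma mult_U:
  assumes "g \<in> carrier_mat n n" "a < n" "b < n" "x \<in> carrier_vec n"
  shows "(g * U c x) $$ (a,b) = g $$ (a,b) + (if b = c then (g *\<^sub>v x) $ a else 0)"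
  unfolding U_def mult_rk1[OF assms(1-3)] index_mult_vec_sum[OF assms(1,4,2)] by simp

lemma U_index: "i < n \<Longrightarrow> j < n \<Longrightarrow> U c x $$ (i,j) = (if i = j then 1 else 0) + (if j = c then x $ i else 0)"
  by (simp add: U_def rk1_def)

lemma U_unip:
  assumes "x \<in> X c R" shows "U c x \<in> N n"
  unfolding U_def by (rule rk1_unip) (use XD(3)[OF assms] in \<open>force split: if_splits\<close>)

lemma U_GL [simp]: "x \<in> X c R \<Longrightarrow> U c x \<in> GL n"
  using unip_GL[OF U_unip] .

lemma psiN_U:
  assumes x: "x \<in> X (Suc c) R" and c: "Suc c < n"
  shows "psiN chi n (U (Suc c) x) = chi (x $ c)"
proof -
  have "psiN chi n (U (Suc c) x) = chi (\<Sum>i<n-1. (if i < n then x $ i else 0) * (if i + 1 = Suc c then 1 else 0))"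
    unfolding U_def by (rule psiN_rk1) (use XD(3)[OF x] in \<open>force split: if_splits\<close>)
  moreover have "(\<Sum>i<n-1. (if i < n then x $ i else 0) * (if i + 1 = Suc c then 1 else 0)) = (\<Sum>i<n-1. if i = c then x $ i else 0)"
    by (intro sum.cong) auto
  moreover have "c < n - 1" using c by linarith
  ultimately show ?thesis by simp
qed

lemma U_add:
  assumes "x \<in> X c R" "y \<in> X c R" "c < n"
  shows "U c x * U c y = U c (x + y)"
proof (rule eq_matI)
  fix a b assume "a < dim_row (U c (x + y))" "b < dim_col (U c (x + y))"
  then have ab: "a < n" "b < n" by (auto simp: U_def rk1_def)
  show "(U c x * U c y) $$ (a,b) = U c (x + y) $$ (a,b)"
    using U_mult[OF U_carrier ab assms(3)] U_index ab assms XD(1,3)[OF assms(2)] XD(1)[OF assms(1)] by auto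
qed (auto simp: U_def rk1_def)

lemma PD: "p \<in> P c R \<Longrightarrow> p \<in> GL n" "p \<in> P c R \<Longrightarrow> i < n \<Longrightarrow> j < n \<Longrightarrow> c \<le> i \<Longrightarrow> p $$ (i,j) = (if j = i then 1 else 0)"
  by (auto simp: P_def GL_sub_def)

lemma P_UNIV: "p \<in> P c R \<Longrightarrow> p \<in> P c UNIV"
  by (auto simp: P_def GL_sub_def)

lemma P_mono: "p \<in> P c R \<Longrightarrow> p \<in> P (Suc c) R"
  by (auto simp: P_def)

lemma U_P:
  assumes "x \<in> X c R" "subring R"
  shows "U c x \<in> P c R"
  using assms U_GL[OF assms(1)] by (auto simp: P_def GL_sub_def U_index X_def subring_def)

lemma P_vec:
  assumes p: "p \<in> P c UNIV" and x: "x \<in> carrier_vec n" and i: "c \<le> i" "i < n"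
  shows "(p *\<^sub>v x) $ i = x $ i"
proof -
  have "(p *\<^sub>v x) $ i = (\<Sum>k<n. if k = i then x $ k else 0)"
    unfolding index_mult_vec_sum[OF GL_carrier[OF PD(1)[OF p]] x i(2)]
    using PD(2)[OF p i(2) _ i(1)] by (intro sum.cong) auto
  then show ?thesis using i by simp
qed

lemma P_X_bij:
  assumes p: "p \<in> P c UNIV"
  shows "bij_betw (\<lambda>x. p *\<^sub>v x) (X c UNIV) (X c UNIV)"
proof -
  note G = PD(1)[OF p]
  have "inj_on (\<lambda>x. p *\<^sub>v x) (X c UNIV)"
  proof (rule inj_on_inverseI)
    fix x assume x: "x \<in> X c UNIV"
    have "mat_inv n p *\<^sub>v (p *\<^sub>v x) = (mat_inv n p * p) *\<^sub>v x"
      by (rule assoc_mult_mat_vec[OF mat_inv(1)[OF G] GL_carrier[OF G] XD(1)[OF x], symmetric])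
    then show "mat_inv n p *\<^sub>v (p *\<^sub>v x) = x" using mat_inv(3)[OF G] XD(1)[OF x] by simp
  qed
  moreover have "(\<lambda>x. p *\<^sub>v x) ` X c UNIV \<subseteq> X c UNIV"
  proof
    fix y assume "y \<in> (\<lambda>x. p *\<^sub>v x) ` X c UNIV"
    then obtain x where x: "x \<in> X c UNIV" "y = p *\<^sub>v x" by blast
    then show "y \<in> X c UNIV"
      using P_vec[OF p XD(1)[OF x(1)]] mult_mat_vec_carrier[OF GL_carrier[OF G] XD(1)[OF x(1)]]
      by (auto simp: X_def)
  qed
  ultimately show ?thesis using finite_X by (simp add: bij_betw_def endo_inj_surj)
qed

lemma P_U:
  assumes p: "p \<in> P c UNIV" and x: "x \<in> X c UNIV" and c: "c < n"
  shows "p * U c x = U c (p *\<^sub>v x) * p"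
proof (rule eq_matI)
  note G = GL_carrier[OF PD(1)[OF p]]
  fix a b assume "a < dim_row (U c (p *\<^sub>v x) * p)" "b < dim_col (U c (p *\<^sub>v x) * p)"
  then have ab: "a < n" "b < n" using G by (auto simp: U_def rk1_def)
  show "(p * U c x) $$ (a,b) = (U c (p *\<^sub>v x) * p) $$ (a,b)"
    using mult_U[OF G ab XD(1)[OF x], of c] U_mult[OF G ab c, of "p *\<^sub>v x"] PD(2)[OF p c ab(2)] by simp
qed (use GL_carrier[OF PD(1)[OF p]] in \<open>auto simp: U_def rk1_def\<close>)

lemma VD: "u \<in> V c \<Longrightarrow> u \<in> N n" "u \<in> V c \<Longrightarrow> i < n \<Longrightarrow> j < n \<Longrightarrow> j \<le> c \<Longrightarrow> u $$ (i,j) = (if i = j then 1 else 0)"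
  by (auto simp: V_def unip_def) (metis linorder_neqE_nat)

text \<open>Write u = 1 + b. The columns of b up to \<open>c\<close> vanish and the later rows of
  \<open>p\<close> are unit rows, so b p = b and p u = (1 + p b) p. Left multiplication by
  \<open>p\<close> keeps the rows from \<open>c\<close> on, and the superdiagonal entries in earlier
  rows are zero in both matrices.\<close>

lemma P_V:
  assumes p: "p \<in> P c UNIV" and u: "u \<in> V c"
  shows "\<exists>u'\<in>V c. p * u = u' * p \<and> psiN chi n u' = psiN chi n u"
proof -
  note G = GL_carrier[OF PD(1)[OF p]]
  note uc = GL_carrier[OF unip_GL[OF VD(1)[OF u]]]
  define b where "b = u - 1\<^sub>m n"
  have bc: "b \<in> carrier_mat n n" unfolding b_def by (rule minus_carrier_mat) simp
  have b: "b $$ (i,j) = u $$ (i,j) - (if i = j then 1 else 0)" if "i < n" "j < n" for i j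
    using uc that by (simp add: b_def)
  have u_eq: "u = 1\<^sub>m n + b"
    using uc by (intro eq_matI) (auto simp: b_def)
  have bp: "b * p = b"
  proof (rule eq_matI)
    fix i j assume "i < dim_row b" "j < dim_col b"
    then have ij: "i < n" "j < n" using bc by auto
    have "(b * p) $$ (i,j) = (\<Sum>k<n. if k = j then b $$ (i,k) else 0)"
      unfolding index_mult_sum[OF bc G ij]
    proof (rule sum.cong[OF refl])
      fix k assume "k \<in> {..<n}"
      then show "b $$ (i,k) * p $$ (k,j) = (if k = j then b $$ (i,k) else 0)"
        using b[OF ij(1), of k] VD(2)[OF u ij(1), of k] PD(2)[OF p, of k j] ij by (cases "k \<le> c") auto
    qed
    then show "(b * p) $$ (i,j) = b $$ (i,j)" using ij by simp
  qed (use bc G in auto)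
  define u' where "u' = 1\<^sub>m n + p * b"
  have u'c: "u' \<in> carrier_mat n n" using G bc by (simp add: u'_def)
  have "p * u = p + p * b" using u_eq mult_add_distrib_mat[OF G one_carrier_mat bc] G by simp
  moreover have "u' * p = p + p * b"
    unfolding u'_def using add_mult_distrib_mat[OF one_carrier_mat mult_carrier_mat[OF G bc] G]
      assoc_mult_mat[OF G bc G] bp G by simp
  ultimately have eq: "p * u = u' * p" by simp
  have low: "u' $$ (i,j) = (if i = j then 1 else 0)" if "i < n" "j < n" "j \<le> c" for i j
  proof -
    have "(p * b) $$ (i,j) = 0"
      unfolding index_mult_sum[OF G bc that(1,2)] using b VD(2)[OF u] that by (intro sum.neutral) auto
    then show ?thesis using that G bc by (simp add: u'_def)
  qed
  have high: "u' $$ (i,j) = u $$ (i,j)" if "i < n" "j < n" "c \<le> i" for i j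
    using unit_row_mult[OF G bc that(1,2,1)] PD(2)[OF p that(1) _ that(3)] b[OF that(1,2)] that G bc
    by (simp add: u'_def)
  have "u' $$ (i,j) = 0" if "i < n" "j < i" for i j
    using low[of i j] high[of i j] VD(1)[OF u] that by (cases "j \<le> c") (auto simp: unip_def)
  moreover have "u' $$ (i,i) = 1" if "i < n" for i
    using low[of i i] high[of i i] VD(1)[OF u] that by (cases "i \<le> c") (auto simp: unip_def)
  ultimately have "u' \<in> V c" using u'c low by (auto simp: V_def unip_def)
  moreover have "psiN chi n u' = psiN chi n u"
    unfolding psiN_def
  proof (intro arg_cong[of _ _ chi] sum.cong refl)
    fix i assume "i \<in> {..<n-1}"
    then show "u' $$ (i,i+1) = u $$ (i,i+1)"
      using low[of i "i+1"] high[of i "i+1"] VD(2)[OF u, of i "i+1"] by (cases "c \<le> i") auto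
  qed
  ultimately show ?thesis using eq by blast
qed

text \<open>Column \<open>Suc c\<close> of \<open>v\<close> can be split off unchanged, because the
  remaining factor \<open>u\<close> has unit columns wherever \<open>x\<close> is supported and so
  fixes \<open>x\<close>.\<close>

lemma V_decompose:
  assumes v: "v \<in> V c" and c: "Suc c < n"
  obtains u x where "u \<in> V (Suc c)" "x \<in> X (Suc c) UNIV" "v = u * U (Suc c) x"
    "psiN chi n v = psiN chi n u * chi (v $$ (c, Suc c))"
proof -
  let ?C = "Suc c"
  define u where "u = mat n n (\<lambda>(i,j). if j = ?C \<and> i < ?C then 0 else v $$ (i,j))"
  define x where "x = vec n (\<lambda>i. if i < ?C then v $$ (i,?C) else 0)"
  have uN: "u \<in> N n" using VD(1)[OF v] by (auto simp: u_def unip_def)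
  have uV: "u \<in> V ?C"
    unfolding V_def using uN VD(2)[OF v] by (auto simp: u_def le_Suc_eq)
  have x: "x \<in> X ?C UNIV" by (auto simp: X_def x_def)
  have uc: "u \<in> carrier_mat n n" by (simp add: u_def)
  have vc: "v \<in> carrier_mat n n" using VD(1)[OF v] by (simp add: unip_def)
  have ux: "(u *\<^sub>v x) $ a = x $ a" if a: "a < n" for a
  proof -
    have "(u *\<^sub>v x) $ a = (\<Sum>k<n. if k = a then x $ k else 0)"
      unfolding index_mult_vec_sum[OF uc XD(1)[OF x] a]
    proof (rule sum.cong[OF refl])
      fix k assume "k \<in> {..<n}"
      then show "u $$ (a,k) * x $ k = (if k = a then x $ k else 0)"
        using VD(2)[OF v a, of k] a by (cases "k \<le> c") (auto simp: u_def x_def)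
    qed
    then show ?thesis using a by simp
  qed
  have "v = u * U ?C x"
  proof (rule eq_matI)
    fix a b assume "a < dim_row (u * U ?C x)" "b < dim_col (u * U ?C x)"
    then have ab: "a < n" "b < n" using uc by (auto simp: U_def rk1_def)
    show "v $$ (a,b) = (u * U ?C x) $$ (a,b)"
      using mult_U[OF uc ab XD(1)[OF x], of ?C] ux[OF ab(1)] ab by (auto simp: u_def x_def)
  qed (use vc uc in \<open>auto simp: U_def rk1_def\<close>)
  moreover from this have "psiN chi n v = psiN chi n u * chi (v $$ (c, ?C))"
    using psiN_mult[OF uN U_unip[OF x]] psiN_U[OF x c] c by (simp add: x_def)
  ultimately show thesis using that uV x by blast
qed

end

section \<open>Fourier coefficients along the columns, and the vanishing induction\<close>

context relative_character
begin

definition V_equivariant where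
  "V_equivariant c f \<longleftrightarrow> (\<forall>u\<in>V c. \<forall>g\<in>GL n. f (u * g) = psiN chi n u * (f g :: complex))"

definition P_invariant where
  "P_invariant c f \<longleftrightarrow> (\<forall>p\<in>P c K. \<forall>g\<in>GL n. f (p * g) = (f g :: complex))"

text \<open>Only maximal standard parabolics enter, one for each cut. The left factor
  \<open>g\<close> lets the property pass to \<open>coeff\<close>, which is a combination of left
  translates.\<close>

definition cuspidal_fun :: "('a mat \<Rightarrow> complex) \<Rightarrow> bool" where
  "cuspidal_fun f \<longleftrightarrow> (\<forall>c\<in>{1..<n}. \<forall>g\<in>GL n. \<forall>h\<in>GL n. (\<Sum>r\<in>unip_radical n {c}. f (g * r * h)) = 0)"

text \<open>For functions \<open>g -> L (rho g v)\<close> this is the vanishing of the Whittaker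
  projection of \<open>L\<close> at all translates of \<open>v\<close>.\<close>

definition N_null :: "('a mat \<Rightarrow> complex) \<Rightarrow> bool" where
  "N_null f \<longleftrightarrow> (\<forall>g\<in>GL n. (\<Sum>u\<in>N n. inverse (psiN chi n u) * f (u * g)) = 0)"

text \<open>The unnormalised Fourier coefficient, along column \<open>c\<close> acting on the left,
  at the character x -> chi(a.x).\<close>

definition coeff :: "nat \<Rightarrow> ('a mat \<Rightarrow> complex) \<Rightarrow> 'a vec \<Rightarrow> 'a mat \<Rightarrow> complex" where
  "coeff c f a g = (\<Sum>x\<in>X c UNIV. chi (- (a \<bullet> x)) * f (U c x * g))"

lemma N_group: "mat_group n (N n)"
  by (rule mat_group_unip[OF subring_UNIV])

lemma unip_radical_unip: "r \<in> unip_radical n {c} \<Longrightarrow> r \<in> N n"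
  unfolding unip_radical_def unip_def by fastforce

text \<open>Moving \<open>u\<close> past the column group keeps its character (\<open>P_V\<close>),
  and shifting the summation variable by \<open>y\<close> releases the factor chi(a.y).\<close>

lemma coeff_left:
  assumes c: "c < n" and f: "V_equivariant c f" and u: "u \<in> V c" and y: "y \<in> X c UNIV"
    and g: "g \<in> GL n" and a: "a \<in> carrier_vec n"
  shows "coeff c f a (u * (U c y * g)) = psiN chi n u * chi (a \<bullet> y) * coeff c f a g"
proof -
  have "coeff c f a (u * (U c y * g))
      = (\<Sum>x\<in>X c UNIV. psiN chi n u * chi (a \<bullet> y) * (chi (- (a \<bullet> (x + y))) * f (U c (x + y) * g)))"
    unfolding coeff_def
  proof (rule sum.cong[OF refl])
    fix x assume x: "x \<in> X c UNIV"
    obtain u' where u': "u' \<in> V c" "U c x * u = u' * U c x" "psiN chi n u' = psiN chi n u"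
      using P_V[OF U_P[OF x subring_UNIV] u] by blast
    note G = U_GL[OF x] U_GL[OF y] unip_GL[OF VD(1)[OF u]] unip_GL[OF VD(1)[OF u'(1)]]
    have "U c x * (u * (U c y * g)) = (U c x * u) * (U c y * g)"
      using G g by (simp add: GL_assoc)
    also have "\<dots> = u' * ((U c x * U c y) * g)"
      unfolding u'(2) using G g by (simp add: GL_assoc)
    finally have "f (U c x * (u * (U c y * g))) = psiN chi n u * f (U c (x + y) * g)"
      using f u' U_add[OF x y c] G(1,2) g GL_mult[OF GL_mult[OF G(1,2)] g] by (simp add: V_equivariant_def)
    moreover have "chi (- (a \<bullet> x)) = chi (a \<bullet> y) * chi (- (a \<bullet> (x + y)))"
      using chi_add[of "a \<bullet> y" "- (a \<bullet> (x + y))"] scalar_prod_add_distrib[OF a XD(1)[OF x] XD(1)[OF y]] by simp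
    ultimately show "chi (- (a \<bullet> x)) * f (U c x * (u * (U c y * g)))
        = psiN chi n u * chi (a \<bullet> y) * (chi (- (a \<bullet> (x + y))) * f (U c (x + y) * g))" by simp
  qed
  also have "\<dots> = (\<Sum>x\<in>X c UNIV. psiN chi n u * chi (a \<bullet> y) * (chi (- (a \<bullet> x)) * f (U c x * g)))"
    by (rule sum.reindex_bij_betw[OF X_shift[OF subring_UNIV y],
          of "\<lambda>x. psiN chi n u * chi (a \<bullet> y) * (chi (- (a \<bullet> x)) * f (U c x * g))"])
  finally show ?thesis by (simp add: coeff_def sum_distrib_left)
qed

text \<open>Conjugation by \<open>p\<close> substitutes \<open>p x\<close> for \<open>x\<close> in
  the column, so frequencies are moved by the adjoint of \<open>p\<close>.\<close>

lemma coeff_P: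
  assumes c: "c < n" and f: "P_invariant c f" and p: "p \<in> P c K" and g: "g \<in> GL n"
    and a: "\<And>x. x \<in> X c UNIV \<Longrightarrow> a' \<bullet> (p *\<^sub>v x) = a \<bullet> x"
  shows "coeff c f a' (p * g) = coeff c f a g"
proof -
  note p' = P_UNIV[OF p] and G = PD(1)[OF p]
  have "coeff c f a' (p * g) = (\<Sum>x\<in>X c UNIV. chi (- (a' \<bullet> (p *\<^sub>v x))) * f (U c (p *\<^sub>v x) * (p * g)))"
    unfolding coeff_def by (rule sum.reindex_bij_betw[OF P_X_bij[OF p'], symmetric])
  also have "\<dots> = coeff c f a g"
    unfolding coeff_def
  proof (rule sum.cong[OF refl])
    fix x assume x: "x \<in> X c UNIV"
    have px: "p *\<^sub>v x \<in> X c UNIV" using P_X_bij[OF p'] x by (auto simp: bij_betw_def)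
    have "U c (p *\<^sub>v x) * (p * g) = p * (U c x * g)"
      using P_U[OF p' x c] GL_assoc[OF U_GL[OF px] G g] GL_assoc[OF G U_GL[OF x] g] by simp
    then have "f (U c (p *\<^sub>v x) * (p * g)) = f (U c x * g)"
      using f p GL_mult[OF U_GL[OF x] g] by (simp add: P_invariant_def)
    then show "chi (- (a' \<bullet> (p *\<^sub>v x))) * f (U c (p *\<^sub>v x) * (p * g)) = chi (- (a \<bullet> x)) * f (U c x * g)"
      using a[OF x] by simp
  qed
  finally show ?thesis .
qed

text \<open>At frequency zero the coefficient is left invariant under the whole unipotent radical
  with cut at \<open>Suc c\<close>. It therefore equals its average over this radical, which is a
  combination of the sums that cuspidality annihilates.\<close>

lemma coeff_zero:
  assumes c: "Suc c < n" and f: "V_equivariant (Suc c) f" "cuspidal_fun f" and g: "g \<in> GL n"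
  shows "coeff (Suc c) f (0\<^sub>v n) g = 0"
proof -
  let ?C = "Suc c" and ?R = "unip_radical n {Suc c} :: 'a mat set"
  have "coeff ?C f (0\<^sub>v n) (r * g) = coeff ?C f (0\<^sub>v n) g" if r: "r \<in> ?R" for r
  proof -
    have rV: "r \<in> V c" using r unip_radical_unip[OF r] by (auto simp: V_def unip_radical_def)
    obtain u x where u: "u \<in> V ?C" "x \<in> X ?C UNIV" "r = u * U ?C x"
      "psiN chi n r = psiN chi n u * chi (r $$ (c, ?C))"
      by (rule V_decompose[OF rV c]) blast
    \<comment> \<open>The only superdiagonal position crossing the cut is \<open>(c, Suc c)\<close>,
      which belongs to the split-off column; hence the character is trivial on the remaining factor
      \<open>u\<close>.\<close>
    have "(\<Sum>i<n-1. r $$ (i,i+1)) = (\<Sum>i<n-1. if i = c then r $$ (i,i+1) else 0)"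
      using r by (intro sum.cong refl) (auto simp: unip_radical_def)
    moreover have "c < n - 1" using c by linarith
    ultimately have "psiN chi n r = chi (r $$ (c, ?C))" by (simp add: psiN_def)
    then have "psiN chi n u = 1" using u(4) by simp
    moreover have "r * g = u * (U ?C x * g)"
      using u(3) GL_assoc[OF unip_GL[OF VD(1)[OF u(1)]] U_GL[OF u(2)] g] by simp
    ultimately show ?thesis
      using coeff_left[OF c f(1) u(1,2) g, of "0\<^sub>v n"] XD(1)[OF u(2)] by (simp add: chi_0)
  qed
  then have "of_nat (card ?R) * coeff ?C f (0\<^sub>v n) g = (\<Sum>r\<in>?R. coeff ?C f (0\<^sub>v n) (r * g))" by simp
  also have "\<dots> = (\<Sum>x\<in>X ?C UNIV. \<Sum>r\<in>?R. f (U ?C x * r * g))"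
    unfolding coeff_def
  proof (subst sum.swap, intro sum.cong refl)
    fix x r assume x: "x \<in> X ?C UNIV" and r: "r \<in> ?R"
    show "chi (- (0\<^sub>v n \<bullet> x)) * f (U ?C x * (r * g)) = f (U ?C x * r * g)"
      using GL_assoc[OF U_GL[OF x] unip_GL[OF unip_radical_unip[OF r]] g] XD(1)[OF x] by (simp add: chi_0)
  qed
  also have "\<dots> = 0"
  proof (rule sum.neutral, rule ballI)
    fix x assume "x \<in> X ?C UNIV"
    then show "(\<Sum>r\<in>?R. f (U ?C x * r * g)) = 0" using f(2) c g by (simp add: cuspidal_fun_def)
  qed
  finally have "of_nat (card ?R) * coeff ?C f (0\<^sub>v n) g = 0" .
  moreover have "card ?R \<noteq> 0"
  proof -
    have "finite ?R" using finite_subset[OF _ mat_group_finite[OF N_group]] unip_radical_unip by blast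
    moreover have "1\<^sub>m n \<in> ?R" by (auto simp: unip_radical_def)
    ultimately show ?thesis by auto
  qed
  ultimately show ?thesis by simp
qed

text \<open>Since \<open>K\<close> is its own annihilator, summing the characters with frequencies
  in \<open>X c K\<close> detects \<open>X c K\<close> itself, and there the left translates of
  \<open>f\<close> equal \<open>f\<close>. One factor of the square comes from this orthogonality,
  the other from the number of remaining \<open>x\<close>.\<close>

lemma coeff_sum:
  assumes c: "c < n" and f: "P_invariant c f" and g: "g \<in> GL n"
  shows "(\<Sum>a\<in>X c K. coeff c f a g) = of_nat (card (X c K)) ^ 2 * f g"
proof -
  have orth: "(\<Sum>a\<in>X c K. chi (- (a \<bullet> x))) = (if x \<in> X c K then of_nat (card (X c K)) else 0)"
    if x: "x \<in> X c UNIV" for x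
  proof (cases "x \<in> X c K")
    case True
    have "chi (- (a \<bullet> x)) = 1" if a: "a \<in> X c K" for a
    proof -
      have "a \<bullet> x \<in> K"
        unfolding scalar_prod_def using XD(2)[OF a] XD(2)[OF True] XD(1)[OF True] K
        by (intro subring_sum[OF K]) (auto simp: subring_def)
      then show ?thesis using chi_minus(1)[of "a \<bullet> x"] chi_K by simp
    qed
    then show ?thesis using True by simp
  next
    case False
    then obtain i where i: "i < n" "x $ i \<notin> K" using x by (auto simp: X_def)
    then have ic: "i < c" using XD(3)[OF x, of i] K by (force simp: subring_def)
    obtain t where t: "t \<in> K" "chi (t * x $ i) \<noteq> 1" using K_dual i by blast
    define b where "b = t \<cdot>\<^sub>v unit_vec n i"
    have b: "b \<in> X c K" using t(1) ic K by (auto simp: b_def X_def unit_vec_def subring_def)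
    have bx: "b \<bullet> x = t * x $ i" using i XD(1)[OF x] by (simp add: b_def)
    have "(\<Sum>a\<in>X c K. chi (- (a \<bullet> x))) = 0"
    proof (rule sum_character_zero[OF X_shift[OF K b]])
      fix a assume a: "a \<in> X c K"
      show "chi (- ((a + b) \<bullet> x)) = chi (- (b \<bullet> x)) * chi (- (a \<bullet> x))"
        using chi_add[of "- (b \<bullet> x)" "- (a \<bullet> x)"] add_scalar_prod_distrib[OF XD(1)[OF a] XD(1)[OF b] XD(1)[OF x]]
        by (simp add: algebra_simps)
    next
      show "chi (- (b \<bullet> x)) \<noteq> 1" using chi_minus(1)[of "b \<bullet> x"] t(2) bx by auto
    qed
    then show ?thesis using False by simp
  qed
  have "(\<Sum>a\<in>X c K. coeff c f a g) = (\<Sum>x\<in>X c UNIV. (\<Sum>a\<in>X c K. chi (- (a \<bullet> x))) * f (U c x * g))"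
    unfolding coeff_def sum_distrib_right by (rule sum.swap)
  also have "\<dots> = (\<Sum>x\<in>X c UNIV. if x \<in> X c K then of_nat (card (X c K)) * f g else 0)"
  proof (rule sum.cong[OF refl])
    fix x assume x: "x \<in> X c UNIV"
    have "f (U c x * g) = f g" if "x \<in> X c K"
      using f U_P[OF that K] g by (simp add: P_invariant_def)
    then show "(\<Sum>a\<in>X c K. chi (- (a \<bullet> x))) * f (U c x * g)
        = (if x \<in> X c K then of_nat (card (X c K)) * f g else 0)" using orth[OF x] by simp
  qed
  also have "\<dots> = (\<Sum>x\<in>X c K. of_nat (card (X c K)) * f g)"
    using X_K finite_X by (intro sum.mono_neutral_cong_right) auto
  finally show ?thesis by (simp add: power2_eq_square)
qed

text \<open>Induction on \<open>c\<close>: the conditions at \<open>Suc c\<close> for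
  \<open>f\<close> yield those at \<open>c\<close> for one well-chosen coefficient of
  \<open>f\<close>, whose vanishing forces that of all others and then of \<open>f\<close>. At
  \<open>c = 0\<close> the function is equivariant under all of \<open>N n\<close>, so the sum in
  \<open>N_null\<close> is |N| times \<open>f g\<close>.\<close>

theorem invariant_cuspidal_zero:
  assumes "c < n" "V_equivariant c f" "P_invariant c f" "cuspidal_fun f" "N_null f" "g \<in> GL n"
  shows "f g = 0"
  using assms
proof (induction c arbitrary: f g)
  case (0 f g)
  have "V 0 = N n" by (auto simp: V_def)
  then have "0 = (\<Sum>u\<in>N n. f g)"
    using 0 by (auto simp: V_equivariant_def N_null_def mult.assoc[symmetric])
  moreover have "card (N n) \<noteq> 0"
    using mat_group_finite[OF N_group] mat_groupD(2)[OF N_group] by auto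
  ultimately show ?case by simp
next
  case (Suc c f g)
  let ?C = "Suc c" and ?e = "unit_vec n c :: 'a vec"
  note f = Suc.prems(2-5) and C = Suc.prems(1)
  have c: "c < n" using C by simp
  have e: "?e \<bullet> x = x $ c" if "x \<in> carrier_vec n" for x using that c by simp
  \<comment> \<open>At this frequency the character of the column group \<open>U (Suc c)\<close> is
    the restriction of \<open>psiN\<close>, so the coefficient gains equivariance under the larger
    group \<open>V c\<close>; and \<open>P c K\<close> preserves it because row \<open>c\<close> of
    its elements is a unit row.\<close>
  let ?h = "coeff ?C f ?e"
  have "?h g = 0" if g: "g \<in> GL n" for g
  proof (rule Suc.IH[OF c _ _ _ _ g])
    show "V_equivariant c ?h"
      unfolding V_equivariant_def
    proof (intro ballI)
      fix v g :: "'a mat" assume v: "v \<in> V c" and g: "g \<in> GL n"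
      obtain u x where u: "u \<in> V ?C" "x \<in> X ?C UNIV" "v = u * U ?C x"
        "psiN chi n v = psiN chi n u * chi (v $$ (c, ?C))"
        by (rule V_decompose[OF v C]) blast
      have "psiN chi n v = psiN chi n u * chi (x $ c)"
        using psiN_mult[OF VD(1)[OF u(1)] U_unip[OF u(2)]] psiN_U[OF u(2) C] u(3) by simp
      moreover have "v * g = u * (U ?C x * g)"
        using u(3) GL_assoc[OF unip_GL[OF VD(1)[OF u(1)]] U_GL[OF u(2)] g] by simp
      ultimately show "?h (v * g) = psiN chi n v * ?h g"
        using coeff_left[OF C f(1) u(1,2) g, of ?e] e[OF XD(1)[OF u(2)]] by simp
    qed
    show "P_invariant c ?h"
      unfolding P_invariant_def
    proof (intro ballI)
      fix p g :: "'a mat" assume p: "p \<in> P c K" and g: "g \<in> GL n"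
      show "?h (p * g) = ?h g"
      proof (rule coeff_P[OF C f(2) P_mono[OF p] g])
        fix x assume x: "x \<in> X ?C UNIV"
        show "?e \<bullet> (p *\<^sub>v x) = ?e \<bullet> x"
          using e[OF XD(1)[OF x]] e[OF mult_mat_vec_carrier[OF GL_carrier[OF PD(1)[OF p]] XD(1)[OF x]]]
            P_vec[OF P_UNIV[OF p] XD(1)[OF x], of c] c by simp
      qed
    qed
    show "cuspidal_fun ?h"
      unfolding cuspidal_fun_def
    proof (intro ballI)
      fix k :: nat and g h :: "'a mat" assume k: "k \<in> {1..<n}" and g: "g \<in> GL n" and h: "h \<in> GL n"
      have "(\<Sum>r\<in>unip_radical n {k}. ?h (g * r * h))
          = (\<Sum>x\<in>X ?C UNIV. chi (- (?e \<bullet> x)) * (\<Sum>r\<in>unip_radical n {k}. f ((U ?C x * g) * r * h)))"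
        unfolding coeff_def sum_distrib_left
      proof (subst sum.swap, intro sum.cong refl)
        fix x and r :: "'a mat" assume x: "x \<in> X ?C UNIV" and r: "r \<in> unip_radical n {k}"
        have "U ?C x * (g * r * h) = (U ?C x * g) * r * h"
          using U_GL[OF x] unip_GL[OF unip_radical_unip[OF r]] g h by (simp add: GL_assoc)
        then show "chi (- (?e \<bullet> x)) * f (U ?C x * (g * r * h)) = chi (- (?e \<bullet> x)) * f ((U ?C x * g) * r * h)"
          by simp
      qed
      also have "\<dots> = 0"
        using f(3) k g h by (intro sum.neutral ballI) (simp add: cuspidal_fun_def)
      finally show "(\<Sum>r\<in>unip_radical n {k}. ?h (g * r * h)) = 0" .
    qed
    show "N_null ?h"
      unfolding N_null_def
    proof (intro ballI)
      fix g :: "'a mat" assume g: "g \<in> GL n"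
      have "(\<Sum>u\<in>N n. inverse (psiN chi n u) * ?h (u * g))
          = (\<Sum>x\<in>X ?C UNIV. \<Sum>u\<in>N n. chi (- (?e \<bullet> x)) * (inverse (psiN chi n u) * f (U ?C x * (u * g))))"
        unfolding coeff_def sum_distrib_left
        by (subst sum.swap) (simp add: mult.left_commute)
      also have "\<dots> = 0"
      proof (rule sum.neutral, rule ballI)
        fix x assume x: "x \<in> X ?C UNIV"
        \<comment> \<open>The factor \<open>U ?C x\<close> is absorbed into the summation over
          \<open>N n\<close>, at the price of its character value.\<close>
        let ?F = "\<lambda>u. chi (- (?e \<bullet> x)) * psiN chi n (U ?C x) * (inverse (psiN chi n u) * f (u * g))"
        have "(\<Sum>u\<in>N n. chi (- (?e \<bullet> x)) * (inverse (psiN chi n u) * f (U ?C x * (u * g))))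
            = (\<Sum>u\<in>N n. ?F (U ?C x * u))"
          using GL_assoc[OF U_GL[OF x] unip_GL g] psiN_mult[OF U_unip[OF x]]
          by (intro sum.cong refl) (simp add: mult.assoc)
        also have "\<dots> = (\<Sum>u\<in>N n. ?F u)" by (rule mat_group_sum(2)[OF N_group U_unip[OF x], of ?F])
        also have "\<dots> = 0"
          using f(4) g by (simp add: N_null_def sum_distrib_left[symmetric])
        finally show "(\<Sum>u\<in>N n. chi (- (?e \<bullet> x)) * (inverse (psiN chi n u) * f (U ?C x * (u * g)))) = 0" .
      qed
      finally show "(\<Sum>u\<in>N n. inverse (psiN chi n u) * ?h (u * g)) = 0" .
    qed
  qed
  then have e0: "?h g = 0" if "g \<in> GL n" for g using that by blast
  have "coeff ?C f a g = 0" if a: "a \<in> X ?C K" and g: "g \<in> GL n" for a g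
  proof (cases "a = 0\<^sub>v n")
    case True
    then show ?thesis using coeff_zero[OF C f(1,3) g] by simp
  next
    case False
    have K01: "0 \<in> K" "1 \<in> K" using K by (auto simp: subring_def)
    \<comment> \<open>An element of \<open>P (Suc c) K\<close> with row \<open>c\<close> equal to
      \<open>a\<close> pulls the unit frequency back to \<open>a\<close>.\<close>
    obtain p where p: "p \<in> GL_sub n K" "\<forall>k<n. p $$ (c,k) = a $ k"
      "\<forall>i k. c < i \<and> i < n \<and> k < n \<longrightarrow> p $$ (i,k) = (if k = i then 1 else 0)"
      using row_completion[OF K01 c XD(1)[OF a] False] XD(2,3)[OF a] by auto
    have pP: "p \<in> P ?C K" using p by (auto simp: P_def)
    have "coeff ?C f ?e (p * g) = coeff ?C f a g"
    proof (rule coeff_P[OF C f(2) pP g])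
      fix x assume x: "x \<in> X ?C UNIV"
      have "(p *\<^sub>v x) $ c = a \<bullet> x"
        using index_mult_vec_sum[OF GL_carrier[OF PD(1)[OF pP]] XD(1)[OF x] c] p(2) XD(1)[OF x]
        by (simp add: scalar_prod_def lessThan_atLeast0)
      then show "?e \<bullet> (p *\<^sub>v x) = a \<bullet> x"
        using e[OF mult_mat_vec_carrier[OF GL_carrier[OF PD(1)[OF pP]] XD(1)[OF x]]] by simp
    qed
    then show ?thesis using e0[OF GL_mult[OF PD(1)[OF pP] g]] by simp
  qed
  then have "of_nat (card (X ?C K)) ^ 2 * f g = 0"
    using coeff_sum[OF C f(2) Suc.prems(6)] Suc.prems(6) by simp
  moreover have "card (X ?C K) \<noteq> 0"
  proof -
    have "0\<^sub>v n \<in> X ?C K" using K by (auto simp: X_def subring_def)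
    then show ?thesis using finite_X by auto
  qed
  ultimately show ?case by simp
qed

end

section \<open>The quadratic extension\<close>

lemma finite_field_prime_char: "prime CHAR('a::{finite,field})"
  by (rule prime_CHAR_semidom) (simp add: finite_imp_CHAR_pos)

text \<open>A subgroup S of order p^m with x outside S extends to the subgroup S + F_p x of order p^(m+1).\<close>

lemma finite_field_card_power:
  "\<exists>m. card (UNIV :: 'a::{finite,field} set) = CHAR('a) ^ m"
proof -
  let ?p = "CHAR('a)"
  have p: "prime ?p" by (rule finite_field_prime_char)
  define Q where "Q = (\<lambda>m. \<exists>S :: 'a set. 0 \<in> S \<and> (\<forall>x\<in>S. \<forall>y\<in>S. x + y \<in> S) \<and> card S = ?p ^ m)"
  have Q0: "Q 0" unfolding Q_def by (intro exI[of _ "{0}"]) auto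
  have bound: "m \<le> card (UNIV :: 'a set)" if "Q m" for m
  proof -
    from that obtain S :: "'a set" where "card S = ?p ^ m" unfolding Q_def by blast
    then have "?p ^ m \<le> card (UNIV :: 'a set)" using card_mono[of UNIV S] by simp
    moreover have "m < ?p ^ m" using power_gt_expt[of ?p m] prime_gt_Suc_0_nat[OF p] by simp
    ultimately show ?thesis by simp
  qed
  define m where "m = (GREATEST m. Q m)"
  have Qm: "Q m" and max: "\<And>k. Q k \<Longrightarrow> k \<le> m"
    unfolding m_def using GreatestI_nat[of Q, OF Q0 ] Greatest_le_nat[of Q] bound by blast+
  obtain S :: "'a set" where S: "0 \<in> S" "\<And>x y. x \<in> S \<Longrightarrow> y \<in> S \<Longrightarrow> x + y \<in> S" "card S = ?p ^ m"
    using Qm unfolding Q_def by blast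
  have mult: "of_nat k * x \<in> S" if "x \<in> S" for k x
    by (induction k) (use S that in \<open>auto simp: distrib_right\<close>)
  have "S = UNIV"
  proof (rule ccontr)
    assume "S \<noteq> UNIV"
    then obtain x where x: "x \<notin> S" by blast
    define h where "h = (\<lambda>(s, k). s + of_nat k * x)"
    have no: False if s: "s \<in> S" "s' \<in> S" and k: "k < k'" "k' < ?p" and eq: "s + of_nat k * x = s' + of_nat k' * x"
      for s s' k k'
    proof -
      define j where "j = k' - k"
      have j: "0 < j" "j < ?p" "k' = k + j" using k by (auto simp: j_def)
      have "of_nat j * x = s - s'" using eq j(3) by (simp add: algebra_simps)
      \<comment> \<open>\<open>S\<close> is only known to be closed under addition, so subtraction
        is replaced by adding p - 1 copies.\<close>
      also have "\<dots> = s + of_nat (?p - 1) * s'"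
      proof -
        have "of_nat (?p - 1) * s' + s' = of_nat (?p - 1 + 1) * s'" by (simp add: algebra_simps)
        also have "?p - 1 + 1 = ?p" using prime_gt_0_nat[OF p] by simp
        also have "of_nat ?p * s' = 0" by simp
        finally show ?thesis by (simp add: algebra_simps eq_neg_iff_add_eq_0)
      qed
      finally have jx: "of_nat j * x \<in> S" using S(2)[OF s(1) mult[OF s(2)]] by simp
      have "coprime j ?p"
        using j p by (metis coprime_commute dvd_imp_le not_le prime_imp_coprime)
      then obtain i where "[j * i = Suc 0] (mod ?p)" using cong_solve_coprime_nat by blast
      then have "of_nat (j * i) = (of_nat (Suc 0) :: 'a)" by (simp only: of_nat_eq_iff_cong_CHAR)
      moreover have "of_nat i * (of_nat j * x) = of_nat (j * i) * x" by (simp add: algebra_simps)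
      ultimately have "of_nat i * (of_nat j * x) = x" by simp
      then show False using mult[OF jx, of i] x by metis
    qed
    have inj: "inj_on h (S \<times> {..<?p})"
    proof (rule inj_onI, clarify)
      fix s s' k k' assume a: "s \<in> S" "s' \<in> S" "k < ?p" "k' < ?p" "h (s, k) = h (s', k')"
      have "\<not> k < k'" "\<not> k' < k"
        using no[of s s' k k'] no[of s' s k' k] a by (auto simp: h_def)
      then have "k = k'" by simp
      then show "s = s' \<and> k = k'" using a by (simp add: h_def)
    qed
    define T where "T = h ` (S \<times> {..<?p})"
    have "card T = ?p ^ Suc m"
      unfolding T_def
      using card_image[OF inj] S(3) by (simp add: card_cartesian_product)
    moreover have "0 \<in> T"
      unfolding T_def using S(1) prime_gt_0_nat[OF p] by (intro image_eqI[of _ _ "(0, 0)"]) (auto simp: h_def)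
    moreover have "a + b \<in> T" if "a \<in> T" "b \<in> T" for a b
    proof -
      obtain s k where a: "s \<in> S" "a = s + of_nat k * x"
        using \<open>a \<in> T\<close> unfolding T_def h_def by auto
      obtain s' k' where b: "s' \<in> S" "b = s' + of_nat k' * x"
        using \<open>b \<in> T\<close> unfolding T_def h_def by auto
      have "of_nat ((k + k') mod ?p) = (of_nat (k + k') :: 'a)"
        unfolding of_nat_eq_iff_cong_CHAR by (simp add: cong_def)
      then have "h (s + s', (k + k') mod ?p) = s + s' + (of_nat k + of_nat k') * x"
        unfolding h_def by simp
      also have "\<dots> = a + b" using a b by (simp add: algebra_simps)
      finally have "a + b = h (s + s', (k + k') mod ?p)" by simp
      moreover have "(s + s', (k + k') mod ?p) \<in> S \<times> {..<?p}"
        using S(2)[OF a(1) b(1)] prime_gt_0_nat[OF p] by simp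
      ultimately show ?thesis unfolding T_def by (rule image_eqI)
    qed
    ultimately have "Q (Suc m)" unfolding Q_def by (intro exI[of _ T]) simp
    then show False using max[of "Suc m"] by simp
  qed
  then show ?thesis using S(3) by blast
qed

lemma finite_field_power_card:
  fixes x :: "'a::{finite,field}"
  shows "x ^ card (UNIV :: 'a set) = x"
proof (cases "x = 0")
  case True
  have "card (UNIV :: 'a set) \<noteq> 0" by simp
  then show ?thesis using True by (simp add: power_0_left)
next
  case False
  let ?S = "UNIV - {0 :: 'a}"
  have bij: "bij_betw (\<lambda>y. x * y) ?S ?S"
    using False by (intro bij_betwI[where g = "\<lambda>y. y / x"]) auto
  have "\<Prod>?S = (\<Prod>y\<in>?S. x * y)" by (rule prod.reindex_bij_betw[OF bij, symmetric])
  also have "\<dots> = x ^ card ?S * \<Prod>?S" unfolding prod.distrib prod_constant ..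
  finally have "\<Prod>?S = x ^ card ?S * \<Prod>?S" .
  moreover have "\<Prod>?S \<noteq> 0" by (subst prod_zero_iff) auto
  ultimately have "x ^ card ?S = 1" by (metis mult_cancel_right1)
  moreover have "card (UNIV :: 'a set) = Suc (card ?S)"
    by (rule card_Suc_Diff1[symmetric]) auto
  ultimately show ?thesis by (simp only: power_Suc mult_1_right)
qed

locale quadratic_extension =
  fixes q :: nat and psi :: "'e::{finite,field} \<Rightarrow> complex" and z :: 'e
  assumes card_E: "card (UNIV :: 'e set) = q ^ 2"
    and psi_nonzero: "\<forall>x\<in>Fsub q. psi x \<noteq> 0"
    and psi_add: "\<forall>x\<in>Fsub q. \<forall>y\<in>Fsub q. psi (x + y) = psi x * psi y"
    and psi_nontriv: "\<exists>x\<in>Fsub q. psi x \<noteq> 1"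
    and z_notin_F: "z \<notin> Fsub q"
begin

abbreviation F :: "'e set" where "F \<equiv> Fsub q"

lemma power_q_q: "((x :: 'e) ^ q) ^ q = x"
  using finite_field_power_card[of x] by (simp add: card_E power_mult[symmetric] power2_eq_square)

lemma q_pos: "q > 0"
  using card_E by (cases q) auto

text \<open>The order q^2 of the field is a power of the characteristic, hence so is its divisor q,
  and \<open>x ^ q\<close> is an iterate of the additive p-th power map.\<close>

lemma frob_add: "(x + y :: 'e) ^ q = x ^ q + y ^ q"
proof -
  obtain m where "q ^ 2 = CHAR('e) ^ m" using finite_field_card_power[where 'a = 'e] card_E by auto
  then have "q dvd CHAR('e) ^ m" by (metis dvd_power zero_less_numeral)
  then obtain k where "q = CHAR('e) ^ k" using divides_primepow_nat[OF finite_field_prime_char] by blast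
  then show ?thesis by (rule freshmans_dream'[OF finite_field_prime_char])
qed

lemma frob_diff: "(x - y :: 'e) ^ q = x ^ q - y ^ q"
  using frob_add[of "x - y" y] by (simp add: algebra_simps)

lemma F_subring: "subring F"
  using q_pos by (auto simp: subring_def Fsub_def frob_add power_mult_distrib)

lemma F_divide: "x \<in> F \<Longrightarrow> y \<in> F \<Longrightarrow> x / y \<in> F"
  by (simp add: Fsub_def power_divide)

lemma F_minus: "x \<in> F \<Longrightarrow> - x \<in> F"
  using frob_diff[of 0 x] q_pos by (simp add: Fsub_def)

lemma z_diff: "z - z ^ q \<noteq> 0"
  using z_notin_F by (auto simp: Fsub_def)

text \<open>The Frobenius has order two on E, so it negates numerator and denominator alike.\<close>

lemma quotient_F: "(x - x ^ q) / (z - z ^ q) \<in> F"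
proof -
  have "((x - x ^ q) / (z - z ^ q)) ^ q = (x ^ q - x) / (z ^ q - z)"
    by (simp add: power_divide frob_diff power_q_q)
  also have "\<dots> = (x - x ^ q) / (z - z ^ q)"
    using minus_divide_divide[of "x - x ^ q" "z - z ^ q"] by simp
  finally show ?thesis by (simp add: Fsub_def)
qed

lemma psi_0: "psi 0 = 1"
proof -
  have "0 \<in> F" using F_subring by (simp add: subring_def)
  then have "psi 0 * psi 0 = psi 0 * 1" "psi 0 \<noteq> 0" using psi_add psi_nonzero by (metis add_0 mult.right_neutral, blast)
  then show ?thesis by simp
qed

lemma psiE_mult_F: "t \<in> F \<Longrightarrow> psiE q z psi (t * x) = psi (t * ((x - x ^ q) / (z - z ^ q)))"
  by (simp add: psiE_def frob_def Fsub_def power_mult_distrib right_diff_distrib)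

sublocale relative_character "psiE q z psi" F n for n
proof
  show "psiE q z psi (x + y) = psiE q z psi x * psiE q z psi y" for x y
  proof -
    have "(x + y - (x + y) ^ q) / (z - z ^ q) = (x - x ^ q) / (z - z ^ q) + (y - y ^ q) / (z - z ^ q)"
      by (simp add: frob_add add_divide_distrib[symmetric])
    then show ?thesis using psi_add quotient_F by (simp add: psiE_def frob_def)
  qed
  show "psiE q z psi 0 = 1" using psi_0 q_pos by (simp add: psiE_def frob_def power_0_left)
  show "\<exists>x. psiE q z psi x \<noteq> 1"
  proof -
    obtain t where t: "t \<in> F" "psi t \<noteq> 1" using psi_nontriv by blast
    then show ?thesis using psiE_mult_F[OF t(1), of z] z_diff by (intro exI[of _ "t * z"]) simp
  qed
  show "subring F" by (rule F_subring)
  show "psiE q z psi x = 1" if "x \<in> F" for x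
    using that psi_0 by (simp add: psiE_def frob_def Fsub_def)
  show "a \<in> F" if a: "\<And>t. t \<in> F \<Longrightarrow> psiE q z psi (t * a) = 1" for a
  proof (rule ccontr)
    assume "a \<notin> F"
    \<comment> \<open>F-linearity of the map a -> b makes psi_E at (t / b) a equal to psi(t), so
      \<open>a\<close> outside F is detected by a \<open>t\<close> with psi(t) not 1.\<close>
    define b where "b = (a - a ^ q) / (z - z ^ q)"
    have b: "b \<noteq> 0" "b \<in> F" using \<open>a \<notin> F\<close> z_diff quotient_F by (auto simp: b_def Fsub_def)
    obtain t where t: "t \<in> F" "psi t \<noteq> 1" using psi_nontriv by blast
    have "psiE q z psi ((t / b) * a) = psi t"
      using psiE_mult_F[OF F_divide[OF t(1) b(2)], of a] b by (simp add: b_def[symmetric])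
    then show False using a[OF F_divide[OF t(1) b(2)]] t by simp
  qed
qed

end

section \<open>Zeta sums and functionals invariant under the rational mirabolic subgroup\<close>

lemma omega_omega: "omega n * omega n = 1\<^sub>m n"
proof (rule eq_matI)
  have c: "omega n \<in> carrier_mat n n" by (simp add: omega_def)
  fix i j assume "i < dim_row (1\<^sub>m n)" "j < dim_col (1\<^sub>m n)"
  then have ij: "i < n" "j < n" by auto
  have "(omega n * omega n) $$ (i,j) = omega n $$ (n - 1 - i, j)"
    by (rule unit_row_mult[OF c c ij]) (use ij in \<open>auto simp: omega_def\<close>)
  also have "\<dots> = 1\<^sub>m n $$ (i,j)" using ij by (auto simp: omega_def)
  finally show "(omega n * omega n) $$ (i,j) = 1\<^sub>m n $$ (i,j)" .
qed (auto simp: omega_def)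

lemma omega_GL [simp]: "omega n \<in> GL n"
  unfolding GL_iff using omega_omega[of n] by (intro conjI bexI[of _ "omega n"]) (auto simp: omega_def)

lemma antitr_omega:
  assumes A: "A \<in> carrier_mat n n"
  shows "antitr n A * omega n = omega n * transpose_mat A"
proof (rule eq_matI)
  note c = GL_carrier[OF omega_GL[of n]] and t = transpose_carrier_mat[THEN iffD2, OF A]
  fix i j assume "i < dim_row (omega n * transpose_mat A)" "j < dim_col (omega n * transpose_mat A)"
  then have ij: "i < n" "j < n" using A by (auto simp: omega_def)
  have "(antitr n A * omega n) $$ (i,j) = antitr n A $$ (i, n - 1 - j)"
    by (rule unit_col_mult[OF antitr_carrier c ij]) (use ij in \<open>auto simp: omega_def\<close>)
  also have "\<dots> = transpose_mat A $$ (n - 1 - i, j)" using ij A by simp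
  also have "\<dots> = (omega n * transpose_mat A) $$ (i,j)"
    by (rule unit_row_mult[OF c t ij, symmetric]) (use ij in \<open>auto simp: omega_def\<close>)
  finally show "(antitr n A * omega n) $$ (i,j) = (omega n * transpose_mat A) $$ (i,j)" .
qed (use A in \<open>auto simp: omega_def antitr_def\<close>)

lemma last_row_index:
  assumes "g \<in> carrier_mat n n" "j < n"
  shows "last_row_times n g $ j = g $$ (n - 1, j)"
  using assms by (simp add: last_row_times_def)

lemma last_row_unip_mult:
  fixes g :: "'a::field mat"
  assumes u: "u \<in> unip n R" and g: "g \<in> carrier_mat n n"
  shows "last_row_times n (u * g) = last_row_times n g"
proof (rule eq_vecI)
  note uc = GL_carrier[OF unip_GL[OF u]]
  fix j assume "j < dim_vec (last_row_times n g)"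
  then have j: "j < n" using g by (simp add: last_row_times_def)
  have "(u * g) $$ (n - 1, j) = g $$ (n - 1, j)"
    by (rule unit_row_mult[OF uc g]) (use u j in \<open>auto simp: unip_def\<close>)
  then show "last_row_times n (u * g) $ j = last_row_times n g $ j"
    using last_row_index[OF mult_carrier_mat[OF uc g] j] last_row_index[OF g j] by simp
qed (use g in \<open>simp add: last_row_times_def\<close>)

text \<open>The summand is constant on the cosets, so the representatives chosen in \<^const>\<open>zeta\<close> do not matter.\<close>

lemma zeta_sum:
  fixes K :: "'a::{finite,field} set"
  assumes K: "subring K"
    and W: "\<And>u g. u \<in> unip n K \<Longrightarrow> g \<in> GL_sub n K \<Longrightarrow> W (u * g) = W g"
  shows "of_nat (card (unip n K)) * zeta n K W phi = (\<Sum>g\<in>GL_sub n K. W g * phi (last_row_times n g))"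
proof -
  let ?H = "GL_sub n K" and ?N = "unip n K"
  define h where "h = (\<lambda>g. W g * phi (last_row_times n g))"
  define coset where "coset = (\<lambda>g :: 'a mat. (\<lambda>u. u * g) ` ?N)"
  note HG = mat_group_GL_sub[OF K, of n] and NG = mat_group_unip[OF K, of n]
  have NH: "u \<in> ?H" if "u \<in> ?N" for u
    using that unip_GL[OF that] by (simp add: GL_sub_def unip_def)
  have h: "h (u * g) = h g" if "u \<in> ?N" "g \<in> ?H" for u g
    using W[OF that] last_row_unip_mult[OF that(1) GL_carrier[OF mat_groupD(1)[OF HG that(2)]]] by (simp add: h_def)
  have self: "g \<in> coset g" if "g \<in> ?H" for g
    unfolding coset_def using mat_groupD(2)[OF NG] GL_carrier[OF mat_groupD(1)[OF HG that]]
    by (intro image_eqI[of _ _ "1\<^sub>m n"]) auto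
  have coset_eq: "coset (u * g) = coset g" if u: "u \<in> ?N" and g: "g \<in> ?H" for u g
  proof -
    have "coset (u * g) = (\<lambda>w. w * g) ` ((\<lambda>w. w * u) ` ?N)"
      unfolding coset_def image_image
      using GL_assoc[OF unip_GL unip_GL[OF u] mat_groupD(1)[OF HG g]] by (intro image_cong) auto
    also have "(\<lambda>w. w * u) ` ?N = ?N" using mat_group_bij(1)[OF NG u] by (simp add: bij_betw_def)
    finally show ?thesis by (simp add: coset_def)
  qed
  have fibre: "{g \<in> ?H. coset g = C} = C" if C: "C \<in> coset ` ?H" for C
  proof -
    obtain g0 where g0: "g0 \<in> ?H" "C = coset g0" using C by blast
    have "g \<in> ?H \<and> coset g = C" if gC: "g \<in> C" for g
    proof -
      obtain u where "u \<in> ?N" "g = u * g0" using gC unfolding g0(2) coset_def by blast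
      then show ?thesis using coset_eq g0 mat_groupD(3)[OF HG NH] by auto
    qed
    then show ?thesis using self by auto
  qed
  have coset_sum: "sum h C = of_nat (card ?N) * h (SOME g. g \<in> C)" if C: "C \<in> coset ` ?H" for C
  proof -
    obtain g0 where g0: "g0 \<in> ?H" "C = coset g0" using C by blast
    have const: "h g = h g0" if "g \<in> C" for g using that g0 h by (auto simp: coset_def)
    have some: "(SOME g. g \<in> C) \<in> C" using self[OF g0(1)] g0(2) by (intro someI_ex[of "\<lambda>g. g \<in> C"]) auto
    have "inj_on (\<lambda>u. u * g0) ?N"
      by (rule inj_on_inverseI[where g = "\<lambda>w. w * mat_inv n g0"])
         (rule mat_inv_cancel_right(1)[OF mat_groupD(1)[OF HG g0(1)] GL_carrier[OF unip_GL]])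
    then have "card C = card ?N" unfolding g0(2) coset_def by (rule card_image)
    moreover have "sum h C = (\<Sum>g\<in>C. h g0)" using const by (rule sum.cong[OF refl])
    ultimately show ?thesis using const[OF some] by simp
  qed
  have "sum h ?H = (\<Sum>C\<in>coset ` ?H. sum h {g \<in> ?H. coset g = C})"
    by (rule sum.image_gen[OF mat_group_finite[OF HG]])
  also have "\<dots> = (\<Sum>C\<in>coset ` ?H. of_nat (card ?N) * h (SOME g. g \<in> C))"
    using fibre coset_sum by simp
  also have "\<dots> = of_nat (card ?N) * zeta n K W phi"
    by (simp add: zeta_def Ncosets_def coset_def h_def Let_def sum_distrib_left)
  finally show ?thesis by (simp add: h_def)
qed

lemma transpose_mat_inv:
  assumes "g \<in> GL n" shows "transpose_mat (mat_inv n (transpose_mat g)) = mat_inv n g"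
proof -
  note i = mat_inv[OF assms] GL_carrier[OF assms]
  have "mat_inv n (transpose_mat g) = transpose_mat (mat_inv n g)"
  proof (rule mat_inv_unique[OF GL_transpose[OF assms]])
    show "transpose_mat g * transpose_mat (mat_inv n g) = 1\<^sub>m n"
      using transpose_mult[OF i(1,4)] unfolding i(3) by simp
  qed (use i(1) in simp)
  then show ?thesis by simp
qed

lemma mat_group_unip_radical: "mat_group n (unip_radical n {c} :: 'a::field mat set)"
proof -
  let ?R = "unip_radical n {c} :: 'a mat set"
  have "r * s \<in> ?R" if r: "r \<in> ?R" and s: "s \<in> ?R" for r s
  proof -
    have rc: "r \<in> carrier_mat n n" "s \<in> carrier_mat n n" using r s by (auto simp: unip_radical_def)
    have "(r * s) $$ (i,j) = (if i = j then 1 else 0)" if ij: "i < n" "j < n" "i = j \<or> \<not> (i < c \<and> c \<le> j)" for i j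
    proof -
      have "r $$ (i,k) * s $$ (k,j) = (if k = i then s $$ (i,j) else 0)" if k: "k < n" for k
      proof -
        have "r $$ (i,k) = 0" if "k \<noteq> i" "\<not> (i < c \<and> c \<le> k)" using r ij k that by (auto simp: unip_radical_def)
        moreover have "s $$ (k,j) = 0" if "k \<noteq> j" "\<not> (k < c \<and> c \<le> j)" using s ij k that by (auto simp: unip_radical_def)
        moreover have "r $$ (i,i) = 1" using r ij by (auto simp: unip_radical_def)
        ultimately show ?thesis using ij(3) by (cases "k = i"; cases "k = j"; force)
      qed
      then have "(r * s) $$ (i,j) = (\<Sum>k<n. if k = i then s $$ (i,j) else 0)"
        unfolding index_mult_sum[OF rc ij(1,2)] by (intro sum.cong) auto
      also have "\<dots> = (if i = j then 1 else 0)" using s ij by (auto simp: unip_radical_def)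
      finally show ?thesis .
    qed
    then show ?thesis using rc by (auto simp: unip_radical_def)
  qed
  moreover have "r \<in> unip n UNIV" if "r \<in> ?R" for r
    using that unfolding unip_radical_def unip_def by fastforce
  then have "?R \<subseteq> GL n" using unip_GL by blast
  ultimately show ?thesis by (auto simp: mat_group_def unip_radical_def)
qed

section \<open>Functionals invariant under the rational mirabolic group\<close>

context relative_character
begin

definition row :: "'a vec \<Rightarrow> 'a mat \<Rightarrow> 'a vec" where
  "row x g = transpose_mat g *\<^sub>v x"

lemma row_carrier: "g \<in> GL n \<Longrightarrow> x \<in> carrier_vec n \<Longrightarrow> row x g \<in> carrier_vec n"
  unfolding row_def by (rule mult_mat_vec_carrier[OF GL_carrier[OF GL_transpose]])

lemma row_mult:
  assumes "g \<in> GL n" "h \<in> GL n" "x \<in> carrier_vec n"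
  shows "row x (g * h) = row (row x g) h"
  unfolding row_def transpose_mult[OF GL_carrier[OF assms(1)] GL_carrier[OF assms(2)]]
  by (rule assoc_mult_mat_vec[OF GL_carrier[OF GL_transpose[OF assms(2)]] GL_carrier[OF GL_transpose[OF assms(1)]] assms(3)])

lemma row_scalar:
  assumes "g \<in> GL n" "x \<in> carrier_vec n" "y \<in> carrier_vec n"
  shows "row x g \<bullet> y = x \<bullet> row y (transpose_mat g)"
  unfolding row_def using transpose_vec_mult_scalar[OF GL_carrier[OF assms(1)] assms(3,2)] by simp

lemma GL_sub_GL: "g \<in> GL_sub n K \<Longrightarrow> g \<in> GL n"
  by (simp add: GL_sub_def)

lemma H_group: "mat_group n (GL_sub n K)"
  by (rule mat_group_GL_sub[OF K])

lemma GL_sub_transpose: "g \<in> GL_sub n K \<Longrightarrow> transpose_mat g \<in> GL_sub n K"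
  by (auto simp: GL_sub_def dest: GL_carrier)

lemma row_X:
  assumes g: "g \<in> GL_sub n K" and x: "x \<in> X n K"
  shows "row x g \<in> X n K"
proof -
  note t = GL_carrier[OF GL_transpose[OF GL_sub_GL[OF g]]]
  have "row x g $ i \<in> K" if "i < n" for i
    unfolding row_def index_mult_vec_sum[OF t XD(1)[OF x] that]
    using GL_sub_transpose[OF g] XD(2)[OF x] that K
    by (intro subring_sum[OF K]) (auto simp: GL_sub_def subring_def)
  then show ?thesis using row_carrier[OF GL_sub_GL[OF g] XD(1)[OF x]] by (auto simp: X_def)
qed

lemma psiN_K: "u \<in> unip n K \<Longrightarrow> psiN chi n u = 1"
  unfolding psiN_def by (rule chi_K, rule subring_sum[OF K]) (auto simp: unip_def)

lemma V_top: "V (n - 1) = {1\<^sub>m n}"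
proof -
  have "u = 1\<^sub>m n" if "u \<in> V (n - 1)" for u
    using VD(2)[OF that] VD(1)[OF that] by (intro eq_matI) (auto simp: unip_def)
  moreover have "1\<^sub>m n \<in> V (n - 1)" by (auto simp: V_def mat_groupD(2)[OF N_group])
  ultimately show ?thesis by blast
qed

context
  fixes d :: nat and rho :: "'a mat \<Rightarrow> complex mat"
  assumes n_pos: "n \<ge> 1"
    and irr: "irreducible_rep n d rho" and cusp: "cuspidal_rep n d rho"
begin

text \<open>Projection onto the Whittaker functionals, without the factor 1/|N|.\<close>

definition whittaker_part :: "(complex vec \<Rightarrow> complex) \<Rightarrow> complex vec \<Rightarrow> complex" where
  "whittaker_part L v = (\<Sum>u\<in>N n. inverse (psiN chi n u) * L (rho u *\<^sub>v v))"

text \<open>Despite the name, invariance is under the mirabolic subgroup \<open>P (n - 1) K\<close>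
  of H only.\<close>

definition H_inv :: "(complex vec \<Rightarrow> complex) \<Rightarrow> bool" where
  "H_inv L \<longleftrightarrow> (\<forall>p\<in>P (n - 1) K. \<forall>v\<in>carrier_vec d. L (rho p *\<^sub>v v) = L v)"

lemma linf_comp_rho: "linf d L \<Longrightarrow> g \<in> GL n \<Longrightarrow> linf d (\<lambda>v. L (rho g *\<^sub>v v))"
  by (simp add: linf_def rho_add[OF irr] rho_smult[OF irr] rho_vec[OF irr])

lemma linf_sum: "(\<And>s. s \<in> S \<Longrightarrow> linf d (L s)) \<Longrightarrow> linf d (\<lambda>v. \<Sum>s\<in>S. c s * L s v)"
  by (simp add: linf_def sum.distrib distrib_left sum_distrib_left mult.left_commute cong: sum.cong_simp)

text \<open>The vector obtained by summing \<open>rho r w\<close> over the radical is fixed by the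
  radical, hence zero by cuspidality.\<close>

lemma radical_sum_zero:
  assumes L: "linf d L" and c: "c \<in> {1..<n}" and w: "w \<in> carrier_vec d"
  shows "(\<Sum>r\<in>unip_radical n {c}. L (rho r *\<^sub>v w)) = 0"
proof -
  let ?R = "unip_radical n {c} :: 'a mat set"
  note RG = mat_group_unip_radical[of n c, where ?'a = 'a]
  define y where "y = vsum d ?R (\<lambda>r. rho r *\<^sub>v w)"
  have yc: "y \<in> carrier_vec d" by (simp add: y_def)
  have rw: "rho r *\<^sub>v w \<in> carrier_vec d" if "r \<in> ?R" for r
    using rho_vec[OF irr mat_groupD(1)[OF RG that] w] .
  have "rho s *\<^sub>v y = y" if s: "s \<in> ?R" for s
  proof -
    note sG = mat_groupD(1)[OF RG s]
    have "rho s *\<^sub>v y = vsum d ?R (\<lambda>r. rho s *\<^sub>v (rho r *\<^sub>v w))"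
      unfolding y_def by (rule mult_vsum[OF rho_carrier[OF irr sG] rw])
    also have "\<dots> = vsum d ?R (\<lambda>r. rho (s * r) *\<^sub>v w)"
      using rho_mult[OF irr sG mat_groupD(1)[OF RG] w] unfolding vsum_def by (simp cong: sum.cong_simp)
    also have "\<dots> = y"
      unfolding vsum_def y_def
    proof (rule eq_vecI)
      fix i assume "i < dim_vec (vec d (\<lambda>i. \<Sum>r\<in>?R. (rho r *\<^sub>v w) $ i))"
      then show "vec d (\<lambda>i. \<Sum>r\<in>?R. (rho (s * r) *\<^sub>v w) $ i) $ i = vec d (\<lambda>i. \<Sum>r\<in>?R. (rho r *\<^sub>v w) $ i) $ i"
        using mat_group_sum(2)[OF RG s, of "\<lambda>r. (rho r *\<^sub>v w) $ i"] by simp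
    qed simp
    finally show ?thesis .
  qed
  then have y0: "y = 0\<^sub>v d" using cusp c yc unfolding cuspidal_rep_def by blast
  obtain l where l: "l \<in> carrier_vec d" "\<And>x. x \<in> carrier_vec d \<Longrightarrow> L x = l \<bullet> x"
    using linear_functional_vec[OF L] by blast
  have "(\<Sum>r\<in>?R. L (rho r *\<^sub>v w)) = (\<Sum>r\<in>?R. l \<bullet> (rho r *\<^sub>v w))" using l(2)[OF rw] by simp
  also have "\<dots> = l \<bullet> y" unfolding y_def by (rule scalar_vsum[OF l(1) rw, symmetric])
  finally show ?thesis using y0 l(1) by simp
qed

text \<open>\<open>invariant_cuspidal_zero\<close> applied to \<open>g -> L (rho g v)\<close> at the
  top level \<open>c = n - 1\<close>, where \<open>V\<close> is trivial and equivariance is no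
  condition; the value at the identity is \<open>L v\<close>.\<close>

lemma H_inv_zero:
  assumes L: "linf d L" "H_inv L" and w: "\<And>v. v \<in> carrier_vec d \<Longrightarrow> whittaker_part L v = 0"
    and v: "v \<in> carrier_vec d"
  shows "L v = 0"
proof -
  let ?f = "\<lambda>g. L (rho g *\<^sub>v v)"
  have "?f (1\<^sub>m n) = 0"
  proof (rule invariant_cuspidal_zero[of "n - 1" ?f])
    show "V_equivariant (n - 1) ?f"
      unfolding V_equivariant_def V_top by (auto dest: GL_carrier)
    show "P_invariant (n - 1) ?f"
      unfolding P_invariant_def using L(2) rho_mult[OF irr PD(1) _ v] rho_vec[OF irr _ v] by (simp add: H_inv_def)
    show "cuspidal_fun ?f"
      unfolding cuspidal_fun_def
    proof (intro ballI)
      fix c :: nat and g h :: "'a mat" assume c: "c \<in> {1..<n}" and g: "g \<in> GL n" and h: "h \<in> GL n"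
      have "(\<Sum>r\<in>unip_radical n {c}. ?f (g * r * h)) = (\<Sum>r\<in>unip_radical n {c}. L (rho g *\<^sub>v (rho r *\<^sub>v (rho h *\<^sub>v v))))"
      proof (rule sum.cong[OF refl])
        fix r :: "'a mat" assume "r \<in> unip_radical n {c}"
        then have r: "r \<in> GL n" using mat_groupD(1)[OF mat_group_unip_radical] by blast
        show "?f (g * r * h) = L (rho g *\<^sub>v (rho r *\<^sub>v (rho h *\<^sub>v v)))"
          using rho_mult[OF irr GL_mult[OF g r] h v] rho_mult[OF irr g r rho_vec[OF irr h v]] by simp
      qed
      also have "\<dots> = 0"
        by (rule radical_sum_zero[OF linf_comp_rho[OF L(1) g] c rho_vec[OF irr h v]])
      finally show "(\<Sum>r\<in>unip_radical n {c}. ?f (g * r * h)) = 0" .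
    qed
    show "N_null ?f"
      unfolding N_null_def
    proof (intro ballI)
      fix g :: "'a mat" assume g: "g \<in> GL n"
      show "(\<Sum>u\<in>N n. inverse (psiN chi n u) * ?f (u * g)) = 0"
        using w[OF rho_vec[OF irr g v]] rho_mult[OF irr unip_GL g v]
        by (simp add: whittaker_part_def cong: sum.cong_simp)
    qed
  qed (use n_pos in auto)
  then show ?thesis using rho_one[OF irr v] by simp
qed

lemma whittaker_part_multiple:
  assumes L: "linf d L" and l: "is_whittaker_functional n d rho chi l" "l \<noteq> 0\<^sub>v d"
  shows "\<exists>c. \<forall>v\<in>carrier_vec d. whittaker_part L v = c * (l \<bullet> v)"
proof -
  have "linf d (whittaker_part L)"
    unfolding whittaker_part_def using linf_comp_rho[OF L unip_GL] by (intro linf_sum) auto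
  from linear_functional_vec[OF this] obtain k where
    k: "k \<in> carrier_vec d" "\<And>x. x \<in> carrier_vec d \<Longrightarrow> whittaker_part L x = k \<bullet> x" by blast
  have "is_whittaker_functional n d rho chi k"
    unfolding is_whittaker_functional_def
  proof (intro conjI ballI)
    fix w and v :: "complex vec" assume w: "w \<in> N n" and v: "v \<in> carrier_vec d"
    let ?F = "\<lambda>u. psiN chi n w * (inverse (psiN chi n u) * L (rho u *\<^sub>v v))"
    have "k \<bullet> (rho w *\<^sub>v v) = (\<Sum>u\<in>N n. inverse (psiN chi n u) * L (rho u *\<^sub>v (rho w *\<^sub>v v)))"
      using k(2)[OF rho_vec[OF irr unip_GL[OF w] v]] by (simp add: whittaker_part_def)
    also have "\<dots> = (\<Sum>u\<in>N n. ?F (u * w))"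
      using rho_mult[OF irr unip_GL unip_GL[OF w] v] psiN_mult[OF _ w]
      by (intro sum.cong refl) simp
    also have "\<dots> = (\<Sum>u\<in>N n. ?F u)" by (rule mat_group_sum(1)[OF N_group w, of ?F])
    also have "\<dots> = psiN chi n w * (k \<bullet> v)"
      using k(2)[OF v] by (simp add: whittaker_part_def sum_distrib_left[symmetric])
    finally show "k \<bullet> (rho w *\<^sub>v v) = psiN chi n w * (k \<bullet> v)" .
  qed (rule k(1))
  from whittaker_unique[OF irr l this] show ?thesis using k(2) by simp
qed

text \<open>By uniqueness both projections are multiples of \<open>l\<close>, with nonzero factors
  \<open>a\<close> and \<open>b\<close> since a functional with zero projection vanishes. The
  combination of \<open>L\<close> and \<open>M\<close> that cancels the projections then vanishes as
  well.\<close>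

lemma H_inv_proportional:
  assumes l: "is_whittaker_functional n d rho chi l" "l \<noteq> 0\<^sub>v d"
    and L: "linf d L" "H_inv L" "v0 \<in> carrier_vec d" "L v0 \<noteq> 0"
    and M: "linf d M" "H_inv M" "w0 \<in> carrier_vec d" "M w0 \<noteq> 0"
  shows "\<exists>\<gamma>. \<gamma> \<noteq> 0 \<and> (\<forall>v\<in>carrier_vec d. M v = \<gamma> * L v)"
proof -
  obtain a where a: "\<And>v. v \<in> carrier_vec d \<Longrightarrow> whittaker_part L v = a * (l \<bullet> v)"
    using whittaker_part_multiple[OF L(1) l] by blast
  obtain b where b: "\<And>v. v \<in> carrier_vec d \<Longrightarrow> whittaker_part M v = b * (l \<bullet> v)"
    using whittaker_part_multiple[OF M(1) l] by blast
  have a0: "a \<noteq> 0" using H_inv_zero[OF L(1,2) _ L(3)] a L(4) by auto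
  have b0: "b \<noteq> 0" using H_inv_zero[OF M(1,2) _ M(3)] b M(4) by auto
  define D where "D = (\<lambda>v. M v - b / a * L v)"
  have D: "linf d D" "H_inv D"
    using L M by (simp_all add: D_def linf_def H_inv_def algebra_simps add_divide_distrib)
  have wD: "whittaker_part D v = 0" if "v \<in> carrier_vec d" for v
  proof -
    have "whittaker_part D v = whittaker_part M v - b / a * whittaker_part L v"
      unfolding whittaker_part_def D_def sum_distrib_left sum_subtractf[symmetric]
      by (intro sum.cong refl) (simp add: algebra_simps)
    then show ?thesis using a b that a0 by simp
  qed
  have "M v = b / a * L v" if "v \<in> carrier_vec d" for v
    using H_inv_zero[OF D wD that] by (simp add: D_def)
  then show ?thesis using a0 b0 by (intro exI[of _ "b / a"]) simp
qed

end

end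

section \<open>The functional equation\<close>

context relative_character
begin

context
  fixes d :: nat and rho :: "'a mat \<Rightarrow> complex mat" and psi :: "'a \<Rightarrow> complex"
  assumes n_pos: "n \<ge> 1"
    and irr: "irreducible_rep n d rho" and cusp: "cuspidal_rep n d rho"
    and K_divide: "\<And>x y. x \<in> K \<Longrightarrow> y \<in> K \<Longrightarrow> x / y \<in> K" and K_minus: "\<And>x. x \<in> K \<Longrightarrow> - x \<in> K"
    and psi_add: "\<And>x y. x \<in> K \<Longrightarrow> y \<in> K \<Longrightarrow> psi (x + y) = psi x * psi y"
    and psi_0: "psi 0 = 1" and psi_nontriv: "\<exists>x\<in>K. psi x \<noteq> 1"
begin

abbreviation e :: "'a vec" where "e \<equiv> unit_vec n (n - 1)"

lemma e_X: "e \<in> X n K" "e \<in> carrier_vec n"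
  using K by (auto simp: X_def subring_def unit_vec_def)

lemma X_scalar: "x \<in> X n K \<Longrightarrow> y \<in> X n K \<Longrightarrow> x \<bullet> y \<in> K"
  unfolding scalar_prod_def using K
  by (intro subring_sum[OF K]) (auto simp: X_def subring_def)

lemma row_e_index: "g \<in> GL n \<Longrightarrow> j < n \<Longrightarrow> row e g $ j = g $$ (n - 1, j)"
  using last_row_index[of g n j] by (simp add: row_def last_row_times_def)

lemma last_row: "last_row_times n g = row e g"
  by (simp add: row_def last_row_times_def)

lemma Kvecs_X: "Kvecs n K = X n K"
  by (auto simp: Kvecs_def X_def)

lemma row_transitive:
  assumes x: "x \<in> X n K" "x \<noteq> 0\<^sub>v n"
  shows "\<exists>k\<in>GL_sub n K. row e k = x"
proof -
  have K01: "0 \<in> K" "1 \<in> K" using K by (auto simp: subring_def)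
  have c: "n - 1 < n" using n_pos by simp
  obtain p where p: "p \<in> GL_sub n K" "\<forall>k<n. p $$ (n - 1,k) = x $ k"
    using row_completion[OF K01 c XD(1)[OF x(1)] x(2) XD(2)[OF x(1)]] by force
  have "row e p = x"
    using row_e_index[OF GL_sub_GL[OF p(1)]] p(2) row_carrier[OF GL_sub_GL[OF p(1)] e_X(2)] XD(1)[OF x(1)]
    by (intro eq_vecI) auto
  then show ?thesis using p(1) by blast
qed

lemma row_e_nonzero: "g \<in> GL n \<Longrightarrow> row e g \<noteq> 0\<^sub>v n"
proof
  assume g: "g \<in> GL n" and "row e g = 0\<^sub>v n"
  then have "row (0\<^sub>v n) (mat_inv n g) = row e (g * mat_inv n g)"
    using row_mult[OF g mat_inv_GL[OF g] e_X(2)] by simp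
  also have "\<dots> = e" using mat_inv(2)[OF g] by (simp add: row_def)
  finally have eq: "row (0\<^sub>v n) (mat_inv n g) = e" .
  have "row (0\<^sub>v n) (mat_inv n g) $ (n - 1) = 0"
    using n_pos mat_inv(1)[OF g] unfolding row_def
    by (subst index_mult_vec_sum[of _ n n]) auto
  then show False using eq n_pos by simp
qed

lemma psi_orthogonality:
  assumes y: "y \<in> X n K"
  shows "(\<Sum>x\<in>X n K. psi (x \<bullet> y)) = (if y = 0\<^sub>v n then of_nat (card (X n K)) else 0)"
proof (cases "y = 0\<^sub>v n")
  case True
  have "psi (x \<bullet> y) = 1" if "x \<in> X n K" for x using that True XD(1) psi_0 by simp
  then show ?thesis using True by simp
next
  case False
  then obtain i where i: "i < n" "y $ i \<noteq> 0"
    using XD(1)[OF y] by (metis carrier_vecD eq_vecI index_zero_vec(1) index_zero_vec(2))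
  obtain t where t: "t \<in> K" "psi t \<noteq> 1" using psi_nontriv by blast
  define b where "b = (t / y $ i) \<cdot>\<^sub>v unit_vec n i"
  have b: "b \<in> X n K" using K_divide[OF t(1) XD(2)[OF y i(1)]] K by (auto simp: b_def X_def unit_vec_def subring_def)
  have "b \<bullet> y = t" using i XD(1)[OF y] by (simp add: b_def)
  have "(\<Sum>x\<in>X n K. psi (x \<bullet> y)) = 0"
  proof (rule sum_character_zero[OF X_shift[OF K b]])
    fix x assume x: "x \<in> X n K"
    show "psi ((x + b) \<bullet> y) = psi t * psi (x \<bullet> y)"
      using psi_add[OF X_scalar[OF x y] X_scalar[OF b y]] \<open>b \<bullet> y = t\<close>
        add_scalar_prod_distrib[OF XD(1)[OF x] XD(1)[OF b] XD(1)[OF y]] by simp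
  qed (rule t(2))
  then show ?thesis using False by simp
qed

section \<open>The two functionals behind the two zeta sums\<close>

definition dual :: "'a mat \<Rightarrow> 'a mat" where
  "dual g = omega n * transpose_mat (mat_inv n g)"

lemma dual_GL: "g \<in> GL n \<Longrightarrow> dual g \<in> GL n"
  by (simp add: dual_def)

lemma dual_antitr: "g \<in> GL n \<Longrightarrow> dual g = antitr n (mat_inv n g) * omega n"
  using antitr_omega[OF mat_inv(1), of g n] by (simp add: dual_def)

lemma dual_mult:
  assumes "u \<in> GL n" "g \<in> GL n"
  shows "dual (u * g) = antitr n (mat_inv n u) * dual g"
  using assms antitr_mult[OF mat_inv(1) mat_inv(1), of g n u]
    GL_assoc[OF antitr_GL antitr_GL omega_GL, of "mat_inv n u" n "mat_inv n g"]
  by (simp add: dual_antitr mat_inv_mult)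

text \<open>Right translation by \<open>k\<close> after the twist corresponds to right translation
  by the transpose of \<open>k\<close> before it; this is matched in \<open>L2_shift\<close> by the
  adjoint relation (x k).y = x.(y k^t).\<close>

lemma dual_mult_transpose:
  assumes g: "g \<in> GL n" and k: "k \<in> GL n"
  shows "dual (g * transpose_mat k) * k = dual g"
proof -
  note kt = GL_transpose[OF k]
  have "transpose_mat (mat_inv n (g * transpose_mat k)) = transpose_mat (mat_inv n g) * mat_inv n k"
    using transpose_mult[OF mat_inv(1)[OF kt] mat_inv(1)[OF g]] transpose_mat_inv[OF k]
    by (simp add: mat_inv_mult[OF g kt])
  then have "dual (g * transpose_mat k) * k = dual g * mat_inv n k * k"
    using GL_assoc[OF omega_GL GL_transpose[OF mat_inv_GL[OF g]] mat_inv_GL[OF k]] by (simp add: dual_def)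
  then show ?thesis using mat_inv_cancel_right(2)[OF k GL_carrier[OF dual_GL[OF g]]] by simp
qed

text \<open>The coefficient of \<open>phi x\<close> in |N(F)| times the left-hand zeta sum.\<close>

definition L1 :: "complex vec \<Rightarrow> 'a vec \<Rightarrow> complex vec \<Rightarrow> complex" where
  "L1 l x v = (\<Sum>g\<in>{g \<in> GL_sub n K. row e g = x}. l \<bullet> (rho g *\<^sub>v v))"

text \<open>The coefficient of \<open>phi x\<close> in |N(F)| times the right-hand zeta sum, after
  expanding the Fourier transform.\<close>

definition L2 :: "complex vec \<Rightarrow> 'a vec \<Rightarrow> complex vec \<Rightarrow> complex" where
  "L2 l x v = (\<Sum>g\<in>GL_sub n K. psi (x \<bullet> row e g) * (l \<bullet> (rho (dual g) *\<^sub>v v)))"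

lemma L_linear:
  assumes "l \<in> carrier_vec d"
  shows "linf d (L1 l x)" "linf d (L2 l x)"
proof -
  have "linf d (\<lambda>v. \<Sum>g\<in>{g \<in> GL_sub n K. row e g = x}. 1 * (l \<bullet> (rho g *\<^sub>v v)))"
    using linf_rho[OF irr assms GL_sub_GL] by (intro linf_sum[OF n_pos irr cusp]) auto
  then show "linf d (L1 l x)" by (simp add: L1_def[abs_def])
  show "linf d (L2 l x)"
    unfolding L2_def[abs_def] using linf_rho[OF irr assms dual_GL[OF GL_sub_GL]]
    by (intro linf_sum[OF n_pos irr cusp]) auto
qed

lemma L1_shift:
  assumes k: "k \<in> GL_sub n K" and x: "x \<in> X n K" and v: "v \<in> carrier_vec d"
  shows "L1 l (row x k) v = L1 l x (rho k *\<^sub>v v)"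
proof -
  note kG = GL_sub_GL[OF k] and xc = XD(1)[OF x]
  let ?A = "{g \<in> GL_sub n K. row e g = x}" and ?B = "{g \<in> GL_sub n K. row e g = row x k}"
  have "bij_betw (\<lambda>g. g * k) ?A ?B"
  proof (rule bij_betw_byWitness[where f' = "\<lambda>g. g * mat_inv n k"])
    show "\<forall>g\<in>?A. g * k * mat_inv n k = g" "\<forall>g\<in>?B. g * mat_inv n k * k = g"
      using mat_inv_cancel_right[OF kG GL_carrier[OF GL_sub_GL]] by auto
    show "(\<lambda>g. g * k) ` ?A \<subseteq> ?B"
      using mat_groupD(3)[OF H_group _ k] row_mult[OF GL_sub_GL kG e_X(2)] by auto
    have "row (row x k) (mat_inv n k) = x"
      using row_mult[OF kG mat_inv_GL[OF kG] xc] mat_inv(2)[OF kG] xc by (simp add: row_def)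
    then show "(\<lambda>g. g * mat_inv n k) ` ?B \<subseteq> ?A"
      using mat_groupD(3)[OF H_group _ mat_group_inv[OF H_group k]] row_mult[OF GL_sub_GL mat_inv_GL[OF kG] e_X(2)] by auto
  qed
  from sum.reindex_bij_betw[OF this, of "\<lambda>g. l \<bullet> (rho g *\<^sub>v v)"]
  have "L1 l (row x k) v = (\<Sum>g\<in>?A. l \<bullet> (rho (g * k) *\<^sub>v v))" by (simp add: L1_def)
  also have "\<dots> = L1 l x (rho k *\<^sub>v v)"
    unfolding L1_def using rho_mult[OF irr GL_sub_GL kG v] by (intro sum.cong) auto
  finally show ?thesis .
qed

text \<open>The substitution g -> g k^t moves \<open>k\<close> from \<open>x\<close> into the
  pairing with the last row of \<open>g\<close> and, through \<open>dual_mult_transpose\<close>,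
  onto \<open>v\<close>.\<close>

lemma L2_shift:
  assumes k: "k \<in> GL_sub n K" and x: "x \<in> X n K" and v: "v \<in> carrier_vec d"
  shows "L2 l (row x k) v = L2 l x (rho k *\<^sub>v v)"
proof -
  note kG = GL_sub_GL[OF k]
  let ?F = "\<lambda>g. psi (x \<bullet> row e g) * (l \<bullet> (rho (dual g) *\<^sub>v (rho k *\<^sub>v v)))"
  have "L2 l (row x k) v = (\<Sum>g\<in>GL_sub n K. ?F (g * transpose_mat k))"
    unfolding L2_def
  proof (rule sum.cong[OF refl])
    fix g assume "g \<in> GL_sub n K"
    then have g: "g \<in> GL n" by (rule GL_sub_GL)
    have "row x k \<bullet> row e g = x \<bullet> row e (g * transpose_mat k)"
      using row_scalar[OF kG XD(1)[OF x] row_carrier[OF g e_X(2)]] row_mult[OF g GL_transpose[OF kG] e_X(2)] by simp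
    moreover have "rho (dual (g * transpose_mat k)) *\<^sub>v (rho k *\<^sub>v v) = rho (dual g) *\<^sub>v v"
      using rho_mult[OF irr dual_GL[OF GL_mult[OF g GL_transpose[OF kG]]] kG v] dual_mult_transpose[OF g kG] by simp
    ultimately show "psi (row x k \<bullet> row e g) * (l \<bullet> (rho (dual g) *\<^sub>v v)) = ?F (g * transpose_mat k)" by simp
  qed
  also have "\<dots> = L2 l x (rho k *\<^sub>v v)"
    unfolding L2_def by (rule mat_group_sum(1)[OF H_group GL_sub_transpose[OF k], of ?F])
  finally show ?thesis .
qed

lemma H_inv_L: "H_inv d rho (L1 l e)" "H_inv d rho (L2 l e)"
proof -
  have fixed: "p \<in> GL_sub n K \<and> row e p = e" if p: "p \<in> P (n - 1) K" for p
  proof -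
    have c: "n - 1 < n" using n_pos by simp
    have "row e p = e"
      using row_e_index[OF PD(1)[OF p]] PD(2)[OF p c] row_carrier[OF PD(1)[OF p] e_X(2)]
      by (intro eq_vecI) (auto simp: unit_vec_def)
    then show ?thesis using p by (simp add: P_def)
  qed
  show "H_inv d rho (L1 l e)" "H_inv d rho (L2 l e)"
    unfolding H_inv_def[OF n_pos irr cusp] using L1_shift[OF _ e_X(1), symmetric] L2_shift[OF _ e_X(1), symmetric] fixed by auto
qed

context
  fixes l v0
  assumes l: "is_whittaker_functional n d rho chi l"
    and v0: "v0 \<in> carrier_vec d" "l \<bullet> v0 \<noteq> 0" "\<And>u. u \<in> N n \<Longrightarrow> rho u *\<^sub>v v0 = psiN chi n u \<cdot>\<^sub>v v0"
begin

text \<open>Off \<open>N n\<close> the value vanishes by \<open>bieq_mirabolic\<close>; on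
  \<open>N n\<close> the matrix has entries in \<open>K\<close>, where the character is
  trivial.\<close>

lemma whittaker_mirabolic:
  assumes g: "g \<in> GL_sub n K" "row e g = e"
  shows "l \<bullet> (rho g *\<^sub>v v0) = (if g \<in> N n then l \<bullet> v0 else 0)"
proof (cases "g \<in> N n")
  case True
  then have "g \<in> unip n K" using g(1) by (simp add: GL_sub_def unip_def)
  then show ?thesis using v0(3)[OF True] psiN_K[of g] True by simp
next
  case False
  have "g $$ (n - 1, j) = (if j = n - 1 then 1 else 0)" if "j < n" for j
    using row_e_index[OF GL_sub_GL[OF g(1)] that] g(2) that by (simp add: unit_vec_def)
  then show ?thesis
    using bieq_mirabolic[OF whittaker_bieq[OF irr l v0(1,3)] GL_sub_GL[OF g(1)]] n_pos False by auto
qed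

lemma row_e_one: "row e (1\<^sub>m n) = e"
  by (simp add: row_def)

text \<open>At the Whittaker vector all nonzero summands equal \<open>l \<bullet> v0\<close>, so
  they cannot cancel, and the identity contributes one.\<close>

lemma L1_nonzero: "L1 l e v0 \<noteq> 0"
proof -
  let ?S = "{g \<in> GL_sub n K. row e g = e}"
  have fin: "finite ?S" using mat_group_finite[OF H_group] by simp
  have "L1 l e v0 = (\<Sum>g\<in>?S. if g \<in> N n then l \<bullet> v0 else 0)"
    unfolding L1_def using whittaker_mirabolic by (intro sum.cong) auto
  also have "\<dots> = of_nat (card (?S \<inter> N n)) * (l \<bullet> v0)" using fin by (simp add: sum.If_cases)
  finally have "L1 l e v0 = of_nat (card (?S \<inter> N n)) * (l \<bullet> v0)" .
  moreover have "1\<^sub>m n \<in> ?S \<inter> N n"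
    using mat_groupD(2)[OF H_group] mat_groupD(2)[OF N_group] row_e_one by simp
  then have "card (?S \<inter> N n) \<noteq> 0" using fin by auto
  ultimately show ?thesis using v0(2) by simp
qed

text \<open>If L2 vanished, then so would its combination with the weights psi(-x.e) - 1, which vanish at
  x = 0; by Fourier inversion that combination is the sum of the Whittaker function
  over the mirabolic subgroup.\<close>

lemma L2_nonzero: "\<exists>v\<in>carrier_vec d. L2 l e v \<noteq> 0"
proof (rule ccontr)
  assume "\<not> ?thesis"
  then have zero: "L2 l e v = 0" if "v \<in> carrier_vec d" for v using that by blast
  \<comment> \<open>Translating by \<open>omega n\<close> cancels the one in \<open>dual g\<close>
    and leaves the reflection of the inverse of \<open>g\<close>, on which
    \<open>bieq_antitr\<close> can be used.\<close>
  let ?v = "rho (omega n) *\<^sub>v v0" and ?S = "{g \<in> GL_sub n K. row e g = e}"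
  have v: "?v \<in> carrier_vec d" by (rule rho_vec[OF irr omega_GL v0(1)])
  have Lx: "L2 l x ?v = 0" if x: "x \<in> X n K" "x \<noteq> 0\<^sub>v n" for x
  proof -
    obtain k where k: "k \<in> GL_sub n K" "row e k = x" using row_transitive[OF x] by blast
    then show ?thesis using L2_shift[OF k(1) e_X(1) v] zero[OF rho_vec[OF irr GL_sub_GL[OF k(1)] v]] by simp
  qed
  let ?a = "\<lambda>x. psi (- (x \<bullet> e)) - 1"
  have term0: "?a x * L2 l x ?v = 0" if x: "x \<in> X n K" for x
    using Lx[OF x] psi_0 e_X(2) by (cases "x = 0\<^sub>v n") auto
  have inner: "(\<Sum>x\<in>X n K. ?a x * psi (x \<bullet> row e g)) = (if row e g = e then of_nat (card (X n K)) else 0)"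
    if g: "g \<in> GL_sub n K" for g
  proof -
    have r: "row e g \<in> X n K" by (rule row_X[OF g e_X(1)])
    have re: "row e g - e \<in> X n K"
      using r e_X K_minus K by (auto simp: X_def subring_def) (metis add_uminus_conv_diff)
    have "?a x * psi (x \<bullet> row e g) = psi (x \<bullet> (row e g - e)) - psi (x \<bullet> row e g)" if x: "x \<in> X n K" for x
    proof -
      have "x \<bullet> (row e g - e) = - (x \<bullet> e) + x \<bullet> row e g"
        using scalar_prod_minus_distrib[OF XD(1)[OF x] XD(1)[OF r] e_X(2)] by simp
      then show ?thesis using psi_add[OF K_minus[OF X_scalar[OF x e_X(1)]] X_scalar[OF x r]]
        by (simp add: left_diff_distrib)
    qed
    then have "(\<Sum>x\<in>X n K. ?a x * psi (x \<bullet> row e g))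
        = (\<Sum>x\<in>X n K. psi (x \<bullet> (row e g - e))) - (\<Sum>x\<in>X n K. psi (x \<bullet> row e g))"
      by (simp add: sum_subtractf)
    \<comment> \<open>The second sum drops out because the last row of an invertible matrix is never
      zero.\<close>
    also have "\<dots> = (if row e g - e = 0\<^sub>v n then of_nat (card (X n K)) else 0)"
      unfolding psi_orthogonality[OF re] psi_orthogonality[OF r] using row_e_nonzero[OF GL_sub_GL[OF g]] by simp
    also have "row e g - e = 0\<^sub>v n \<longleftrightarrow> row e g = e"
      using XD(1)[OF r] e_X(2) by (auto simp: vec_eq_iff)
    finally show ?thesis .
  qed
  have val: "l \<bullet> (rho (dual g) *\<^sub>v ?v) = (if mat_inv n g \<in> N n then l \<bullet> v0 else 0)" if g: "g \<in> ?S" for g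
  proof -
    have gH: "g \<in> GL_sub n K" and re: "row e g = e" using g by auto
    note gG = GL_sub_GL[OF gH]
    have "dual g * omega n = antitr n (mat_inv n g)"
      using GL_assoc[OF antitr_GL[OF mat_inv_GL[OF gG]] omega_GL omega_GL] omega_omega[of n, where ?'a = 'a]
        right_mult_one_mat[OF antitr_carrier]
      by (simp add: dual_antitr[OF gG])
    then have "l \<bullet> (rho (dual g) *\<^sub>v ?v) = l \<bullet> (rho (antitr n (mat_inv n g)) *\<^sub>v v0)"
      using rho_mult[OF irr dual_GL[OF gG] omega_GL v0(1)] by simp
    also have "\<dots> = l \<bullet> (rho (mat_inv n g) *\<^sub>v v0)"
      using bieq_antitr[OF whittaker_bieq[OF irr l v0(1,3)] mat_inv_GL[OF gG]] by simp
    also have "row e (mat_inv n g) = e"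
      using row_mult[OF gG mat_inv_GL[OF gG] e_X(2)] re mat_inv(2)[OF gG] row_e_one by simp
    then have "l \<bullet> (rho (mat_inv n g) *\<^sub>v v0) = (if mat_inv n g \<in> N n then l \<bullet> v0 else 0)"
      by (rule whittaker_mirabolic[OF mat_group_inv[OF H_group gH]])
    finally show ?thesis .
  qed
  have fin: "finite ?S" using mat_group_finite[OF H_group] by simp
  have "0 = (\<Sum>x\<in>X n K. ?a x * L2 l x ?v)" using term0 by simp
  also have "\<dots> = (\<Sum>g\<in>GL_sub n K. (\<Sum>x\<in>X n K. ?a x * psi (x \<bullet> row e g)) * (l \<bullet> (rho (dual g) *\<^sub>v ?v)))"
    unfolding L2_def sum_distrib_left sum_distrib_right by (subst sum.swap) (simp add: mult.assoc)
  also have "\<dots> = (\<Sum>g\<in>GL_sub n K. if row e g = e then of_nat (card (X n K)) * (l \<bullet> (rho (dual g) *\<^sub>v ?v)) else 0)"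
    using inner by (intro sum.cong refl) simp
  also have "\<dots> = (\<Sum>g\<in>?S. of_nat (card (X n K)) * (l \<bullet> (rho (dual g) *\<^sub>v ?v)))"
    using mat_group_finite[OF H_group] by (rule sum.inter_filter[symmetric])
  also have "\<dots> = (\<Sum>g\<in>?S. if mat_inv n g \<in> N n then of_nat (card (X n K)) * (l \<bullet> v0) else 0)"
    using val by (intro sum.cong refl) simp
  also have "\<dots> = of_nat (card (?S \<inter> {g. mat_inv n g \<in> N n})) * (of_nat (card (X n K)) * (l \<bullet> v0))"
    using fin by (simp add: sum.If_cases)
  finally have "of_nat (card (?S \<inter> {g. mat_inv n g \<in> N n})) * (of_nat (card (X n K)) * (l \<bullet> v0)) = (0::complex)" by simp
  moreover have "mat_inv n (1\<^sub>m n :: 'a mat) = 1\<^sub>m n" by (rule mat_inv_unique) auto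
  then have "1\<^sub>m n \<in> ?S \<inter> {g. mat_inv n g \<in> N n}"
    using mat_groupD(2)[OF H_group] mat_groupD(2)[OF N_group] row_e_one by simp
  then have "card (?S \<inter> {g. mat_inv n g \<in> N n}) \<noteq> 0" using fin by auto
  moreover have "card (X n K) \<noteq> 0" using e_X finite_X[of n K] by auto
  ultimately show False using v0(2) by simp
qed

end

text \<open>Proportionality holds at the last basis row, where both functionals are mirabolic
  invariant, and spreads to all nonzero rows because \<open>L1\<close> and \<open>L2\<close> shift
  alike under the transitive action of H.\<close>

lemma L_proportional:
  assumes l: "is_whittaker_functional n d rho chi l" "l \<noteq> 0\<^sub>v d"
  shows "\<exists>\<gamma>. \<gamma> \<noteq> 0 \<and> (\<forall>x\<in>X n K. \<forall>v\<in>carrier_vec d. x \<noteq> 0\<^sub>v n \<longrightarrow> L2 l x v = \<gamma> * L1 l x v)"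
proof -
  have lc: "l \<in> carrier_vec d" using l by (simp add: is_whittaker_functional_def)
  obtain v0 where v0: "v0 \<in> carrier_vec d" "l \<bullet> v0 \<noteq> 0" "\<And>u. u \<in> N n \<Longrightarrow> rho u *\<^sub>v v0 = psiN chi n u \<cdot>\<^sub>v v0"
    by (rule whittaker_vector[OF irr l]) blast
  obtain w0 where w0: "w0 \<in> carrier_vec d" "L2 l e w0 \<noteq> 0" using L2_nonzero[OF l(1) v0] by blast
  obtain \<gamma> where \<gamma>: "\<gamma> \<noteq> 0" "\<forall>v\<in>carrier_vec d. L2 l e v = \<gamma> * L1 l e v"
    using H_inv_proportional[OF n_pos irr cusp l L_linear(1)[OF lc] H_inv_L(1) v0(1) L1_nonzero[OF l(1) v0]
        L_linear(2)[OF lc] H_inv_L(2) w0] by blast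
  have "L2 l x v = \<gamma> * L1 l x v" if x: "x \<in> X n K" "x \<noteq> 0\<^sub>v n" and v: "v \<in> carrier_vec d" for x v
  proof -
    obtain k where k: "k \<in> GL_sub n K" "row e k = x" using row_transitive[OF x] by blast
    show ?thesis
      using L1_shift[OF k(1) e_X(1) v, of l] L2_shift[OF k(1) e_X(1) v, of l] k \<gamma>(2) rho_vec[OF irr GL_sub_GL[OF k(1)] v]
      by simp
  qed
  then show ?thesis using \<gamma>(1) by blast
qed

lemma zeta_L1:
  assumes l: "is_whittaker_functional n d rho chi l" and v: "v \<in> carrier_vec d"
  shows "of_nat (card (unip n K)) * zeta n K (whittaker_fun rho l v) phi = (\<Sum>x\<in>X n K. phi x * L1 l x v)"
proof -
  have inv: "whittaker_fun rho l v (u * g) = whittaker_fun rho l v g" if "u \<in> unip n K" "g \<in> GL_sub n K" for u g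
  proof -
    have "u \<in> N n" using that(1) by (simp add: unip_def)
    then show ?thesis
      using l rho_mult[OF irr unip_GL[OF that(1)] GL_sub_GL[OF that(2)] v] psiN_K[OF that(1)]
        rho_vec[OF irr GL_sub_GL[OF that(2)] v] by (simp add: whittaker_fun_def is_whittaker_functional_def)
  qed
  have "of_nat (card (unip n K)) * zeta n K (whittaker_fun rho l v) phi
      = (\<Sum>g\<in>GL_sub n K. (l \<bullet> (rho g *\<^sub>v v)) * phi (row e g))"
    unfolding whittaker_fun_def[symmetric] last_row[symmetric] by (rule zeta_sum[OF K inv])
  also have "\<dots> = (\<Sum>x\<in>X n K. \<Sum>g\<in>{g \<in> GL_sub n K. row e g = x}. (l \<bullet> (rho g *\<^sub>v v)) * phi (row e g))"
    using row_X[OF _ e_X(1)] by (intro sum.group[symmetric] mat_group_finite[OF H_group] finite_X) auto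
  also have "\<dots> = (\<Sum>x\<in>X n K. phi x * L1 l x v)"
    unfolding L1_def sum_distrib_left by (intro sum.cong refl) auto
  finally show ?thesis .
qed

text \<open>The twist sends left multiplication by N(F) to left multiplication by N(F), where the
  character is trivial; hence the sum over cosets is a sum over H, and the sums over
  \<open>x\<close> and \<open>g\<close> can be exchanged.\<close>

lemma zeta_L2:
  assumes l: "is_whittaker_functional n d rho chi l" and v: "v \<in> carrier_vec d"
  shows "of_nat (card (unip n K)) * zeta n K (wtilde n (whittaker_fun rho l v)) (fourier n K psi phi)
    = (\<Sum>x\<in>X n K. phi x * L2 l x v)"
proof -
  let ?W = "wtilde n (whittaker_fun rho l v)"
  have W: "?W g = l \<bullet> (rho (dual g) *\<^sub>v v)" for g by (simp add: wtilde_def whittaker_fun_def dual_def)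
  have inv: "?W (u * g) = ?W g" if u: "u \<in> unip n K" and g: "g \<in> GL_sub n K" for u g
  proof -
    let ?w = "antitr n (mat_inv n u)"
    have w: "?w \<in> unip n K" by (rule antitr_unip[OF mat_group_inv[OF mat_group_unip[OF K] u]])
    then have wN: "?w \<in> N n" by (simp add: unip_def)
    note gG = GL_sub_GL[OF g]
    show ?thesis
      unfolding W dual_mult[OF unip_GL[OF u] gG] using l wN psiN_K[OF w] rho_vec[OF irr dual_GL[OF gG] v]
        rho_mult[OF irr unip_GL[OF w] dual_GL[OF gG] v] by (simp add: is_whittaker_functional_def)
  qed
  have "of_nat (card (unip n K)) * zeta n K ?W (fourier n K psi phi)
      = (\<Sum>g\<in>GL_sub n K. (l \<bullet> (rho (dual g) *\<^sub>v v)) * fourier n K psi phi (row e g))"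
    unfolding W[symmetric] last_row[symmetric] by (rule zeta_sum[OF K inv])
  also have "\<dots> = (\<Sum>g\<in>GL_sub n K. \<Sum>x\<in>X n K. phi x * (psi (x \<bullet> row e g) * (l \<bullet> (rho (dual g) *\<^sub>v v))))"
    unfolding fourier_def Kvecs_X sum_distrib_left by (intro sum.cong refl) simp
  also have "\<dots> = (\<Sum>x\<in>X n K. phi x * L2 l x v)"
    unfolding L2_def sum_distrib_left by (rule sum.swap)
  finally show ?thesis .
qed

theorem functional_equation:
  "\<exists>\<gamma>::complex. \<gamma> \<noteq> 0 \<and> (\<forall>l v phi. is_whittaker_functional n d rho chi l \<and> l \<noteq> 0\<^sub>v d \<and>
     v \<in> carrier_vec d \<and> phi (0\<^sub>v n) = 0 \<longrightarrow>
     \<gamma> * zeta n K (whittaker_fun rho l v) phi = zeta n K (wtilde n (whittaker_fun rho l v)) (fourier n K psi phi))"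
proof (cases "\<exists>l. is_whittaker_functional n d rho chi l \<and> l \<noteq> 0\<^sub>v d")
  case True
  then obtain l0 where l0: "is_whittaker_functional n d rho chi l0" "l0 \<noteq> 0\<^sub>v d" by blast
  obtain \<gamma> where \<gamma>: "\<gamma> \<noteq> 0" "\<And>x v. x \<in> X n K \<Longrightarrow> v \<in> carrier_vec d \<Longrightarrow> x \<noteq> 0\<^sub>v n \<Longrightarrow> L2 l0 x v = \<gamma> * L1 l0 x v"
    using L_proportional[OF l0] by blast
  have "\<gamma> * zeta n K (whittaker_fun rho l v) phi = zeta n K (wtilde n (whittaker_fun rho l v)) (fourier n K psi phi)"
    if l: "is_whittaker_functional n d rho chi l" and v: "v \<in> carrier_vec d" and phi: "phi (0\<^sub>v n) = 0" for l v phi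
  proof -
    \<comment> \<open>Changing the Whittaker functional scales both sides by the same factor, so the
      constant found for \<open>l0\<close> serves every \<open>l\<close>.\<close>
    obtain c where c: "\<And>x. x \<in> carrier_vec d \<Longrightarrow> l \<bullet> x = c * (l0 \<bullet> x)" using whittaker_unique[OF irr l0 l] by blast
    have "L1 l x v = c * L1 l0 x v" "L2 l x v = c * L2 l0 x v" for x
      unfolding L1_def L2_def sum_distrib_left using c v rho_vec[OF irr GL_sub_GL v] rho_vec[OF irr dual_GL[OF GL_sub_GL] v]
      by (auto intro!: sum.cong)
    then have "phi x * L2 l x v = \<gamma> * (phi x * L1 l x v)" if "x \<in> X n K" for x
      using \<gamma>(2)[OF that v] phi by (cases "x = 0\<^sub>v n") auto
    then have "(\<Sum>x\<in>X n K. phi x * L2 l x v) = \<gamma> * (\<Sum>x\<in>X n K. phi x * L1 l x v)"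
      unfolding sum_distrib_left by (rule sum.cong[OF refl])
    then have "of_nat (card (unip n K)) * zeta n K (wtilde n (whittaker_fun rho l v)) (fourier n K psi phi)
        = of_nat (card (unip n K)) * (\<gamma> * zeta n K (whittaker_fun rho l v) phi)"
      using zeta_L1[OF l v, of phi] zeta_L2[OF l v, of phi] by (simp add: mult.left_commute[of _ \<gamma>])
    moreover have "card (unip n K) \<noteq> 0"
      using mat_group_finite[OF mat_group_unip[OF K]] mat_groupD(2)[OF mat_group_unip[OF K]] by auto
    ultimately show ?thesis by simp
  qed
  then show ?thesis using \<gamma>(1) by blast
next
  case False
  \<comment> \<open>With no nonzero Whittaker functional the equation is vacuous, and any nonzero
    constant will do.\<close>
  then show ?thesis by (intro exI[of _ 1] conjI) (simp, blast)
qed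

end

end

theorem theorem3p1:
  fixes q n d :: nat
    and psi :: "'e::{finite,field} \<Rightarrow> complex"
    and z :: 'e
    and rho :: "'e mat \<Rightarrow> complex mat"
  assumes card_E: "card (UNIV :: 'e set) = q ^ 2"
    and n_pos: "n \<ge> 1"
    and psi_nonzero: "\<forall>x\<in>Fsub q. psi x \<noteq> 0"
    and psi_add: "\<forall>x\<in>Fsub q. \<forall>y\<in>Fsub q. psi (x + y) = psi x * psi y"
    and psi_nontriv: "\<exists>x\<in>Fsub q. psi x \<noteq> 1"
    and z_notin_F: "z \<notin> Fsub q"
    and irred: "irreducible_rep n d rho"
    and cusp: "cuspidal_rep n d rho"
  shows "\<exists>\<gamma>::complex. \<gamma> \<noteq> 0 \<and>
    (\<forall>l v (phi :: 'e vec \<Rightarrow> complex).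
        is_whittaker_functional n d rho (psiE q z psi) l \<and> l \<noteq> 0\<^sub>v d \<and>
        v \<in> carrier_vec d \<and> phi (0\<^sub>v n) = 0 \<longrightarrow>
        \<gamma> * zeta n (Fsub q) (whittaker_fun rho l v) phi
          = zeta n (Fsub q) (wtilde n (whittaker_fun rho l v)) (fourier n (Fsub q) psi phi))"
proof -
  interpret quadratic_extension q psi z
    using assms by unfold_locales auto
  show ?thesis
    by (rule functional_equation[OF n_pos irred cusp])
       (use F_divide F_minus psi_add psi_0 psi_nontriv in auto)
qed

end
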